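(* Let $t$ and $k$ be natural numbers with $t\ge k\ge2$, and suppose that the real number $\mu$ satisfies $2t-\frac12k(k+1)<\mu\le 2t$ and $J_{t,k}(P)\ll_{t,k}P^{\mu}$ for all real $P\ge1$. For $s=t+l(k-1)$ with $l\in\mathbb N\cup\{0\}$, define $\lambda_s,\Delta_s,\theta_s$ and $\phi(j,s,J)$ recursively as follows. Put $\Delta_t=\mu+\frac12k(k+1)-2t$. For $s=t+l(k-1)$ with $l\ge1$: for each $j=1,\dots,k$, put $\phi(j,s,j)=1/k$, and for $J=j,j-1,\dots,2$ successively put $$\phi^*(j,s,J-1)=\frac1{2k}+\left(\frac12+\frac{\frac12(J-1)(J-2)-\Delta_{s-k+1}}{2k(k-J+1)}\right)\phi(j,s,J),\qquad \phi(j,s,J-1)=\min\{1/k,\phi^*(j,s,J-1)\}.$$ Then set $\theta_s=\min_{1\le j\le k}\phi(j,s,1)$, $\Delta_s=\Delta_{s-k+1}(1-\theta_s)+(k-1)(k\theta_s-1)$, and $\lambda_s=2s-\frac12k(k+1)+\Delta_s$. Then for each natural number $s=t+l(k-1)$ ($l\in\mathbb N$) one has $J_{s,k}(P)\ll P^{\lambda_s}$ for all real $P\ge1$, with implicit constant depending at most on $s,k,t,\mu$.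
   Context: $J_{s,k}(P)=\int_{[0,1)^k}\big|\sum_{1\le x\le P}e(\alpha_1x+\alpha_2x^2+\dots+\alpha_kx^k)\big|^{2s}d\boldsymbol\alpha$, where $e(z)=e^{2\pi iz}$; equivalently, the number of integral solutions of $\sum_{m=1}^s(x_m^i-y_m^i)=0$ $(1\le i\le k)$ with $1\le x_m,y_m\le P$. *)

theory Defs
  imports "HOL-Analysis.Analysis"
begin

definition e :: "real \<Rightarrow> complex" where
  "e z = exp (2 * complex_of_real pi * \<i> * complex_of_real z)"

text \<open>Points of \<open>[0,1)^k\<close> are extensional functions on \<open>{1..k}\<close>, with \<open>k\<close>-dimensional
  Lebesgue measure given by the finite product measure; \<open>P\<close> is real.\<close>

definition vinogradov_J :: "nat \<Rightarrow> nat \<Rightarrow> real \<Rightarrow> real" where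
  "vinogradov_J s k P =
     (LINT \<alpha>:(\<Pi>\<^sub>E i\<in>{1..k}. {0..<1})|(\<Pi>\<^sub>M i\<in>{1..k}. (lborel :: real measure)).
        cmod (\<Sum>x\<in>{x::nat. 1 \<le> x \<and> real x \<le> P}. e (\<Sum>i=1..k. \<alpha> i * real x ^ i)) ^ (2 * s))"

text \<open>The quantities attached to \<open>s = t + l(k-1)\<close> are indexed by \<open>l\<close>. The dependence of
  \<open>\<phi>(j,s,J)\<close> and \<open>\<theta>\<^sub>s\<close> on \<open>s\<close> is only through \<open>D = \<Delta>\<^bsub>s-k+1\<^esub>\<close>, the value at \<open>l - 1\<close>.

  \<open>phi_step k D J x\<close> is \<open>\<phi>*(j,s,J-1)\<close> for \<open>x = \<phi>(j,s,J)\<close>.\<close>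

definition phi_step :: "nat \<Rightarrow> real \<Rightarrow> nat \<Rightarrow> real \<Rightarrow> real" where
  "phi_step k D J x =
     1 / (2 * real k)
     + (1 / 2 + ((real J - 1) * (real J - 2) / 2 - D) / (2 * real k * (real k - real J + 1))) * x"

text \<open>Descending recursion in \<open>J\<close>, starting from \<open>J = j\<close>; only \<open>1 \<le> J \<le> j\<close> is meaningful.\<close>

function phi :: "nat \<Rightarrow> real \<Rightarrow> nat \<Rightarrow> nat \<Rightarrow> real" where
  "phi k D j J =
     (if j \<le> J then 1 / real k
      else min (1 / real k) (phi_step k D (J + 1) (phi k D j (J + 1))))"
  by pat_completeness auto
termination
  by (relation "Wellfounded.measure (\<lambda>(k, D, j, J). j - J)") auto

declare phi.simps [simp del]

definition theta :: "nat \<Rightarrow> real \<Rightarrow> real" where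
  "theta k D = Min ((\<lambda>j. phi k D j 1) ` {1..k})"

primrec Delta :: "nat \<Rightarrow> nat \<Rightarrow> real \<Rightarrow> nat \<Rightarrow> real" where
  "Delta t k \<mu> 0 = \<mu> + real k * (real k + 1) / 2 - 2 * real t"
| "Delta t k \<mu> (Suc l) =
     Delta t k \<mu> l * (1 - theta k (Delta t k \<mu> l))
     + (real k - 1) * (real k * theta k (Delta t k \<mu> l) - 1)"

definition lam :: "nat \<Rightarrow> nat \<Rightarrow> real \<Rightarrow> nat \<Rightarrow> real" where
  "lam t k \<mu> l = 2 * real (t + l * (k - 1)) - real k * (real k + 1) / 2 + Delta t k \<mu> l"

end

theory Submission
  imports Defs "HOL-Library.Real_Mod" "HOL-Computational_Algebra.Computational_Algebra"
    "HOL-Real_Asymp.Real_Asymp" "HOL-Number_Theory.Cong"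
begin

text \<open>
  The proof is Wooley's repeated efficient differencing. Write \<open>u = s - k + 1\<close> and let \<open>q\<close> be a prime of
  size \<open>P\<^sup>\<theta>\<close> modulo which the variables on either side are distinct. The \<open>k\<close> equations, read modulo
  \<open>q\<close>, leave \<open>O(q\<^bsup>2s-k\<^esup>)\<close> possibilities for the residues of all \<open>2s\<close> variables, and Hoelder's
  inequality makes \<open>2u\<close> of the variables congruent to a single \<open>c\<close>. After a translation by \<open>c\<close> the
  other \<open>k - 1\<close> variables on each side satisfy congruences modulo \<open>q\<^sup>j\<close> for \<open>2 \<le> j \<le> k\<close>, and at the
  cost of a factor \<open>q\<^bsup>(k-1)(k-2)/2\<^esup>\<close> Hensel lifting gives \<open>x\<^sub>i \<equiv> y\<^sub>i\<close> modulo \<open>q\<^sup>k\<close>. Counting the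
  residues of all the variables together, rather than of the \<open>2u\<close> variables alone, saves a factor \<open>q\<close>;
  this is why \<open>k - 1\<close> differenced variables suffice.

  Writing \<open>x\<^sub>i = y\<^sub>i + h q\<^sup>k\<close>, the terms with \<open>h = 0\<close> contribute \<open>P\<^bsup>k-1\<^esup> J\<^sub>u(P/q)\<close>. The others lead to a
  system of polynomials whose degrees have dropped by one, to which the argument is applied again with
  a new prime. At stage \<open>d\<close> the equations of index at most \<open>d\<close> involve only the \<open>2u\<close> variables, which
  saves a factor \<open>q\<^sup>d\<close>. The recursion for \<open>\<phi>(j,s,J)\<close> says that the terms with \<open>h = 0\<close> dominate at
  every stage; with \<open>\<phi> = 1/k\<close> there are no others.
\<close>

section \<open>Solution counts\<close>

definition collisions :: "nat \<Rightarrow> ('a \<Rightarrow> nat \<Rightarrow> int) \<Rightarrow> 'a set \<Rightarrow> ('a \<times> 'a) set" where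
  "collisions k V A = {(x, y) \<in> A \<times> A. \<forall>j\<in>{1..k}. V x j = V y j}"

definition energy :: "nat \<Rightarrow> ('a \<Rightarrow> nat \<Rightarrow> int) \<Rightarrow> 'a set \<Rightarrow> nat" where
  "energy k V A = card (collisions k V A)"

definition tuple_sum :: "nat \<Rightarrow> ('a \<Rightarrow> nat \<Rightarrow> int) \<Rightarrow> (nat \<Rightarrow> 'a) \<Rightarrow> nat \<Rightarrow> int" where
  "tuple_sum r v x j = (\<Sum>i<r. v (x i) j)"

definition joint_sum :: "('a \<Rightarrow> nat \<Rightarrow> int) \<Rightarrow> ('b \<Rightarrow> nat \<Rightarrow> int) \<Rightarrow> 'a \<times> 'b \<Rightarrow> nat \<Rightarrow> int" where
  "joint_sum V U = (\<lambda>(x, z) j. V x j + U z j)"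

abbreviation tuples :: "nat \<Rightarrow> 'a set \<Rightarrow> (nat \<Rightarrow> 'a) set" where
  "tuples n X \<equiv> {..<n} \<rightarrow>\<^sub>E X"

lemma joint_sum_Pair [simp]: "joint_sum V U (x, z) j = V x j + U z j"
  by (simp add: joint_sum_def)

lemma finite_tuples [intro]: "finite X \<Longrightarrow> finite (tuples n X)"
  by (intro finite_PiE) auto

lemma finite_collisions: "finite A \<Longrightarrow> finite (collisions k V A)"
  by (rule finite_subset[of _ "A \<times> A"]) (auto simp: collisions_def)

lemma energy_mono:
  assumes "finite B" "A \<subseteq> B"
  shows "energy k V A \<le> energy k V B"
  unfolding energy_def using assms
  by (intro card_mono finite_collisions) (auto simp: collisions_def)

lemma energy_le_inj:
  assumes "finite B" "inj_on f A" "f ` A \<subseteq> B"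
    and "\<And>x y. x \<in> A \<Longrightarrow> y \<in> A \<Longrightarrow> \<forall>j\<in>{1..k}. V x j = V y j \<Longrightarrow> \<forall>j\<in>{1..k}. V' (f x) j = V' (f y) j"
  shows "energy k V A \<le> energy k V' B"
  unfolding energy_def
proof (rule card_inj_on_le[where f = "map_prod f f"])
  show "inj_on (map_prod f f) (collisions k V A)"
    using assms(2) by (auto simp: inj_on_def collisions_def)
  show "map_prod f f ` collisions k V A \<subseteq> collisions k V' B"
    using assms(3,4) by (auto simp: collisions_def)
qed (intro finite_collisions assms(1))

lemma card_le_energy:
  assumes "finite A"
  shows "card A \<le> energy k V A"
  unfolding energy_def
proof (rule card_inj_on_le[where f = "\<lambda>x. (x, x)"])
  show "(\<lambda>x. (x, x)) ` A \<subseteq> collisions k V A" by (auto simp: collisions_def)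
qed (auto simp: inj_on_def finite_collisions assms)

lemma card_Collect_nested_eq_sum:
  assumes "finite A"
  shows "card {x \<in> A. P x} = (\<Sum>a\<in>g ` {x \<in> A. P x}. card {x \<in> A. P x \<and> g x = a})"
proof -
  have "{x \<in> A. P x} = (\<Union>a\<in>g ` {x \<in> A. P x}. {x \<in> A. P x \<and> g x = a})" by auto
  thus ?thesis using assms by (subst card_UN_disjoint[symmetric]) auto
qed

definition profile :: "nat \<Rightarrow> ('a \<Rightarrow> nat \<Rightarrow> int) \<Rightarrow> 'a \<Rightarrow> nat \<Rightarrow> int" where
  "profile k V x = restrict (V x) {1..k}"

lemma profile_eq_iff: "profile k V x = profile k V y \<longleftrightarrow> (\<forall>j\<in>{1..k}. V x j = V y j)"
  unfolding profile_def by (metis (no_types, lifting) restrict_apply' restrict_ext)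

lemma collisions_eq_profile: "collisions k V A = {(x, y) \<in> A \<times> A. profile k V x = profile k V y}"
  by (simp only: collisions_def profile_eq_iff)

lemma energy_eq_sum_squares:
  assumes "finite A" "finite N" "profile k V ` A \<subseteq> N"
  shows "energy k V A = (\<Sum>n\<in>N. card {x \<in> A. profile k V x = n} ^ 2)"
proof -
  let ?F = "\<lambda>n. {x \<in> A. profile k V x = n}"
  have "collisions k V A = (\<Union>n\<in>N. ?F n \<times> ?F n)"
    using assms(3) by (auto simp: collisions_eq_profile)
  also have "card \<dots> = (\<Sum>n\<in>N. card (?F n \<times> ?F n))"
    using assms by (intro card_UN_disjoint) auto
  finally show ?thesis by (simp add: energy_def power2_eq_square card_cartesian_product)
qed

lemma sum_power2_le_card_mult_sum:
  fixes f :: "'a \<Rightarrow> nat"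
  shows "(\<Sum>i\<in>I. f i) ^ 2 \<le> card I * (\<Sum>i\<in>I. f i ^ 2)"
proof -
  have "real ((\<Sum>i\<in>I. f i) ^ 2) \<le> real (card I * (\<Sum>i\<in>I. f i ^ 2))"
    using sum_squared_le_sum_of_squares[of "\<lambda>i. real (f i)" I] by (simp add: mult.commute)
  thus ?thesis by (simp only: of_nat_le_iff)
qed

lemma energy_UN_le:
  assumes "finite I" "\<And>i. i \<in> I \<Longrightarrow> finite (A i)"
  shows "energy k V (\<Union>i\<in>I. A i) \<le> card I * (\<Sum>i\<in>I. energy k V (A i))"
proof -
  let ?U = "\<Union>i\<in>I. A i" and ?F = "\<lambda>i n. {x \<in> A i. profile k V x = n}"
  let ?N = "profile k V ` ?U"
  have finU: "finite ?U" using assms by auto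
  have "energy k V ?U = (\<Sum>n\<in>?N. card {x \<in> ?U. profile k V x = n} ^ 2)"
    using finU by (intro energy_eq_sum_squares) auto
  also have "\<dots> \<le> (\<Sum>n\<in>?N. card I * (\<Sum>i\<in>I. card (?F i n) ^ 2))"
  proof (rule sum_mono)
    fix n
    have "{x \<in> ?U. profile k V x = n} = (\<Union>i\<in>I. ?F i n)" by auto
    hence "card {x \<in> ?U. profile k V x = n} \<le> (\<Sum>i\<in>I. card (?F i n))"
      using assms(1) by (simp add: card_UN_le)
    hence "card {x \<in> ?U. profile k V x = n} ^ 2 \<le> (\<Sum>i\<in>I. card (?F i n)) ^ 2"
      by (intro power_mono) auto
    also have "\<dots> \<le> card I * (\<Sum>i\<in>I. card (?F i n) ^ 2)"
      by (rule sum_power2_le_card_mult_sum)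
    finally show "card {x \<in> ?U. profile k V x = n} ^ 2 \<le> \<dots>" .
  qed
  also have "\<dots> = card I * (\<Sum>i\<in>I. \<Sum>n\<in>?N. card (?F i n) ^ 2)"
    unfolding sum_distrib_left[symmetric] by (subst sum.swap) (rule refl)
  also have "(\<Sum>i\<in>I. \<Sum>n\<in>?N. card (?F i n) ^ 2) = (\<Sum>i\<in>I. energy k V (A i))"
    using assms finU by (intro sum.cong refl energy_eq_sum_squares[symmetric]) auto
  finally show ?thesis .
qed

lemma energy_le_cover:
  fixes \<beta> :: real
  assumes "finite I" "\<And>i. i \<in> I \<Longrightarrow> finite (S i)" "A \<subseteq> (\<Union>i\<in>I. S i)"
    and \<beta>: "\<And>i. i \<in> I \<Longrightarrow> real (energy k V (S i)) \<le> \<beta>"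
  shows "real (energy k V A) \<le> real (card I) ^ 2 * \<beta>"
proof -
  have "energy k V A \<le> energy k V (\<Union>i\<in>I. S i)" using assms(1-3) by (intro energy_mono finite_UN_I)
  also have "\<dots> \<le> card I * (\<Sum>i\<in>I. energy k V (S i))" using assms(1,2) by (rule energy_UN_le)
  finally have "real (energy k V A) \<le> real (card I * (\<Sum>i\<in>I. energy k V (S i)))" by (simp only: of_nat_le_iff)
  also have "\<dots> = real (card I) * (\<Sum>i\<in>I. real (energy k V (S i)))" by simp
  also have "\<dots> \<le> real (card I) * (real (card I) * \<beta>)" using \<beta> by (intro mult_left_mono sum_bounded_above) auto
  finally show ?thesis by (simp add: power2_eq_square)
qed

lemma energy_Un_le:
  assumes "finite A" "finite B"
  shows "energy k V (A \<union> B) \<le> 2 * (energy k V A + energy k V B)"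
proof -
  let ?S = "\<lambda>b. if b then A else B"
  have "energy k V (\<Union>b\<in>UNIV. ?S b) \<le> card (UNIV :: bool set) * (\<Sum>b\<in>UNIV. energy k V (?S b))"
    using assms by (intro energy_UN_le) auto
  thus ?thesis by (simp add: UNIV_bool Un_commute)
qed

lemma energy_le_fibres:
  assumes "finite A"
    and few_classes: "\<And>x. x \<in> A \<Longrightarrow> card (g ` {y \<in> A. \<forall>j\<in>{1..k}. V y j = V x j}) \<le> D"
  shows "energy k V A \<le> D * (\<Sum>a\<in>g ` A. energy k V {x \<in> A. g x = a})"
proof -
  let ?N = "profile k V ` A"
  let ?F = "\<lambda>n. {x \<in> A. profile k V x = n}" and ?c = "\<lambda>n a. card {x \<in> A. profile k V x = n \<and> g x = a}"
  have "energy k V A = (\<Sum>n\<in>?N. card (?F n) ^ 2)"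
    using assms(1) by (intro energy_eq_sum_squares) auto
  also have "\<dots> \<le> (\<Sum>n\<in>?N. D * (\<Sum>a\<in>g ` A. ?c n a ^ 2))"
  proof (rule sum_mono)
    fix n assume "n \<in> ?N"
    then obtain x where x: "x \<in> A" "n = profile k V x" by auto
    have "card (?F n) ^ 2 = (\<Sum>a\<in>g ` ?F n. ?c n a) ^ 2"
      using card_Collect_nested_eq_sum[OF assms(1), of "\<lambda>x. profile k V x = n" g] by simp
    also have "\<dots> \<le> card (g ` ?F n) * (\<Sum>a\<in>g ` ?F n. ?c n a ^ 2)"
      by (rule sum_power2_le_card_mult_sum)
    also have "\<dots> \<le> D * (\<Sum>a\<in>g ` A. ?c n a ^ 2)"
      using assms(1) few_classes[OF x(1)] x(2)
      by (intro mult_mono sum_mono2) (auto simp: profile_eq_iff)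
    finally show "card (?F n) ^ 2 \<le> \<dots>" .
  qed
  also have "\<dots> = D * (\<Sum>a\<in>g ` A. \<Sum>n\<in>?N. ?c n a ^ 2)"
    unfolding sum_distrib_left[symmetric] by (subst sum.swap) (rule refl)
  also have "(\<Sum>a\<in>g ` A. \<Sum>n\<in>?N. ?c n a ^ 2) = (\<Sum>a\<in>g ` A. energy k V {x \<in> A. g x = a})"
  proof (intro sum.cong refl)
    fix a
    have "energy k V {x \<in> A. g x = a} = (\<Sum>n\<in>?N. card {x \<in> {x \<in> A. g x = a}. profile k V x = n} ^ 2)"
      using assms(1) by (intro energy_eq_sum_squares) auto
    also have "\<dots> = (\<Sum>n\<in>?N. ?c n a ^ 2)"
      by (intro sum.cong refl arg_cong[of _ _ "\<lambda>S. card S ^ 2"]) auto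
    finally show "(\<Sum>n\<in>?N. ?c n a ^ 2) = energy k V {x \<in> A. g x = a}" ..
  qed
  finally show ?thesis .
qed

lemma sum_energy_fibres:
  assumes "finite A"
  shows "(\<Sum>a\<in>g ` A. energy k V {x \<in> A. g x = a}) = card {(x, y) \<in> collisions k V A. g x = g y}"
proof -
  have "{(x, y) \<in> collisions k V A. g x = g y} = (\<Union>a\<in>g ` A. collisions k V {x \<in> A. g x = a})"
    by (auto simp: collisions_def)
  moreover have "card (\<Union>a\<in>g ` A. collisions k V {x \<in> A. g x = a}) = (\<Sum>a\<in>g ` A. card (collisions k V {x \<in> A. g x = a}))"
    using assms by (intro card_UN_disjoint ballI impI finite_collisions) (auto simp: collisions_def)
  ultimately show ?thesis by (simp add: energy_def)
qed

section \<open>Exponential sums\<close>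

definition torus_char :: "nat \<Rightarrow> nat \<Rightarrow> (nat \<Rightarrow> nat) \<Rightarrow> (nat \<Rightarrow> int) \<Rightarrow> complex" where
  "torus_char k M a v = (\<Prod>j\<in>{1..k}. cis (2 * pi * real (a j) * of_int (v j) / real M))"

text \<open>Only finitely many frequencies occur at a time, so integrals over the torus may be replaced by
  means over the points \<open>a / M\<close> for a single large \<open>M\<close>.\<close>

definition torus_mean :: "nat \<Rightarrow> nat \<Rightarrow> ((nat \<Rightarrow> nat) \<Rightarrow> 'a) \<Rightarrow> 'a::field" where
  "torus_mean k M g = (\<Sum>a\<in>{1..k} \<rightarrow>\<^sub>E {..<M}. g a) / of_nat (M ^ k)"

definition exp_sum :: "nat \<Rightarrow> nat \<Rightarrow> ('i \<Rightarrow> nat \<Rightarrow> int) \<Rightarrow> 'i set \<Rightarrow> (nat \<Rightarrow> nat) \<Rightarrow> complex" where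
  "exp_sum k M V A a = (\<Sum>x\<in>A. torus_char k M a (V x))"

lemma torus_char_add: "torus_char k M a (\<lambda>j. v j + w j) = torus_char k M a v * torus_char k M a w"
  by (simp add: torus_char_def prod.distrib[symmetric] cis_mult distrib_left add_divide_distrib)

lemma torus_char_zero: "(\<And>j. j \<in> {1..k} \<Longrightarrow> v j = 0) \<Longrightarrow> torus_char k M a v = 1"
  by (simp add: torus_char_def)

lemma torus_char_uminus: "torus_char k M a (\<lambda>j. - v j) = cnj (torus_char k M a v)"
  by (simp add: torus_char_def cis_cnj)

lemma torus_char_cong: "(\<And>j. j \<in> {1..k} \<Longrightarrow> v j = w j) \<Longrightarrow> torus_char k M a v = torus_char k M a w"
  by (simp add: torus_char_def)

lemma norm_torus_char [simp]: "cmod (torus_char k M a v) = 1"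
  by (simp add: torus_char_def prod_norm[symmetric])

lemma torus_char_sum: "torus_char k M a (\<lambda>j. \<Sum>i\<in>I. v i j) = (\<Prod>i\<in>I. torus_char k M a (v i))"
  by (induction I rule: infinite_finite_induct) (simp_all add: torus_char_add torus_char_zero)

lemma sum_cis_eq_if:
  fixes n :: int
  assumes "M > 0" "\<bar>n\<bar> < int M"
  shows "(\<Sum>b<M. cis (2 * pi * real b * of_int n / real M)) = (if n = 0 then of_nat M else 0)"
proof (cases "n = 0")
  case False
  define w where "w = cis (2 * pi * of_int n / real M)"
  have "w \<noteq> 1"
  proof
    assume "w = 1"
    then obtain m :: int where "2 * pi * of_int n / real M = of_int m * (2 * pi)"
      unfolding w_def cis_eq_1_iff by blast
    hence "real_of_int n = of_int (m * int M)"
      using assms(1) by (simp add: field_simps)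
    hence "int M dvd n" by (simp only: of_int_eq_iff dvd_triv_right)
    with False assms(2) show False
      using zdvd_imp_le[of "int M" "\<bar>n\<bar>"] by auto
  qed
  moreover have "w ^ M = 1"
    using assms(1) cis_multiple_2pi[of "of_int n"] by (simp add: w_def Complex.DeMoivre)
  ultimately have "(\<Sum>b<M. w ^ b) = 0"
    using sum_gp_strict[of w M] by auto
  moreover have "w ^ b = cis (2 * pi * real b * of_int n / real M)" for b
    by (simp add: w_def Complex.DeMoivre mult_ac)
  ultimately show ?thesis using False by simp
qed simp

lemma torus_mean_char:
  assumes "M > 0" "\<And>j. j \<in> {1..k} \<Longrightarrow> \<bar>v j\<bar> < int M"
  shows "torus_mean k M (\<lambda>a. torus_char k M a v) = (if \<forall>j\<in>{1..k}. v j = 0 then 1 else 0)"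
proof -
  have "(\<Sum>a\<in>{1..k} \<rightarrow>\<^sub>E {..<M}. torus_char k M a v)
      = (\<Prod>j\<in>{1..k}. \<Sum>b<M. cis (2 * pi * real b * of_int (v j) / real M))"
    unfolding torus_char_def by (rule prod_sum_PiE[symmetric]) auto
  also have "\<dots> = (\<Prod>j\<in>{1..k}. if v j = 0 then of_nat M else 0)"
    by (intro prod.cong refl sum_cis_eq_if assms) auto
  also have "\<dots> = (if \<forall>j\<in>{1..k}. v j = 0 then of_nat M ^ k else 0)"
    by auto
  finally show ?thesis using assms(1) by (auto simp: torus_mean_def)
qed

lemma torus_mean_sum: "torus_mean k M (\<lambda>a. \<Sum>x\<in>A. g x a) = (\<Sum>x\<in>A. torus_mean k M (g x))"
  unfolding torus_mean_def by (subst sum.swap) (simp add: sum_divide_distrib)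

lemma torus_mean_add: "torus_mean k M (\<lambda>a. g a + h a) = torus_mean k M g + torus_mean k M h"
  by (simp add: torus_mean_def sum.distrib add_divide_distrib)

lemma torus_mean_cmult: "torus_mean k M (\<lambda>a. c * g a) = c * torus_mean k M g"
  by (simp add: torus_mean_def sum_distrib_left[symmetric])

lemma torus_mean_mono:
  fixes g h :: "(nat \<Rightarrow> nat) \<Rightarrow> real"
  assumes "\<And>a. g a \<le> h a"
  shows "torus_mean k M g \<le> torus_mean k M h"
  unfolding torus_mean_def by (intro divide_right_mono sum_mono assms) auto

lemma norm_torus_mean_le: "cmod (torus_mean k M g) \<le> torus_mean k M (\<lambda>a. cmod (g a))"
  unfolding torus_mean_def by (auto simp: norm_divide norm_power intro!: divide_right_mono norm_sum)

lemma torus_mean_of_real: "torus_mean k M (\<lambda>a. of_real (g a)) = (of_real (torus_mean k M g) :: complex)"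
  by (simp add: torus_mean_def)

lemma torus_mean_exp_sum:
  assumes "finite A"
  shows "\<forall>\<^sub>F M in sequentially. torus_mean k M (exp_sum k M V A)
            = of_nat (card {x \<in> A. \<forall>j\<in>{1..k}. V x j = 0})"
proof -
  have "\<forall>\<^sub>F M in sequentially. \<forall>x\<in>A. \<forall>j\<in>{1..k}. \<bar>V x j\<bar> < int M"
  proof (intro eventually_ball_finite ballI assms)
    fix x j
    show "\<forall>\<^sub>F M in sequentially. \<bar>V x j\<bar> < int M"
      using eventually_gt_at_top[of "nat \<bar>V x j\<bar>"] by eventually_elim linarith
  qed auto
  thus ?thesis using eventually_gt_at_top[of 0]
  proof eventually_elim
    case (elim M)
    have "torus_mean k M (exp_sum k M V A) = (\<Sum>x\<in>A. torus_mean k M (\<lambda>a. torus_char k M a (V x)))"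
      unfolding exp_sum_def by (rule torus_mean_sum)
    also have "\<dots> = (\<Sum>x\<in>A. if \<forall>j\<in>{1..k}. V x j = 0 then 1 else 0)"
      using elim by (intro sum.cong refl torus_mean_char) auto
    also have "\<dots> = of_nat (card {x \<in> A. \<forall>j\<in>{1..k}. V x j = 0})"
      using assms by (simp add: sum.If_cases Int_def)
    finally show ?case .
  qed
qed

lemma exp_sum_joint_sum:
  "exp_sum k M (joint_sum V W) (A \<times> B) a = exp_sum k M V A a * exp_sum k M W B a"
  by (simp add: exp_sum_def joint_sum_def sum_product sum.cartesian_product case_prod_unfold torus_char_add)

lemma exp_sum_uminus: "exp_sum k M (\<lambda>x j. - V x j) A a = cnj (exp_sum k M V A a)"
  by (simp add: exp_sum_def torus_char_uminus)

lemma exp_sum_diff: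
  "exp_sum k M (\<lambda>(x, y) j. V x j - V y j) (A \<times> A) a = of_real (cmod (exp_sum k M V A a) ^ 2)"
proof -
  have "(\<lambda>(x, y) j. V x j - V y j) = joint_sum V (\<lambda>y j. - V y j)"
    by (simp add: joint_sum_def)
  thus ?thesis
    by (simp only: exp_sum_joint_sum exp_sum_uminus complex_norm_square)
qed

lemma exp_sum_PiE:
  assumes "\<And>i. i < r \<Longrightarrow> finite (Z i)"
  shows "exp_sum k M (tuple_sum r v) (PiE {..<r} Z) a = (\<Prod>i<r. exp_sum k M v (Z i) a)"
proof -
  have "torus_char k M a (tuple_sum r v x) = (\<Prod>i<r. torus_char k M a (v (x i)))" for x
    using torus_char_sum[where v = "\<lambda>i. v (x i)"] by (simp add: tuple_sum_def[abs_def])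
  thus ?thesis unfolding exp_sum_def using assms by (subst prod_sum_PiE) auto
qed

lemma exp_sum_tuples:
  assumes "finite X"
  shows "exp_sum k M (tuple_sum r v) (tuples r X) a = exp_sum k M v X a ^ r"
  using assms by (simp add: exp_sum_PiE)

lemma torus_mean_energy:
  assumes "finite A"
  shows "\<forall>\<^sub>F M in sequentially. torus_mean k M (\<lambda>a. cmod (exp_sum k M V A a) ^ 2) = real (energy k V A)"
proof -
  let ?D = "\<lambda>(x, y) j. V x j - V y j"
  have zeros: "{p \<in> A \<times> A. \<forall>j\<in>{1..k}. ?D p j = 0} = collisions k V A"
    by (auto simp: collisions_def)
  have "\<forall>\<^sub>F M in sequentially. torus_mean k M (exp_sum k M ?D (A \<times> A)) = of_nat (energy k V A)"
    unfolding energy_def zeros[symmetric] using assms by (intro torus_mean_exp_sum) auto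
  thus ?thesis
  proof eventually_elim
    case (elim M)
    have "torus_mean k M (\<lambda>a. of_real (cmod (exp_sum k M V A a) ^ 2)) = torus_mean k M (exp_sum k M ?D (A \<times> A))"
      by (intro arg_cong[of _ _ "torus_mean k M"] ext exp_sum_diff[symmetric])
    also have "\<dots> = complex_of_real (real (energy k V A))"
      using elim by simp
    finally show ?case by (simp only: torus_mean_of_real of_real_eq_iff)
  qed
qed

lemma card_zeros_le:
  assumes "finite A" "finite B" "finite I" "\<And>i. i \<in> I \<Longrightarrow> finite (C i)"
    and bound: "\<And>M a. cmod (exp_sum k M V A a)
      \<le> \<beta> * cmod (exp_sum k M U B a) ^ 2 + (\<Sum>i\<in>I. \<gamma> i * cmod (exp_sum k M (W i) (C i) a) ^ 2)"
  shows "real (card {x \<in> A. \<forall>j\<in>{1..k}. V x j = 0})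
    \<le> \<beta> * real (energy k U B) + (\<Sum>i\<in>I. \<gamma> i * real (energy k (W i) (C i)))"
proof -
  have "\<forall>\<^sub>F M in sequentially. \<forall>i\<in>I. torus_mean k M (\<lambda>a. cmod (exp_sum k M (W i) (C i) a) ^ 2)
      = real (energy k (W i) (C i))"
    using assms by (intro eventually_ball_finite ballI torus_mean_energy) auto
  with torus_mean_exp_sum[OF assms(1), of k V] torus_mean_energy[OF assms(2), of k U]
  have "\<forall>\<^sub>F M in sequentially. real (card {x \<in> A. \<forall>j\<in>{1..k}. V x j = 0})
    \<le> \<beta> * real (energy k U B) + (\<Sum>i\<in>I. \<gamma> i * real (energy k (W i) (C i)))"
  proof eventually_elim
    case (elim M)
    have "real (card {x \<in> A. \<forall>j\<in>{1..k}. V x j = 0}) = cmod (torus_mean k M (exp_sum k M V A))"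
      unfolding elim(1) by simp
    also have "\<dots> \<le> torus_mean k M (\<lambda>a. cmod (exp_sum k M V A a))" by (rule norm_torus_mean_le)
    also have "\<dots> \<le> torus_mean k M (\<lambda>a. \<beta> * cmod (exp_sum k M U B a) ^ 2
        + (\<Sum>i\<in>I. \<gamma> i * cmod (exp_sum k M (W i) (C i) a) ^ 2))"
      by (intro torus_mean_mono bound)
    also have "\<dots> = \<beta> * real (energy k U B) + (\<Sum>i\<in>I. \<gamma> i * real (energy k (W i) (C i)))"
      using elim(2,3) by (simp only: torus_mean_add torus_mean_sum torus_mean_cmult cong: sum.cong)
    finally show ?case .
  qed
  thus ?thesis by (auto dest: eventually_happens)
qed

lemma energy_le_exp_sum_bound:
  assumes "finite A" "finite B" "finite I" "\<And>i. i \<in> I \<Longrightarrow> finite (C i)"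
    and bound: "\<And>M a. cmod (exp_sum k M V A a) ^ 2
      \<le> \<beta> * cmod (exp_sum k M U B a) ^ 2 + (\<Sum>i\<in>I. \<gamma> i * cmod (exp_sum k M (W i) (C i) a) ^ 2)"
  shows "real (energy k V A) \<le> \<beta> * real (energy k U B) + (\<Sum>i\<in>I. \<gamma> i * real (energy k (W i) (C i)))"
proof -
  let ?D = "\<lambda>(x, y) j. V x j - V y j"
  have "collisions k V A = {p \<in> A \<times> A. \<forall>j\<in>{1..k}. ?D p j = 0}"
    by (auto simp: collisions_def)
  moreover have "cmod (exp_sum k M ?D (A \<times> A) a)
      \<le> \<beta> * cmod (exp_sum k M U B a) ^ 2 + (\<Sum>i\<in>I. \<gamma> i * cmod (exp_sum k M (W i) (C i) a) ^ 2)" for M a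
    unfolding exp_sum_diff norm_of_real using bound by simp
  ultimately show ?thesis
    unfolding energy_def using assms card_zeros_le[of "A \<times> A" B I C k ?D \<beta> U \<gamma> W] by (simp add: energy_def)
qed

lemma prod_le_sum_powers:
  fixes t :: "'i \<Rightarrow> real"
  assumes "finite I" "I \<noteq> {}" "\<And>i. i \<in> I \<Longrightarrow> 0 \<le> t i"
  shows "(\<Prod>i\<in>I. t i) \<le> (\<Sum>i\<in>I. t i ^ card I)"
proof -
  have "Max (t ` I) \<in> t ` I" using assms by (intro Max_in) auto
  then obtain m where m: "m \<in> I" "t m = Max (t ` I)" by auto
  have "(\<Prod>i\<in>I. t i) \<le> (\<Prod>i\<in>I. t m)"
    using assms by (intro prod_mono) (auto simp: m(2))
  also have "\<dots> = t m ^ card I" by simp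
  also have "\<dots> \<le> (\<Sum>i\<in>I. t i ^ card I)"
    using assms m(1) by (intro member_le_sum) auto
  finally show ?thesis .
qed

lemma energy_Holder:
  assumes "finite A" "\<And>m. m < u \<Longrightarrow> finite (Z m)" "u > 0"
  shows "energy k (joint_sum V (tuple_sum u v)) (A \<times> PiE {..<u} Z)
       \<le> (\<Sum>m<u. energy k (joint_sum V (tuple_sum u v)) (A \<times> tuples u (Z m)))"
proof -
  let ?V = "joint_sum V (tuple_sum u v)"
  have "real (energy k ?V (A \<times> PiE {..<u} Z))
      \<le> 0 * real (energy k ?V {}) + (\<Sum>m<u. 1 * real (energy k ?V (A \<times> tuples u (Z m))))"
  proof (rule energy_le_exp_sum_bound)
    fix M a
    let ?s = "cmod (exp_sum k M V A a) ^ 2" and ?t = "\<lambda>m. cmod (exp_sum k M v (Z m) a) ^ 2"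
    have "cmod (exp_sum k M ?V (A \<times> PiE {..<u} Z) a) ^ 2 = ?s * (\<Prod>m<u. ?t m)"
      using assms(2) by (simp add: exp_sum_joint_sum exp_sum_PiE norm_mult prod_norm[symmetric]
          power_mult_distrib prod_power_distrib)
    also have "\<dots> \<le> ?s * (\<Sum>m<u. ?t m ^ u)"
      using prod_le_sum_powers[of "{..<u}" ?t] assms(3) by (intro mult_left_mono) auto
    also have "\<dots> = (\<Sum>m<u. cmod (exp_sum k M ?V (A \<times> tuples u (Z m)) a) ^ 2)"
      using assms(2) by (simp add: exp_sum_joint_sum exp_sum_tuples norm_mult norm_power sum_distrib_left
          power_mult_distrib power_mult[symmetric] mult.commute)
    finally show "cmod (exp_sum k M ?V (A \<times> PiE {..<u} Z) a) ^ 2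
        \<le> 0 * cmod (exp_sum k M ?V {} a) ^ 2 + (\<Sum>m<u. 1 * cmod (exp_sum k M ?V (A \<times> tuples u (Z m)) a) ^ 2)"
      by simp
  qed (use assms in \<open>auto intro!: finite_PiE\<close>)
  thus ?thesis by (simp flip: of_nat_sum)
qed

lemma young_power:
  fixes N t \<kappa> :: real
  assumes "0 \<le> N" "0 \<le> t" "1 \<le> \<kappa>" "2 \<le> r"
  shows "N ^ 2 * t ^ (r - 2) \<le> t ^ r / \<kappa> ^ 2 + (\<kappa> * N) ^ r"
proof -
  have r: "r = 2 + (r - 2)" using assms(4) by simp
  show ?thesis
  proof (cases "\<kappa> * N \<le> t")
    case True
    have "(\<kappa> * N) ^ 2 * t ^ (r - 2) \<le> t ^ 2 * t ^ (r - 2)"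
      using assms True by (intro mult_right_mono power_mono) auto
    also have "\<dots> = t ^ r" unfolding power_add[symmetric] using r by simp
    finally have "N ^ 2 * t ^ (r - 2) \<le> t ^ r / \<kappa> ^ 2"
      using assms(3) by (simp add: pos_le_divide_eq power_mult_distrib mult_ac)
    thus ?thesis using assms by (simp add: add_increasing2)
  next
    case False
    have "N ^ 2 * t ^ (r - 2) \<le> (\<kappa> * N) ^ 2 * (\<kappa> * N) ^ (r - 2)"
      using assms False by (intro mult_mono power_mono) (auto simp: mult_le_cancel_right1)
    also have "\<dots> = (\<kappa> * N) ^ r" unfolding power_add[symmetric] using r by simp
    finally show ?thesis using assms by (simp add: add_increasing)
  qed
qed

lemma norm_exp_sum_equal_entries_le:
  assumes "finite X" "a < r" "b < r" "a \<noteq> b"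
  shows "cmod (exp_sum k M (tuple_sum r v) {x \<in> tuples r X. x a = x b} \<alpha>)
       \<le> real (card X) * cmod (exp_sum k M v X \<alpha>) ^ (r - 2)"
proof -
  let ?F = "cmod (exp_sum k M v X \<alpha>)"
  define T where "T t = PiE {..<r} (\<lambda>i. if i \<in> {a, b} then {t} else X)" for t
  have "{x \<in> tuples r X. x a = x b} = (\<Union>t\<in>X. T t)"
  proof (intro equalityI subsetI)
    fix x assume "x \<in> {x \<in> tuples r X. x a = x b}"
    thus "x \<in> (\<Union>t\<in>X. T t)"
      using assms(2,3) by (intro UN_I[of "x a"]) (auto simp: T_def PiE_iff)
  qed (use assms(2,3) in \<open>auto simp: T_def PiE_iff split: if_splits\<close>)
  moreover have "x a = t" if "x \<in> T t" for x t
    using PiE_mem[OF that[unfolded T_def], of a] assms(2) by simp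
  hence "\<forall>t\<in>X. \<forall>t'\<in>X. t \<noteq> t' \<longrightarrow> T t \<inter> T t' = {}" by blast
  moreover have "finite (T t)" for t
    unfolding T_def using assms(1) by (intro finite_PiE) auto
  ultimately have "exp_sum k M (tuple_sum r v) {x \<in> tuples r X. x a = x b} \<alpha>
      = (\<Sum>t\<in>X. exp_sum k M (tuple_sum r v) (T t) \<alpha>)"
    unfolding exp_sum_def using assms(1) by (simp add: sum.UNION_disjoint)
  also have "cmod \<dots> \<le> (\<Sum>t\<in>X. ?F ^ (r - 2))"
  proof (rule sum_norm_le)
    fix t
    have "cmod (exp_sum k M (tuple_sum r v) (T t) \<alpha>) = (\<Prod>i<r. if i \<in> {a, b} then 1 else ?F)"
      unfolding T_def using assms(1)
      by (subst exp_sum_PiE) (auto simp: prod_norm[symmetric] exp_sum_def intro!: prod.cong)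
    also have "\<dots> = ?F ^ card ({..<r} - {a, b})"
      by (subst prod.mono_neutral_cong_right[of _ "{..<r} - {a, b}" _ "\<lambda>_. ?F"]) auto
    also have "card ({..<r} - {a, b}) = r - 2"
      using assms by (subst card_Diff_subset) auto
    finally show "cmod (exp_sum k M (tuple_sum r v) (T t) \<alpha>) \<le> ?F ^ (r - 2)" by simp
  qed
  finally show ?thesis by simp
qed

lemma energy_equal_entries_le:
  fixes \<kappa> :: real
  assumes "finite X" "finite B" "a < r" "b < r" "a \<noteq> b" "1 \<le> \<kappa>"
  shows "real (energy k (joint_sum (tuple_sum r v) U) ({x \<in> tuples r X. x a = x b} \<times> B))
    \<le> real (energy k (joint_sum (tuple_sum r v) U) (tuples r X \<times> B)) / \<kappa> ^ 2
      + (\<kappa> * real (card X)) ^ r * real (energy k U B)"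
proof -
  let ?V = "joint_sum (tuple_sum r v) U" and ?S = "{x \<in> tuples r X. x a = x b}" and ?N = "real (card X)"
  have "real (energy k ?V (?S \<times> B)) \<le> (\<kappa> * ?N) ^ r * real (energy k U B)
      + (\<Sum>_\<in>{()}. (1 / \<kappa> ^ 2) * real (energy k ?V (tuples r X \<times> B)))"
  proof (rule energy_le_exp_sum_bound)
    fix M \<alpha>
    let ?F = "cmod (exp_sum k M v X \<alpha>)" and ?G = "cmod (exp_sum k M U B \<alpha>) ^ 2"
    have "cmod (exp_sum k M ?V (?S \<times> B) \<alpha>) ^ 2 = cmod (exp_sum k M (tuple_sum r v) ?S \<alpha>) ^ 2 * ?G"
      by (simp add: exp_sum_joint_sum norm_mult power_mult_distrib)
    also have "\<dots> \<le> (?N * ?F ^ (r - 2)) ^ 2 * ?G"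
      using assms by (intro mult_right_mono power_mono norm_exp_sum_equal_entries_le) auto
    also have "\<dots> = (?N ^ 2 * (?F ^ 2) ^ (r - 2)) * ?G"
      by (simp add: power_mult_distrib power_mult[symmetric] mult.commute)
    also have "\<dots> \<le> ((?F ^ 2) ^ r / \<kappa> ^ 2 + (\<kappa> * ?N) ^ r) * ?G"
      using assms by (intro mult_right_mono young_power) auto
    also have "\<dots> = (\<kappa> * ?N) ^ r * ?G + (1 / \<kappa> ^ 2) * cmod (exp_sum k M ?V (tuples r X \<times> B) \<alpha>) ^ 2"
      using assms(1) by (simp add: exp_sum_joint_sum exp_sum_tuples norm_mult norm_power
          power_mult_distrib power_mult[symmetric] algebra_simps)
    finally show "cmod (exp_sum k M ?V (?S \<times> B) \<alpha>) ^ 2 \<le> (\<kappa> * ?N) ^ r * ?G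
        + (\<Sum>_\<in>{()}. (1 / \<kappa> ^ 2) * cmod (exp_sum k M ?V (tuples r X \<times> B) \<alpha>) ^ 2)" by simp
  qed (use assms finite_tuples[OF assms(1)] in auto)
  thus ?thesis by simp
qed

lemma energy_joint_sum_le_distinct:
  fixes v :: "'a \<Rightarrow> nat \<Rightarrow> int"
  assumes "finite X" "finite B" "r > 0"
  shows "real (energy k (joint_sum (tuple_sum r v) U) (tuples r X \<times> B))
     \<le> 4 * real (energy k (joint_sum (tuple_sum r v) U) ({x \<in> tuples r X. inj_on x {..<r}} \<times> B))
       + (2 * real r ^ 2) ^ (r + 2) * real (card X) ^ r * real (energy k U B)"
proof -
  let ?E = "energy k (joint_sum (tuple_sum r v) U)"
  let ?T = "tuples r X \<times> B" and ?D = "{x \<in> tuples r X. inj_on x {..<r}} \<times> B"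
  let ?I = "{(a, b) \<in> {..<r} \<times> {..<r}. a \<noteq> b}"
  let ?S = "\<lambda>(a, b). {x \<in> tuples r X. x a = x b} \<times> B"
  define \<kappa> where "\<kappa> = 2 * real r ^ 2"
  define \<beta> where "\<beta> = real (?E ?T) / \<kappa> ^ 2 + (\<kappa> * real (card X)) ^ r * real (energy k U B)"
  have "1 \<le> real r ^ 2" using assms(3) by (intro one_le_power) auto
  hence \<kappa>: "\<kappa> \<ge> 1" by (simp add: \<kappa>_def)
  have finI: "finite ?I" by (rule finite_subset[of _ "{..<r} \<times> {..<r}"]) auto
  have finT: "finite ?T" using assms by auto
  have finS: "finite (?S p)" for p by (rule finite_subset[OF _ finT]) (auto split: prod.splits)
  have finD: "finite ?D" by (rule finite_subset[OF _ finT]) auto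
  have "card ?I \<le> card ({..<r} \<times> {..<r})" by (intro card_mono) auto
  hence card_I: "real (card ?I) \<le> real r ^ 2"
    by (simp add: power2_eq_square flip: of_nat_mult)
  have "real (?E (\<Union>p\<in>?I. ?S p)) \<le> real (card ?I) ^ 2 * \<beta>"
  proof (rule energy_le_cover[OF finI finS order_refl])
    fix p assume "p \<in> ?I"
    thus "real (?E (?S p)) \<le> \<beta>"
      unfolding \<beta>_def using assms \<kappa> by (cases p) (simp add: energy_equal_entries_le)
  qed
  also have "\<dots> \<le> (real r ^ 2) ^ 2 * \<beta>"
    using card_I \<kappa> by (intro mult_right_mono power_mono) (auto simp: \<beta>_def)
  also have "\<dots> = \<kappa> ^ 2 / 4 * \<beta>" by (simp add: \<kappa>_def power2_eq_square)
  also have "\<dots> = real (?E ?T) / 4 + \<kappa> ^ (r + 2) * real (card X) ^ r * real (energy k U B) / 4"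
    using \<kappa> by (simp add: \<beta>_def field_simps power_mult_distrib power2_eq_square power4_eq_xxxx)
  finally have equal_entries: "real (?E (\<Union>p\<in>?I. ?S p))
      \<le> real (?E ?T) / 4 + \<kappa> ^ (r + 2) * real (card X) ^ r * real (energy k U B) / 4" .
  have "?T \<subseteq> ?D \<union> (\<Union>p\<in>?I. ?S p)" by (auto simp: inj_on_def)
  hence "?E ?T \<le> ?E (?D \<union> (\<Union>p\<in>?I. ?S p))" using finD finI finS by (intro energy_mono) auto
  also have "\<dots> \<le> 2 * (?E ?D + ?E (\<Union>p\<in>?I. ?S p))" using finD finI finS by (intro energy_Un_le) auto
  finally have "real (?E ?T) \<le> real (2 * (?E ?D + ?E (\<Union>p\<in>?I. ?S p)))" by (simp only: of_nat_le_iff)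
  also have "\<dots> = 2 * real (?E ?D) + 2 * real (?E (\<Union>p\<in>?I. ?S p))" by simp
  finally show ?thesis using equal_entries unfolding \<kappa>_def[symmetric] by linarith
qed

lemma energy_tuple_sum_le_distinct:
  fixes v :: "'a \<Rightarrow> nat \<Rightarrow> int"
  assumes "finite X" "r > 0"
  shows "real (energy k (tuple_sum r v) (tuples r X))
     \<le> 4 * real (energy k (tuple_sum r v) {x \<in> tuples r X. inj_on x {..<r}})
       + (2 * real r ^ 2) ^ (r + 2) * real (card X) ^ r"
proof -
  let ?U = "\<lambda>_ _. 0 :: int" and ?D = "{x \<in> tuples r X. inj_on x {..<r}}"
  have finD: "finite ?D" using finite_tuples[OF assms(1)] by simp
  have "energy k (tuple_sum r v) (tuples r X) \<le> energy k (joint_sum (tuple_sum r v) ?U) (tuples r X \<times> {()})"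
    using finite_tuples[OF assms(1)] by (intro energy_le_inj[where f = "\<lambda>x. (x, ())"]) (auto simp: inj_on_def)
  hence "real (energy k (tuple_sum r v) (tuples r X))
      \<le> real (energy k (joint_sum (tuple_sum r v) ?U) (tuples r X \<times> {()}))"
    by simp
  also have "\<dots> \<le> 4 * real (energy k (joint_sum (tuple_sum r v) ?U) (?D \<times> {()}))
      + (2 * real r ^ 2) ^ (r + 2) * real (card X) ^ r * real (energy k ?U {()})"
    using assms by (intro energy_joint_sum_le_distinct) auto
  also have "energy k ?U {()} = 1"
    by (simp add: energy_def collisions_def case_prod_unfold)
  finally have total: "real (energy k (tuple_sum r v) (tuples r X))
      \<le> 4 * real (energy k (joint_sum (tuple_sum r v) ?U) (?D \<times> {()})) + (2 * real r ^ 2) ^ (r + 2) * real (card X) ^ r"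
    by simp
  have "energy k (joint_sum (tuple_sum r v) ?U) (?D \<times> {()}) \<le> energy k (tuple_sum r v) ?D"
    using finD by (intro energy_le_inj[where f = fst]) (auto simp: inj_on_def)
  thus ?thesis using total by linarith
qed

section \<open>Differencing\<close>

lemma power_sum_le_card_power_mult_sum:
  fixes t :: "'a \<Rightarrow> real"
  assumes "finite I" "even n" "n > 0"
  shows "(\<Sum>i\<in>I. t i) ^ n \<le> real (card I) ^ (n - 1) * (\<Sum>i\<in>I. t i ^ n)"
proof (cases "I = {}")
  case False
  let ?c = "real (card I)"
  have c: "?c > 0" using False assms by (simp add: card_gt_0_iff)
  have "(\<Sum>i\<in>I. (1 / ?c) *\<^sub>R t i) ^ n \<le> (\<Sum>i\<in>I. (1 / ?c) * t i ^ n)"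
    using c False assms by (intro convex_on_sum[OF _ _ convex_power_even[OF assms(2)]]) auto
  hence "(\<Sum>i\<in>I. t i) ^ n / ?c ^ n \<le> (\<Sum>i\<in>I. t i ^ n) / ?c"
    by (simp add: sum_divide_distrib[symmetric] power_divide)
  hence "(\<Sum>i\<in>I. t i) ^ n \<le> (\<Sum>i\<in>I. t i ^ n) / ?c * ?c ^ n"
    using c by (simp only: pos_divide_le_eq zero_less_power)
  also obtain m where "n = Suc m" using assms(3) by (cases n) auto
  hence "(\<Sum>i\<in>I. t i ^ n) / ?c * ?c ^ n = ?c ^ (n - 1) * (\<Sum>i\<in>I. t i ^ n)"
    using c by simp
  finally show ?thesis .
qed (use assms in \<open>auto simp: power_0_left\<close>)

lemma add_power_le_rescaled:
  fixes N S :: real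
  assumes "N > 0" "S \<ge> 0" "r \<le> m"
  shows "(N + 2 * S) ^ r \<le> 3 ^ r * (N ^ r + N ^ r / N ^ m * S ^ m)"
proof (cases "S \<le> N")
  case True
  have "(N + 2 * S) ^ r \<le> (3 * N) ^ r" using assms True by (intro power_mono) auto
  also have "\<dots> \<le> 3 ^ r * (N ^ r + N ^ r / N ^ m * S ^ m)"
    using assms by (simp add: power_mult_distrib)
  finally show ?thesis .
next
  case False
  have "(N + 2 * S) ^ r \<le> (3 * S) ^ r" using assms False by (intro power_mono) auto
  also have "\<dots> = 3 ^ r * (N ^ r * (S / N) ^ r)"
    using assms by (simp add: power_mult_distrib power_divide)
  also have "\<dots> \<le> 3 ^ r * (N ^ r * (S / N) ^ m)"
    using assms False by (intro mult_left_mono power_increasing) (auto simp: field_simps)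
  also have "N ^ r * (S / N) ^ m = N ^ r / N ^ m * S ^ m" by (simp add: power_divide)
  also have "3 ^ r * \<dots> \<le> 3 ^ r * (N ^ r + N ^ r / N ^ m * S ^ m)"
    using assms by (intro mult_left_mono) auto
  finally show ?thesis .
qed

definition congruent_pairs :: "int set \<Rightarrow> int \<Rightarrow> (int \<times> int) set" where
  "congruent_pairs X Q = {(x, y) \<in> X \<times> X. Q dvd x - y}"

lemma finite_congruent_pairs: "finite X \<Longrightarrow> finite (congruent_pairs X Q)"
  by (rule finite_subset[of _ "X \<times> X"]) (auto simp: congruent_pairs_def)

lemma sum_congruent_pairs_descending:
  assumes "finite X" "Q > 0" "\<And>x y. x \<in> X \<Longrightarrow> y \<in> X \<Longrightarrow> (x - y) div Q \<le> H"
  shows "(\<Sum>(x, y)\<in>{(x, y) \<in> congruent_pairs X Q. y < x}. f x y)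
       = (\<Sum>h\<in>{1..H}. \<Sum>x\<in>{x \<in> X. x + h * Q \<in> X}. f (x + h * Q) x)"
proof -
  have "\<exists>h. (x - y) div Q = h \<and> y + h * Q = x \<and> 1 \<le> h \<and> h \<le> H"
    if "(x, y) \<in> congruent_pairs X Q" "y < x" for x y
  proof -
    obtain h where h: "x - y = Q * h" using \<open>(x, y) \<in> _\<close> by (auto simp: congruent_pairs_def)
    hence "0 < Q * h" using \<open>y < x\<close> by linarith
    hence "0 < h" using assms(2) by (simp add: zero_less_mult_iff)
    moreover have "(x - y) div Q = h" using h assms(2) by simp
    moreover from this have "h \<le> H" using assms(3)[of x y] that by (auto simp: congruent_pairs_def)
    moreover have "y + h * Q = x" using h by (simp add: algebra_simps)
    ultimately show ?thesis by auto
  qed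
  hence "(\<Sum>(x, y)\<in>{(x, y) \<in> congruent_pairs X Q. y < x}. f x y)
      = (\<Sum>(h, x)\<in>(SIGMA h:{1..H}. {x \<in> X. x + h * Q \<in> X}). f (x + h * Q) x)"
    using assms(2)
    by (intro sum.reindex_bij_witness[of _ "\<lambda>(h, x). (x + h * Q, x)" "\<lambda>(x, y). ((x - y) div Q, y)"])
      (force simp: congruent_pairs_def)+
  thus ?thesis using assms(1) by (subst sum.Sigma) auto
qed

lemma norm_exp_sum_congruent_pairs_le:
  fixes \<delta> :: "int \<Rightarrow> int \<Rightarrow> nat \<Rightarrow> int"
  assumes "finite X" "Q > 0" "\<And>x y. x \<in> X \<Longrightarrow> y \<in> X \<Longrightarrow> (x - y) div Q \<le> H"
    and \<delta>: "\<And>x j. \<delta> x x j = 0" "\<And>x y j. Q dvd x - y \<Longrightarrow> j \<in> {1..k} \<Longrightarrow> \<delta> y x j = - \<delta> x y j"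
  shows "cmod (exp_sum k M (\<lambda>(x, y). \<delta> x y) (congruent_pairs X Q) a)
       \<le> real (card X) + 2 * (\<Sum>h\<in>{1..H}. cmod (exp_sum k M (\<lambda>x. \<delta> (x + h * Q) x) {x \<in> X. x + h * Q \<in> X} a))"
proof -
  let ?c = "\<lambda>(x, y). torus_char k M a (\<delta> x y)"
  let ?D = "{(x, y) \<in> congruent_pairs X Q. x = y}" and ?L = "{(x, y) \<in> congruent_pairs X Q. y < x}"
    and ?U = "{(x, y) \<in> congruent_pairs X Q. x < y}"
  have fin: "finite ?D" "finite ?L" "finite ?U"
    by (rule finite_subset[OF _ finite_congruent_pairs[OF assms(1), of Q]]; blast)+
  have "congruent_pairs X Q = ?D \<union> (?L \<union> ?U)" by auto
  hence "exp_sum k M (\<lambda>(x, y). \<delta> x y) (congruent_pairs X Q) a = sum ?c (?D \<union> (?L \<union> ?U))"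
    by (simp add: exp_sum_def case_prod_unfold)
  also have "\<dots> = sum ?c ?D + (sum ?c ?L + sum ?c ?U)"
    using fin by (subst sum.union_disjoint, auto)+
  finally have "cmod (exp_sum k M (\<lambda>(x, y). \<delta> x y) (congruent_pairs X Q) a)
      \<le> cmod (sum ?c ?D) + (cmod (sum ?c ?L) + cmod (sum ?c ?U))"
    by (metis (no_types, lifting) add_left_mono norm_triangle_ineq order_trans)
  moreover have "cmod (sum ?c ?D) = real (card X)"
  proof -
    have "?D = (\<lambda>x. (x, x)) ` X" by (auto simp: congruent_pairs_def)
    thus ?thesis by (simp add: sum.reindex inj_on_def torus_char_zero \<delta>(1))
  qed
  moreover have "sum ?c ?U = cnj (sum ?c ?L)"
  proof -
    have "?c (prod.swap p) = cnj (?c p)" if "p \<in> ?L" for p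
      using that \<delta>(2) by (auto simp: congruent_pairs_def torus_char_uminus[symmetric] intro!: torus_char_cong)
    hence "sum ?c ?U = (\<Sum>p\<in>?L. cnj (?c p))"
      by (intro sum.reindex_bij_witness[of _ prod.swap prod.swap])
        (auto simp: congruent_pairs_def dvd_diff_commute)
    thus ?thesis by (simp only: cnj_sum)
  qed
  hence "cmod (sum ?c ?U) = cmod (sum ?c ?L)" by (simp only: complex_mod_cnj)
  moreover have "sum ?c ?L = (\<Sum>h\<in>{1..H}. exp_sum k M (\<lambda>x. \<delta> (x + h * Q) x) {x \<in> X. x + h * Q \<in> X} a)"
    unfolding exp_sum_def by (rule sum_congruent_pairs_descending[OF assms(1-3)])
  hence "cmod (sum ?c ?L) \<le> (\<Sum>h\<in>{1..H}. cmod (exp_sum k M (\<lambda>x. \<delta> (x + h * Q) x) {x \<in> X. x + h * Q \<in> X} a))"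
    by (simp only: norm_sum)
  ultimately show ?thesis by linarith
qed

lemma card_congruent_solutions_le:
  fixes \<delta> :: "int \<Rightarrow> int \<Rightarrow> nat \<Rightarrow> int" and N :: real
  assumes "finite X" "finite B" "Q > 0" "real (card X) \<le> N" "N > 0" "r' > 0" "r \<le> 2 * r'"
    and H: "\<And>x y. x \<in> X \<Longrightarrow> y \<in> X \<Longrightarrow> (x - y) div Q \<le> H"
    and \<delta>: "\<And>x j. \<delta> x x j = 0" "\<And>x y j. Q dvd x - y \<Longrightarrow> j \<in> {1..k} \<Longrightarrow> \<delta> y x j = - \<delta> x y j"
  shows "real (card {p \<in> tuples r (congruent_pairs X Q) \<times> (B \<times> B).
          \<forall>j\<in>{1..k}. joint_sum (tuple_sum r (\<lambda>(x, y). \<delta> x y)) (\<lambda>(z, w) j. U z j - U w j) p j = 0})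
    \<le> 3 ^ r * (N ^ r * real (energy k U B) + N ^ r / N ^ (2 * r') * (real (nat H) ^ (2 * r' - 1) *
           (\<Sum>h\<in>{1..H}. real (energy k (joint_sum (tuple_sum r' (\<lambda>x. \<delta> (x + h * Q) x)) U)
               (tuples r' {x \<in> X. x + h * Q \<in> X} \<times> B)))))"
proof -
  let ?P = "congruent_pairs X Q" and ?X = "\<lambda>h. {x \<in> X. x + h * Q \<in> X}"
  let ?V = "joint_sum (tuple_sum r (\<lambda>(x, y). \<delta> x y)) (\<lambda>(z, w) j. U z j - U w j)"
  let ?W = "\<lambda>h. joint_sum (tuple_sum r' (\<lambda>x. \<delta> (x + h * Q) x)) U"
  define c where "c = 3 ^ r * (N ^ r / N ^ (2 * r') * real (nat H) ^ (2 * r' - 1))"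
  have finP: "finite ?P" by (rule finite_congruent_pairs[OF assms(1)])
  have "real (card {p \<in> tuples r ?P \<times> (B \<times> B). \<forall>j\<in>{1..k}. ?V p j = 0})
      \<le> (3 ^ r * N ^ r) * real (energy k U B) + (\<Sum>h\<in>{1..H}. c * real (energy k (?W h) (tuples r' (?X h) \<times> B)))"
  proof (rule card_zeros_le)
    fix M a
    let ?b = "cmod (exp_sum k M U B a) ^ 2"
    let ?S = "\<Sum>h\<in>{1..H}. cmod (exp_sum k M (\<lambda>x. \<delta> (x + h * Q) x) (?X h) a)"
    let ?S' = "\<Sum>h\<in>{1..H}. cmod (exp_sum k M (\<lambda>x. \<delta> (x + h * Q) x) (?X h) a) ^ (2 * r')"
    have "cmod (exp_sum k M ?V (tuples r ?P \<times> (B \<times> B)) a) = cmod (exp_sum k M (\<lambda>(x, y). \<delta> x y) ?P a) ^ r * ?b"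
      using finP by (simp add: exp_sum_joint_sum exp_sum_tuples exp_sum_diff norm_mult norm_power)
    also have "\<dots> \<le> (N + 2 * ?S) ^ r * ?b"
      using norm_exp_sum_congruent_pairs_le[where \<delta> = \<delta> and k = k and M = M and a = a, OF assms(1,3) H \<delta>] assms(4)
      by (intro mult_right_mono power_mono) auto
    also have "\<dots> \<le> 3 ^ r * (N ^ r + N ^ r / N ^ (2 * r') * ?S ^ (2 * r')) * ?b"
      using assms by (intro mult_right_mono add_power_le_rescaled) (auto intro: sum_nonneg)
    also have "\<dots> \<le> 3 ^ r * (N ^ r + N ^ r / N ^ (2 * r') * (real (nat H) ^ (2 * r' - 1) * ?S')) * ?b"
      using power_sum_le_card_power_mult_sum[of "{1..H}" "2 * r'"] assms
      by (intro mult_right_mono mult_left_mono add_left_mono) auto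
    also have "\<dots> = (3 ^ r * N ^ r) * ?b + c * (?S' * ?b)"
      by (simp add: c_def algebra_simps)
    also have "?S' * ?b = (\<Sum>h\<in>{1..H}. cmod (exp_sum k M (?W h) (tuples r' (?X h) \<times> B) a) ^ 2)"
      using assms(1) by (simp add: exp_sum_joint_sum exp_sum_tuples norm_mult norm_power sum_distrib_left
          sum_distrib_right power_mult_distrib power_mult[symmetric] mult.commute)
    finally show "cmod (exp_sum k M ?V (tuples r ?P \<times> (B \<times> B)) a)
        \<le> (3 ^ r * N ^ r) * ?b + (\<Sum>h\<in>{1..H}. c * cmod (exp_sum k M (?W h) (tuples r' (?X h) \<times> B) a) ^ 2)"
      by (simp only: sum_distrib_left)
  qed (use assms(1,2) finP in \<open>auto intro!: finite_cartesian_product finite_tuples\<close>)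
  also have "\<dots> = 3 ^ r * (N ^ r * real (energy k U B) + N ^ r / N ^ (2 * r') * (real (nat H) ^ (2 * r' - 1) *
           (\<Sum>h\<in>{1..H}. real (energy k (?W h) (tuples r' (?X h) \<times> B)))))"
    by (simp add: c_def algebra_simps sum_distrib_left)
  finally show ?thesis .
qed

section \<open>Primes up to a constant factor\<close>

lemma prod_primes_dvd:
  fixes n :: nat
  assumes "\<And>p. p \<in> S \<Longrightarrow> prime p" "\<And>p. p \<in> S \<Longrightarrow> p dvd n"
  shows "\<Prod>S dvd n"
  using cong_cong_prod_coprime_nat[of S n 0 "\<lambda>p. p"] assms by (simp add: cong_0_iff primes_coprime)

definition primorial :: "nat \<Rightarrow> nat" where
  "primorial n = \<Prod>{p. prime p \<and> p \<le> n}"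

lemma finite_primes_between: "finite {p::nat. prime p \<and> m < p \<and> p \<le> n}"
  by (rule finite_subset[of _ "{..n}"]) auto

lemma finite_primes_le: "finite {p::nat. prime p \<and> p \<le> n}"
  by (rule finite_subset[of _ "{..n}"]) auto

lemma primorial_split:
  assumes "m \<le> n"
  shows "primorial n = primorial m * \<Prod>{p. prime p \<and> m < p \<and> p \<le> n}"
proof -
  have "{p. prime p \<and> p \<le> n} = {p. prime p \<and> p \<le> m} \<union> {p. prime p \<and> m < p \<and> p \<le> n}"
    using assms by auto
  thus ?thesis unfolding primorial_def
    using finite_primes_le finite_primes_between by (subst prod.union_disjoint[symmetric]) auto
qed

lemma primorial_le_mult_binomial:
  assumes "m \<le> n" "n \<le> 2 * m"
  shows "primorial n \<le> primorial m * (n choose m)"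
proof -
  let ?S = "{p. prime p \<and> m < p \<and> p \<le> n}"
  have "\<Prod>?S dvd (n choose m)"
  proof (rule prod_primes_dvd)
    fix p assume "p \<in> ?S"
    hence p: "prime p" "m < p" "p \<le> n" by auto
    have "p dvd fact n" using p by (simp add: prime_dvd_fact_iff)
    also have "fact n = fact m * fact (n - m) * (n choose m)"
      using assms by (simp add: binomial_fact_lemma)
    finally show "p dvd (n choose m)"
      using p assms by (auto simp: prime_dvd_mult_iff prime_dvd_fact_iff)
  qed auto
  hence "\<Prod>?S \<le> n choose m" using assms by (intro dvd_imp_le) auto
  thus ?thesis using primorial_split[OF assms(1)] by simp
qed

lemma odd_central_binomial_le: "Suc (2 * m) choose Suc m \<le> 4 ^ m"
proof -
  have "2 * (Suc (2 * m) choose Suc m) = (Suc (2 * m) choose m) + (Suc (2 * m) choose Suc m)"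
    using binomial_symmetric[of m "Suc (2 * m)"] by simp
  also have "\<dots> = (\<Sum>i\<in>{m, Suc m}. Suc (2 * m) choose i)" by simp
  also have "\<dots> \<le> (\<Sum>i\<le>Suc (2 * m). Suc (2 * m) choose i)" by (intro sum_mono2) auto
  also have "\<dots> = 2 * 4 ^ m" by (simp only: choose_row_sum power_Suc power_mult) simp
  finally show ?thesis by simp
qed

lemma primorial_le: "primorial n \<le> 4 ^ n"
proof (induction n rule: less_induct)
  case (less n)
  consider "n = 0" | m where "n = Suc m" "\<not> prime n" | "n = 2" | m where "n = Suc (2 * m)" "m > 0"
  proof (cases "prime n \<and> n \<noteq> 2")
    case True
    hence "odd n" "n > 2" using prime_odd_nat[of n] prime_ge_2_nat[of n] by auto
    thus ?thesis using that(4)[of "n div 2"] by (auto elim: oddE)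
  qed (metis that(1,2,3) not0_implies_Suc)
  thus ?case
  proof cases
    case 1
    hence no_primes: "{p. prime p \<and> p \<le> n} = {}" by auto
    show ?thesis unfolding primorial_def no_primes by simp
  next
    case (2 m)
    hence no_primes: "{p. prime p \<and> m < p \<and> p \<le> n} = {}" by (auto simp: le_Suc_eq)
    have "primorial n = primorial m" using primorial_split[of m n, unfolded no_primes] 2(1) by simp
    also have "\<dots> \<le> 4 ^ m" using 2 by (intro less) auto
    finally show ?thesis using 2 by simp
  next
    case 3
    hence "{p. prime p \<and> p \<le> n} = {2}" by (auto dest: prime_ge_2_nat)
    thus ?thesis using 3 by (simp add: primorial_def)
  next
    case (4 m)
    have "primorial n \<le> primorial (Suc m) * (n choose Suc m)"
      using 4 by (intro primorial_le_mult_binomial) auto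
    also have "\<dots> \<le> 4 ^ Suc m * 4 ^ m"
      using 4 odd_central_binomial_le[of m] by (intro mult_mono less) auto
    also have "\<dots> = 4 ^ n" using 4 by (simp add: power_add[symmetric] mult_2)
    finally show ?thesis .
  qed
qed

lemma dvd_if_reciprocal_difference:
  fixes a b c n :: int
  assumes "a dvd n" "b dvd n" "a * b = c * (a - b)" "a \<noteq> b"
  shows "c dvd n"
proof -
  obtain x y where n: "n = a * x" "n = b * y" using assms(1,2) by (elim dvdE)
  have "n * (a - b) = (b * y) * a - (a * x) * b"
    unfolding n[symmetric] by (rule right_diff_distrib)
  also have "\<dots> = (a * b) * (y - x)" by (simp add: algebra_simps)
  also have "\<dots> = (c * (y - x)) * (a - b)" unfolding assms(3) by simp
  finally show ?thesis using assms(4) by simp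
qed

lemma binomial_dvd_Lcm:
  fixes n j :: nat
  shows "j < n \<Longrightarrow> n * ((n - 1) choose j) dvd Lcm {1..n}"
proof (induction j arbitrary: n)
  case 0
  thus ?case by (auto intro: dvd_Lcm)
next
  case (Suc j)
  define m where "m = n - 2"
  have m: "n = Suc (Suc m)" using Suc.prems by (simp add: m_def)
  have j: "j < Suc m" and n_pred: "n - 1 = Suc m" using Suc.prems m by auto
  let ?a = "n * (Suc m choose j)" and ?b = "Suc m * (m choose j)" and ?c = "n * (Suc m choose Suc j)"
  have a_dvd: "?a dvd Lcm {1..n}" using Suc.IH[OF Suc_lessD[OF Suc.prems]] by (simp only: n_pred)
  have "?b dvd Lcm {1..Suc m}" using Suc.IH[OF j] by (simp only: diff_Suc_1)
  also have "\<dots> dvd Lcm {1..n}" unfolding m by (intro Lcm_subset) auto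
  finally have b_dvd: "?b dvd Lcm {1..n}" .
  \<comment> \<open>The entries of Leibniz's harmonic triangle satisfy \<open>1 / ?c = 1 / ?b - 1 / ?a\<close>.\<close>
  have b1: "int (Suc j) * int (Suc m choose Suc j) = int ?b"
    by (simp only: of_nat_mult[symmetric] Suc_times_binomial)
  have "(Suc m - j) * (Suc m choose j) = ?b"
    using binomial_absorb_comp[of "Suc m" j] by simp
  hence "int (Suc m - j) * int (Suc m choose j) = int ?b" by (simp only: of_nat_mult[symmetric])
  hence b2: "(int n - int (Suc j)) * int (Suc m choose j) = int ?b" using j by (simp add: m of_nat_diff algebra_simps)
  have ab: "int ?a - int ?b = int (Suc j) * int (Suc m choose j)"
    unfolding b2[symmetric] by (simp add: algebra_simps)
  have "int ?c * (int ?a - int ?b) = int n * (int (Suc j) * int (Suc m choose Suc j)) * int (Suc m choose j)"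
    unfolding ab by (simp only: of_nat_mult mult_ac)
  also have "\<dots> = int ?a * int ?b" unfolding b1 by (simp only: of_nat_mult mult_ac)
  finally have product: "int ?a * int ?b = int ?c * (int ?a - int ?b)" ..
  have "0 < int (Suc j) * int (Suc m choose j)"
    using j by (intro mult_pos_pos) (simp_all only: of_nat_0_less_iff zero_less_binomial_iff zero_less_Suc less_imp_le)
  hence distinct: "int ?a \<noteq> int ?b" using ab by linarith
  have "int ?a dvd int (Lcm {1..n})" "int ?b dvd int (Lcm {1..n})"
    using a_dvd b_dvd by (simp_all only: int_dvd_int_iff)
  hence "int ?c dvd int (Lcm {1..n})"
    by (rule dvd_if_reciprocal_difference[OF _ _ product distinct])
  thus ?case by (simp only: n_pred int_dvd_int_iff)
qed

lemma prime_power_dvd_Lcm_atLeastAtMost: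
  fixes p :: nat
  assumes "prime p" "p ^ a dvd Lcm {1..n}" "n > 0"
  shows "p ^ a \<le> n"
  using assms(2,3)
proof (induction n)
  case (Suc n)
  have "Lcm {1..Suc n} = lcm (Suc n) (Lcm {1..n})"
    by (simp add: atLeastAtMostSuc_conv)
  hence "a \<le> multiplicity p (lcm (Suc n) (Lcm {1..n}))"
    using Suc.prems assms(1) by (intro multiplicity_geI) (auto simp: Lcm_0_iff)
  also have "\<dots> = max (multiplicity p (Suc n)) (multiplicity p (Lcm {1..n}))"
    using assms(1) by (intro multiplicity_lcm) (auto simp: Lcm_0_iff)
  finally have "p ^ a dvd Suc n \<or> p ^ a dvd Lcm {1..n}"
    by (auto simp: le_max_iff_disj multiplicity_dvd')
  thus ?case
  proof
    assume "p ^ a dvd Suc n"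
    thus ?thesis by (rule dvd_imp_le) simp
  next
    assume "p ^ a dvd Lcm {1..n}"
    thus ?thesis using Suc.IH by (cases "n = 0") auto
  qed
qed simp

lemma prime_power_multiplicity_Lcm_le:
  fixes p :: nat
  assumes "prime p" "n > 0" "n \<le> s ^ 2"
  shows "p ^ multiplicity p (Lcm {1..n}) \<le> (if p \<le> s then n else 1) * p"
proof -
  let ?a = "multiplicity p (Lcm {1..n})"
  have le_n: "p ^ ?a \<le> n"
    using assms by (intro prime_power_dvd_Lcm_atLeastAtMost[of p]) (auto simp: multiplicity_dvd)
  show ?thesis
  proof (cases "p \<le> s")
    case True
    have "n \<le> n * p" using prime_gt_0_nat[OF assms(1)] by simp
    thus ?thesis using le_trans[OF le_n] True by simp
  next
    case False
    hence "p ^ ?a < p ^ 2" using le_n assms(3) power_strict_mono[of s p 2] by simp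
    hence "?a < 2" using prime_gt_1_nat[OF assms(1)] by (simp only: power_strict_increasing_iff)
    hence "p ^ ?a \<le> p ^ 1" using prime_gt_0_nat[OF assms(1)] by (intro power_increasing) auto
    thus ?thesis using False by simp
  qed
qed

lemma Lcm_atLeastAtMost_le:
  fixes n :: nat
  assumes "n > 0" "n \<le> s ^ 2"
  shows "Lcm {1..n} \<le> n ^ s * primorial n"
proof -
  let ?L = "Lcm {1..n}" and ?P = "{p::nat. prime p \<and> p \<le> n}"
  have "?L \<noteq> 0" by (simp add: Lcm_0_iff)
  have factors: "prime_factors ?L \<subseteq> ?P"
  proof
    fix p assume "p \<in> prime_factors ?L"
    hence "prime p" "p ^ 1 dvd ?L" by auto
    thus "p \<in> ?P" using prime_power_dvd_Lcm_atLeastAtMost[of p 1 n] assms by auto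
  qed
  have "?L = (\<Prod>p\<in>prime_factors ?L. p ^ multiplicity p ?L)"
    using prod_prime_factors[OF \<open>?L \<noteq> 0\<close>] by simp
  also have "\<dots> \<le> (\<Prod>p\<in>prime_factors ?L. (if p \<le> s then n else 1) * p)"
    using assms by (intro prod_mono conjI prime_power_multiplicity_Lcm_le) auto
  also have "\<dots> = (\<Prod>p\<in>prime_factors ?L. if p \<le> s then n else 1) * \<Prod>(prime_factors ?L)"
    by (simp add: prod.distrib)
  also have "(\<Prod>p\<in>prime_factors ?L. if p \<le> s then n else 1) = n ^ card {p \<in> prime_factors ?L. p \<le> s}"
    by (simp add: prod.If_cases Int_def)
  also have "\<dots> \<le> n ^ s"
  proof (intro power_increasing)
    have "card {p \<in> prime_factors ?L. p \<le> s} \<le> card {1..s}"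
      by (intro card_mono) (auto intro!: prime_gt_0_nat dest: in_prime_factors_imp_prime simp: Suc_le_eq)
    thus "card {p \<in> prime_factors ?L. p \<le> s} \<le> s" by simp
  qed (use assms in auto)
  also have "\<Prod>(prime_factors ?L) \<le> primorial n"
    unfolding primorial_def by (rule dvd_imp_le[OF prod_dvd_prod_subset[OF finite_primes_le factors]])
      (auto intro!: prod_pos dest: prime_gt_0_nat)
  finally show ?thesis by simp
qed

lemma four_power_le_Lcm:
  assumes "m > 0"
  shows "4 ^ m \<le> 2 * real (Lcm {1..2 * m})"
proof -
  have "(2 * m) * ((2 * m - 1) choose (m - 1)) dvd Lcm {1..2 * m}"
    using assms by (intro binomial_dvd_Lcm) auto
  moreover have "(2 * m) * ((2 * m - 1) choose (m - 1)) = m * ((2 * m) choose m)"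
    using assms times_binomial_minus1_eq[of m "2 * m"] by (simp only: mult.commute)
  moreover have "Lcm {1..2 * m} \<noteq> 0" by (simp add: Lcm_0_iff)
  ultimately have "m * ((2 * m) choose m) \<le> Lcm {1..2 * m}"
    by (metis dvd_imp_le neq0_conv)
  hence "real m * real ((2 * m) choose m) \<le> real (Lcm {1..2 * m})"
    by (simp only: of_nat_mult[symmetric] of_nat_le_iff)
  moreover have "4 ^ m / (2 * real m) \<le> real ((2 * m) choose m)"
    using assms by (rule central_binomial_lower_bound)
  hence "4 ^ m \<le> 2 * (real m * real ((2 * m) choose m))" using assms by (simp add: field_simps)
  ultimately show ?thesis by linarith
qed

lemma four_power_le_by_primes:
  assumes "n > 0" "4 * n \<le> s ^ 2"
  shows "4 ^ n \<le> 2 * real (4 * n) ^ (s + card {p. prime p \<and> n < p \<and> p \<le> 4 * n})"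
proof -
  let ?S = "{p. prime p \<and> n < p \<and> p \<le> 4 * n}"
  have "\<Prod>?S \<le> (\<Prod>p\<in>?S. 4 * n)" by (intro prod_mono) auto
  also have "\<dots> = (4 * n) ^ card ?S" by (rule prod_constant)
  finally have "primorial (4 * n) \<le> 4 ^ n * (4 * n) ^ card ?S"
    using primorial_split[of n "4 * n"] primorial_le[of n] by (simp add: mult_mono)
  moreover have "Lcm {1..4 * n} \<le> (4 * n) ^ s * primorial (4 * n)"
    using assms by (intro Lcm_atLeastAtMost_le) auto
  ultimately have "Lcm {1..4 * n} \<le> (4 * n) ^ s * (4 ^ n * (4 * n) ^ card ?S)"
    by (meson le_trans mult_le_mono2)
  hence "real (Lcm {1..4 * n}) \<le> real ((4 * n) ^ s * (4 ^ n * (4 * n) ^ card ?S))"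
    by (simp only: of_nat_le_iff)
  also have "\<dots> = 4 ^ n * real (4 * n) ^ (s + card ?S)"
    by (simp add: power_add)
  finally have "real (Lcm {1..4 * n}) \<le> 4 ^ n * real (4 * n) ^ (s + card ?S)" .
  moreover have "4 ^ (2 * n) \<le> 2 * real (Lcm {1..4 * n})"
    using four_power_le_Lcm[of "2 * n"] assms(1) by simp
  hence "(4::real) ^ n * 4 ^ n \<le> 2 * real (Lcm {1..4 * n})"
    by (simp only: mult_2 power_add)
  ultimately have "(4::real) ^ n * 4 ^ n \<le> 4 ^ n * (2 * real (4 * n) ^ (s + card ?S))"
    by linarith
  thus ?thesis by (rule mult_left_le_imp_le) simp
qed

lemma eventually_many_primes:
  "\<forall>\<^sub>F n in sequentially. N \<le> card {p::nat. prime p \<and> n < p \<and> p \<le> 4 * n}"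
proof -
  have "\<forall>\<^sub>F n in sequentially. 2 * (4 * real n) powr (2 * sqrt n + 2 + real N) < 4 ^ n"
    by real_asymp
  thus ?thesis using eventually_gt_at_top[of 0]
  proof eventually_elim
    case (elim n)
    let ?c = "card {p. prime p \<and> n < p \<and> p \<le> 4 * n}"
    define s where "s = nat \<lceil>sqrt (4 * n)\<rceil>"
    have "real (4 * n) \<le> real s ^ 2"
      unfolding s_def by (intro sqrt_le_D real_nat_ceiling_ge)
    hence "4 * n \<le> s ^ 2" by (simp only: of_nat_power[symmetric] of_nat_le_iff)
    have s: "real s \<le> 2 * sqrt n + 1"
      unfolding s_def by (simp add: real_sqrt_mult)
    show ?case
    proof (rule ccontr)
      assume few: "\<not> N \<le> ?c"
      have "4 ^ n \<le> 2 * real (4 * n) ^ (s + ?c)"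
        by (rule four_power_le_by_primes) fact+
      also have "real (4 * n) ^ (s + ?c) = (4 * real n) powr (real s + real ?c)"
        using elim powr_realpow[of "4 * real n" "s + ?c"] by simp
      also have "\<dots> \<le> (4 * real n) powr (2 * sqrt n + 2 + real N)"
        using elim s few by (intro powr_mono) auto
      finally show False using elim by simp
    qed
  qed
qed

text \<open>No power of \<open>log y\<close> is lost here, which is what keeps the final bounds free of \<open>P\<^sup>\<epsilon>\<close>.\<close>

lemma many_primes_in_scaled_range:
  fixes K :: real
  assumes "K \<ge> 0"
  obtains C where "C \<ge> 1" "\<And>y. y \<ge> 1 \<Longrightarrow>
    \<exists>S::nat set. finite S \<and> card S = N \<and> (\<forall>p\<in>S. prime p \<and> K * y < real p \<and> real p \<le> C * y)"
proof -
  obtain m where m: "\<And>n. n \<ge> m \<Longrightarrow> N \<le> card {p::nat. prime p \<and> n < p \<and> p \<le> 4 * n}"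
    using eventually_many_primes[of N] unfolding eventually_sequentially by blast
  define C where "C = 4 * (K + 1 + real m)"
  have "\<exists>S::nat set. finite S \<and> card S = N \<and> (\<forall>p\<in>S. prime p \<and> K * y < real p \<and> real p \<le> C * y)"
    if y: "y \<ge> 1" for y
  proof -
    define n where "n = nat \<lceil>K * y\<rceil> + m"
    have "N \<le> card {p::nat. prime p \<and> n < p \<and> p \<le> 4 * n}" by (rule m) (simp add: n_def)
    then obtain S where S: "S \<subseteq> {p. prime p \<and> n < p \<and> p \<le> 4 * n}" "card S = N" "finite S"
      by (rule obtain_subset_with_card_n)
    have lower: "K * y \<le> real n" unfolding n_def by linarith
    have "K * y \<ge> 0" using assms y by simp
    hence "real n \<le> K * y + 1 + real m" unfolding n_def by linarith
    also have "\<dots> \<le> K * y + 1 * y + real m * y"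
      using y mult_left_mono[OF y, of "real m"] by simp
    finally have upper: "real (4 * n) \<le> C * y" by (simp add: C_def algebra_simps)
    have "prime p \<and> K * y < real p \<and> real p \<le> C * y" if "p \<in> S" for p
    proof -
      have "prime p" "n < p" "p \<le> 4 * n" using S(1) that by auto
      hence "real n < real p" "real p \<le> real (4 * n)" by (simp_all only: of_nat_less_iff of_nat_le_iff)
      thus ?thesis using \<open>prime p\<close> lower upper by linarith
    qed
    thus ?thesis using S by blast
  qed
  moreover have "C \<ge> 1" using assms by (simp add: C_def)
  ultimately show ?thesis using that by blast
qed

lemma exists_prime_not_dvd:
  fixes D :: int and Y :: real
  assumes "finite S" "\<And>q. q \<in> S \<Longrightarrow> prime q \<and> Y < real q" "Y \<ge> 0" "D \<noteq> 0" "of_int \<bar>D\<bar> < Y ^ card S"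
  shows "\<exists>q\<in>S. \<not> int q dvd D"
proof (rule ccontr)
  assume "\<not> (\<exists>q\<in>S. \<not> int q dvd D)"
  hence "q dvd nat \<bar>D\<bar>" if "q \<in> S" for q
    using that by (simp add: int_dvd_int_iff[symmetric] del: int_dvd_int_iff)
  hence "\<Prod>S dvd nat \<bar>D\<bar>" using assms(1,2) by (intro prod_primes_dvd) auto
  hence "\<Prod>S \<le> nat \<bar>D\<bar>" using assms(4) by (intro dvd_imp_le) auto
  hence "real (\<Prod>S) \<le> of_int \<bar>D\<bar>" by linarith
  moreover have "(\<Prod>q\<in>S. Y) \<le> (\<Prod>q\<in>S. real q)"
    using assms(2,3) by (intro prod_mono) (auto simp: less_imp_le)
  hence "Y ^ card S \<le> real (\<Prod>S)" by simp
  ultimately show False using assms(5) by linarith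
qed

lemma primes_avoiding_small_integers:
  fixes \<phi> E B :: real and k :: nat
  assumes "0 < \<phi>" "1 \<le> B"
  obtains C N where "1 \<le> C" "\<And>P. 1 \<le> P \<Longrightarrow> \<exists>S. finite S \<and> card S = N \<and>
      (\<forall>q\<in>S. prime q \<and> k < q \<and> P powr \<phi> < real q \<and> real q \<le> C * P powr \<phi>) \<and>
      (\<forall>D. D \<noteq> 0 \<and> of_int \<bar>D\<bar> \<le> B * P powr E \<longrightarrow> (\<exists>q\<in>S. \<not> int q dvd D))"
proof -
  define N where "N = nat \<lceil>E / \<phi>\<rceil> + 1"
  define K where "K = B + real k + 1"
  have K: "K \<ge> 1" "real k < K" using assms by (auto simp: K_def)
  obtain C where C: "C \<ge> 1" "\<And>y. y \<ge> 1 \<Longrightarrow>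
      \<exists>S::nat set. finite S \<and> card S = N \<and> (\<forall>p\<in>S. prime p \<and> K * y < real p \<and> real p \<le> C * y)"
    using many_primes_in_scaled_range[of K N] K by auto
  have primes: "\<exists>S. finite S \<and> card S = N \<and>
      (\<forall>q\<in>S. prime q \<and> k < q \<and> P powr \<phi> < real q \<and> real q \<le> C * P powr \<phi>) \<and>
      (\<forall>D. D \<noteq> 0 \<and> of_int \<bar>D\<bar> \<le> B * P powr E \<longrightarrow> (\<exists>q\<in>S. \<not> int q dvd D))" if P: "1 \<le> P" for P
  proof -
    let ?y = "P powr \<phi>"
    have y: "?y \<ge> 1" using P assms by (simp add: ge_one_powr_ge_zero)
    obtain S :: "nat set" where S: "finite S" "card S = N"
      "\<And>q. q \<in> S \<Longrightarrow> prime q \<and> K * ?y < real q \<and> real q \<le> C * ?y"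
      using C(2)[OF y] by blast
    have "\<exists>q\<in>S. \<not> int q dvd D" if D: "D \<noteq> 0" "of_int \<bar>D\<bar> \<le> B * P powr E" for D
    proof (rule exists_prime_not_dvd[OF S(1)])
      have "E / \<phi> \<le> real N" unfolding N_def by linarith
      hence "B * P powr E \<le> B * P powr (\<phi> * real N)"
        using P assms by (intro mult_left_mono powr_mono) (auto simp: field_simps)
      also have "\<dots> < K ^ N * P powr (\<phi> * real N)"
      proof (rule mult_strict_right_mono)
        have "K ^ 1 \<le> K ^ N" using K by (intro power_increasing) (auto simp: N_def)
        thus "B < K ^ N" by (simp add: K_def)
      qed (use P in simp)
      also have "\<dots> = (K * ?y) ^ card S"
        using P by (simp add: S(2) power_mult_distrib powr_realpow[symmetric] powr_powr)
      finally show "of_int \<bar>D\<bar> < (K * ?y) ^ card S" using D(2) by linarith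
    qed (use S(3) K D in auto)
    moreover have "k < q \<and> ?y < real q" if "q \<in> S" for q
    proof -
      have "K * 1 \<le> K * ?y" "1 * ?y \<le> K * ?y" using y K by (intro mult_mono; simp)+
      thus ?thesis using S(3)[OF that] \<open>real k < K\<close> by linarith
    qed
    ultimately show ?thesis using S by (intro exI[of _ S]) (simp add: S(2,3))
  qed
  show ?thesis by (rule that[OF C(1) primes])
qed

section \<open>Power sums modulo a prime\<close>

abbreviation power_sums :: "nat \<Rightarrow> (nat \<Rightarrow> int) \<Rightarrow> nat \<Rightarrow> int" where
  "power_sums n \<equiv> tuple_sum n (\<lambda>x j. x ^ j)"

definition root_fps :: "nat \<Rightarrow> (nat \<Rightarrow> int) \<Rightarrow> int fps" where
  "root_fps n x = (\<Prod>i<n. 1 - fps_const (x i) * fps_X)"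

lemma root_fps_Suc: "root_fps (Suc n) x = root_fps n x * (1 - fps_const (x n) * fps_X)"
  by (simp add: root_fps_def mult.commute)

lemma nth_root_fps_Suc:
  "root_fps (Suc n) x $ m = root_fps n x $ m - (if m = 0 then 0 else x n * root_fps n x $ (m - 1))"
proof -
  have "root_fps (Suc n) x = root_fps n x - fps_const (x n) * (fps_X * root_fps n x)"
    by (simp add: root_fps_Suc algebra_simps)
  thus ?thesis by simp
qed

lemma nth_root_fps_0 [simp]: "root_fps n x $ 0 = 1"
  by (induction n) (simp_all add: nth_root_fps_Suc, simp add: root_fps_def)

lemma nth_root_fps_eq_0: "m > n \<Longrightarrow> root_fps n x $ m = 0"
  by (induction n arbitrary: m) (auto simp: nth_root_fps_Suc, simp add: root_fps_def)

lemma prod_diff_eq_root_fps: "(\<Prod>i<n. T - x i) = (\<Sum>m\<le>n. root_fps n x $ m * T ^ (n - m))"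
proof (induction n)
  case (Suc n)
  let ?a = "\<lambda>m. root_fps n x $ m"
  have "(\<Sum>m\<le>Suc n. root_fps (Suc n) x $ m * T ^ (Suc n - m))
      = (\<Sum>m\<le>Suc n. ?a m * T ^ (Suc n - m)) - (\<Sum>m\<le>Suc n. (if m = 0 then 0 else x n * ?a (m - 1)) * T ^ (Suc n - m))"
    by (simp only: nth_root_fps_Suc left_diff_distrib sum_subtractf)
  also have "(\<Sum>m\<le>Suc n. ?a m * T ^ (Suc n - m)) = (\<Sum>m\<le>n. T * (?a m * T ^ (n - m)))"
    by (simp add: nth_root_fps_eq_0 Suc_diff_le mult_ac cong: sum.cong_simp)
  also have "(\<Sum>m\<le>Suc n. (if m = 0 then 0 else x n * ?a (m - 1)) * T ^ (Suc n - m)) = (\<Sum>m\<le>n. x n * (?a m * T ^ (n - m)))"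
    by (subst sum.atMost_Suc_shift) (simp add: mult_ac)
  also have "(\<Sum>m\<le>n. T * (?a m * T ^ (n - m))) - \<dots> = (T - x n) * (\<Prod>i<n. T - x i)"
    by (simp only: Suc.IH sum_distrib_left[symmetric] left_diff_distrib)
  finally show ?case by (simp add: mult.commute)
qed simp

lemma fps_deriv_root_fps: "fps_deriv (root_fps n x) = - (root_fps n x * Abs_fps (\<lambda>m. power_sums n x (Suc m)))"
proof (induction n)
  case 0
  have "Abs_fps (\<lambda>m. power_sums 0 x (Suc m)) = 0" by (rule fps_ext) (simp add: tuple_sum_def)
  thus ?case by (simp add: root_fps_def)
next
  case (Suc n)
  define A where "A = root_fps n x"
  define c where "c = fps_const (x n)"
  define S where "S = Abs_fps (\<lambda>m. power_sums n x (Suc m))"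
  define G where "G = Abs_fps (\<lambda>m. x n ^ Suc m)"
  have "G = c + c * (fps_X * G)"
  proof (rule fps_ext)
    fix m show "G $ m = (c + c * (fps_X * G)) $ m" by (cases m) (simp_all add: G_def c_def)
  qed
  hence geometric: "(1 - c * fps_X) * G = c" by (simp add: algebra_simps)
  have split: "Abs_fps (\<lambda>m. power_sums (Suc n) x (Suc m)) = S + G"
    by (rule fps_ext) (simp add: S_def G_def tuple_sum_def)
  have "fps_deriv (root_fps (Suc n) x) = A * (- c) + - (A * S) * (1 - c * fps_X)"
    unfolding root_fps_Suc fps_deriv_mult Suc.IH A_def c_def S_def by simp
  also have "\<dots> = - (A * ((1 - c * fps_X) * G)) - A * S * (1 - c * fps_X)"
    unfolding geometric by simp
  also have "\<dots> = - (A * (1 - c * fps_X) * (S + G))"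
    by (simp add: algebra_simps)
  finally show ?case unfolding split root_fps_Suc A_def c_def .
qed

lemma newton_identity:
  "int (Suc m) * root_fps n x $ Suc m = - (\<Sum>j\<le>m. root_fps n x $ j * power_sums n x (Suc (m - j)))"
proof -
  have "fps_deriv (root_fps n x) $ m = - (root_fps n x * Abs_fps (\<lambda>m. power_sums n x (Suc m))) $ m"
    by (simp only: fps_deriv_root_fps)
  thus ?thesis by (simp add: fps_mult_nth atMost_atLeast0)
qed

lemma root_fps_cong_if_power_sums_cong:
  assumes "prime q" "n < q" "\<And>j. j \<in> {1..n} \<Longrightarrow> [power_sums n x j = power_sums n y j] (mod int q)"
    and "m \<le> n"
  shows "[root_fps n x $ m = root_fps n y $ m] (mod int q)"
  using assms(4)
proof (induction m rule: less_induct)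
  case (less m)
  show ?case
  proof (cases m)
    case (Suc l)
    have "[int m * root_fps n x $ m = int m * root_fps n y $ m] (mod int q)"
      unfolding Suc newton_identity
      using less Suc by (intro cong_minus_minus_iff[THEN iffD2] cong_sum cong_mult assms(3)) auto
    moreover have "\<not> q dvd m" using less.prems assms(2) Suc by (auto dest: dvd_imp_le)
    hence "coprime q m" using assms(1) by (rule prime_imp_coprime[rotated])
    hence "coprime (int m) (int q)" by (simp add: coprime_commute)
    ultimately show ?thesis by (simp add: cong_mult_lcancel)
  qed simp
qed

lemma entry_cong_if_power_sums_cong:
  assumes "prime q" "n < q" "\<And>j. j \<in> {1..n} \<Longrightarrow> [power_sums n x j = power_sums n y j] (mod int q)"
    and "i < n"
  shows "\<exists>l<n. [x i = y l] (mod int q)"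
proof -
  have "[(\<Prod>l<n. x i - y l) = (\<Prod>l<n. x i - x l)] (mod int q)"
    unfolding prod_diff_eq_root_fps
    by (intro cong_sum cong_mult cong_refl cong_sym[OF root_fps_cong_if_power_sums_cong[OF assms(1-3)]]) auto
  also have "(\<Prod>l<n. x i - x l) = 0" using assms(4) by auto
  finally have "int q dvd (\<Prod>l<n. x i - y l)" by (simp add: cong_0_iff)
  then obtain l where "l < n" "int q dvd x i - y l"
    using assms(1) by (auto simp: prime_dvd_prod_iff)
  thus ?thesis by (auto simp: cong_iff_dvd_diff)
qed

abbreviation residues :: "nat \<Rightarrow> int set" where
  "residues q \<equiv> {0..<int q}"

lemma cong_residues_imp_eq:
  fixes a b :: int
  assumes "[a = b] (mod int q)" "a \<in> residues q" "b \<in> residues q"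
  shows "a = b"
  using assms by (auto simp: cong_def)

lemma card_power_sums_le_square:
  assumes "prime q" "m < q"
  shows "card {x \<in> tuples m (residues q). \<forall>j\<in>{1..m}. [power_sums m x j = b j] (mod int q)} \<le> m ^ m"
    (is "card ?S \<le> _")
proof (cases "?S = {}")
  case True
  thus ?thesis by (simp only: card.empty zero_le)
next
  case False
  then obtain y where y: "y \<in> ?S" by blast
  have "?S \<subseteq> tuples m (y ` {..<m})"
  proof
    fix x assume x: "x \<in> ?S"
    have "x i \<in> y ` {..<m}" if i: "i < m" for i
    proof -
      have "[power_sums m x j = power_sums m y j] (mod int q)" if "j \<in> {1..m}" for j
        using x y that cong_sym cong_trans by blast
      then obtain l where l: "l < m" "[x i = y l] (mod int q)"
        using entry_cong_if_power_sums_cong[OF assms _ i] by blast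
      moreover have "x i \<in> residues q" "y l \<in> residues q" using x y i l(1) by (auto simp: PiE_iff)
      ultimately show ?thesis using cong_residues_imp_eq by blast
    qed
    thus "x \<in> tuples m (y ` {..<m})" using x by (auto simp: PiE_iff)
  qed
  hence "card ?S \<le> card (tuples m (y ` {..<m}))" by (intro card_mono finite_tuples) auto
  also have "\<dots> = card (y ` {..<m}) ^ m" by (simp add: card_PiE)
  also have "\<dots> \<le> m ^ m" by (intro power_mono) (auto intro: card_image_le[of "{..<m}", simplified])
  finally show ?thesis .
qed

lemma card_le_card_mult_fibres:
  assumes "finite T" "f ` S \<subseteq> T" "\<And>t. t \<in> T \<Longrightarrow> card {x \<in> S. f x = t} \<le> c"
  shows "card S \<le> card T * c"
proof -
  have "S = (\<Union>t\<in>T. {x \<in> S. f x = t})" using assms(2) by auto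
  hence "card S \<le> (\<Sum>t\<in>T. card {x \<in> S. f x = t})" using card_UN_le[OF assms(1)] by metis
  also have "\<dots> \<le> (\<Sum>t\<in>T. c)" by (intro sum_mono assms)
  finally show ?thesis by simp
qed

lemma card_power_sums_le:
  assumes "prime q" "m < q" "m \<le> n"
  shows "card {x \<in> tuples n (residues q). \<forall>j\<in>{1..m}. [power_sums n x j = b j] (mod int q)} \<le> q ^ (n - m) * m ^ m"
    (is "card (?S n b) \<le> _")
  using assms(3)
proof (induction n arbitrary: b rule: dec_induct)
  case base
  show ?case using card_power_sums_le_square[OF assms(1,2)] by simp
next
  case (step n)
  have "card (?S (Suc n) b) \<le> card (residues q) * (q ^ (n - m) * m ^ m)"
  proof (rule card_le_card_mult_fibres[where f = "\<lambda>x. x n"])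
    show "(\<lambda>x. x n) ` ?S (Suc n) b \<subseteq> residues q" by (auto simp: PiE_iff)
  next
    fix t assume "t \<in> residues q"
    let ?b = "\<lambda>j. b j - t ^ j"
    have "card {x \<in> ?S (Suc n) b. x n = t} \<le> card (?S n ?b)"
    proof (rule card_inj_on_le[where f = "\<lambda>x. restrict x {..<n}"])
      show "inj_on (\<lambda>x. restrict x {..<n}) {x \<in> ?S (Suc n) b. x n = t}"
      proof (rule inj_onI)
        fix x y assume x: "x \<in> {x \<in> ?S (Suc n) b. x n = t}" and y: "y \<in> {x \<in> ?S (Suc n) b. x n = t}"
          and eq: "restrict x {..<n} = restrict y {..<n}"
        have "x i = y i" if "i < Suc n" for i
          using fun_cong[OF eq, of i] x y that by (cases "i = n") auto
        thus "x = y" using x y by (auto intro!: PiE_ext[of x "{..<Suc n}" "\<lambda>_. residues q"])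
      qed
      show "(\<lambda>x. restrict x {..<n}) ` {x \<in> ?S (Suc n) b. x n = t} \<subseteq> ?S n ?b"
      proof (rule image_subsetI)
        fix x assume x: "x \<in> {x \<in> ?S (Suc n) b. x n = t}"
        have "power_sums (Suc n) x j = power_sums n (restrict x {..<n}) j + t ^ j" for j
          using x by (simp add: tuple_sum_def)
        hence "[power_sums n (restrict x {..<n}) j = ?b j] (mod int q)" if "j \<in> {1..m}" for j
          using x that by (simp add: cong_iff_dvd_diff algebra_simps)
        thus "restrict x {..<n} \<in> ?S n ?b" using x by (auto simp: PiE_iff)
      qed
    qed (auto intro!: finite_subset[OF _ finite_tuples[of "residues q" n]])
    also have "\<dots> \<le> q ^ (n - m) * m ^ m" by (rule step.IH)
    finally show "card {x \<in> ?S (Suc n) b. x n = t} \<le> q ^ (n - m) * m ^ m" .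
  qed simp
  thus ?case using step.hyps by (simp add: Suc_diff_le)
qed

section \<open>Polynomials modulo a prime\<close>

abbreviation poly_sums :: "nat \<Rightarrow> (nat \<Rightarrow> int poly) \<Rightarrow> (nat \<Rightarrow> int) \<Rightarrow> nat \<Rightarrow> int" where
  "poly_sums r \<Phi> \<equiv> tuple_sum r (\<lambda>x j. poly (\<Phi> j) x)"

definition incongruent :: "nat \<Rightarrow> nat \<Rightarrow> (nat \<Rightarrow> int) \<Rightarrow> bool" where
  "incongruent q n x \<longleftrightarrow> (\<forall>i<n. \<forall>l<n. i \<noteq> l \<longrightarrow> \<not> int q dvd x i - x l)"

lemma incongruent_cong:
  assumes "incongruent q n x" "\<And>i. i < n \<Longrightarrow> [y i = x i] (mod int q)"
  shows "incongruent q n y"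
  unfolding incongruent_def
proof (intro allI impI notI)
  fix i l assume il: "i < n" "l < n" "i \<noteq> l" "int q dvd y i - y l"
  hence "[y i = y l] (mod int q)" by (simp add: cong_iff_dvd_diff)
  hence "[x i = x l] (mod int q)" using assms(2)[OF il(1)] assms(2)[OF il(2)] by (meson cong_sym cong_trans)
  thus False using assms(1) il by (auto simp: incongruent_def cong_iff_dvd_diff)
qed

definition triangular_mod :: "nat \<Rightarrow> nat \<Rightarrow> (nat \<Rightarrow> int poly) \<Rightarrow> bool" where
  "triangular_mod q n P \<longleftrightarrow> (\<forall>l<n. degree (P l) \<le> l \<and> \<not> int q dvd coeff (P l) l)"

lemma functional_vanishes_mod_prime:
  fixes L :: "int poly \<Rightarrow> int"
  assumes "prime q" "triangular_mod q n P"
    and linear: "\<And>a b p p'. L (smult a p - smult b p') = a * L p - b * L p'" "L 0 = 0"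
    and vanish: "\<And>l. l < n \<Longrightarrow> int q dvd L (P l)"
    and "\<forall>i\<ge>n. coeff p i = 0"
  shows "int q dvd L p"
  using assms(2) vanish assms(6)
proof (induction n arbitrary: p)
  case 0
  hence "p = 0" by (intro poly_eqI) auto
  thus ?case using linear(2) by simp
next
  case (Suc n)
  define m where "m = coeff (P n) n"
  define c where "c = coeff p n"
  have deg: "degree (P n) \<le> n" and lead: "\<not> int q dvd m"
    using Suc.prems(1) by (auto simp: triangular_mod_def m_def)
  have "int q dvd L (smult m p - smult c (P n))"
  proof (rule Suc.IH)
    show "\<forall>i\<ge>n. coeff (smult m p - smult c (P n)) i = 0"
    proof (intro allI impI)
      fix i assume "i \<ge> n"
      show "coeff (smult m p - smult c (P n)) i = 0"
      proof (cases "i = n")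
        case False
        hence "coeff p i = 0" "coeff (P n) i = 0"
          using Suc.prems(3) \<open>i \<ge> n\<close> deg by (auto intro!: coeff_eq_0)
        thus ?thesis by simp
      qed (simp add: m_def c_def)
    qed
  qed (use Suc.prems in \<open>auto simp: triangular_mod_def\<close>)
  hence "int q dvd m * L p - c * L (P n)" by (simp only: linear)
  moreover have "int q dvd c * L (P n)" using Suc.prems(2)[of n] by simp
  ultimately have "int q dvd m * L p" by (simp add: dvd_diff_left_iff)
  thus ?case using lead assms(1) by (simp add: prime_dvd_mult_iff)
qed

lemma vandermonde_mod_prime:
  assumes "prime q" "incongruent q r y" "triangular_mod q r P"
    and combination: "\<And>l. l < r \<Longrightarrow> int q dvd (\<Sum>i<r. z i * poly (P l) (y i))"
    and "i < r"
  shows "int q dvd z i"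
proof -
  \<comment> \<open>The polynomials \<open>P l\<close> span all polynomials of degree below \<open>r\<close>, in particular the one
    that vanishes at every \<open>y l\<close> except \<open>y i\<close>.\<close>
  define p where "p = (\<Prod>l\<in>{..<r} - {i}. [:- y l, 1:])"
  have "degree p \<le> (\<Sum>l\<in>{..<r} - {i}. degree [:- y l, 1:])"
    using degree_prod_sum_le[of "{..<r} - {i}" "\<lambda>l. [:- y l, 1:]"] by (simp add: p_def o_def)
  also have "\<dots> = r - 1" using assms(5) by simp
  finally have p_coeffs: "\<forall>i\<ge>r. coeff p i = 0" using assms(5) by (auto intro!: coeff_eq_0)
  have "int q dvd (\<Sum>l<r. z l * poly p (y l))"
    by (rule functional_vanishes_mod_prime[where L = "\<lambda>p. \<Sum>l<r. z l * poly p (y l)",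
          OF assms(1,3) _ _ combination p_coeffs])
      (simp_all add: sum_distrib_left sum_subtractf[symmetric] algebra_simps)
  also have "(\<Sum>l<r. z l * poly p (y l)) = (\<Sum>l\<in>{i}. z l * poly p (y l))"
  proof (rule sum.mono_neutral_right)
    show "\<forall>l\<in>{..<r} - {i}. z l * poly p (y l) = 0"
      by (auto simp: p_def poly_prod)
  qed (use assms(5) in auto)
  finally have "int q dvd z i * (\<Prod>l\<in>{..<r} - {i}. y i - y l)" by (simp add: p_def poly_prod)
  moreover have "\<not> int q dvd (\<Prod>l\<in>{..<r} - {i}. y i - y l)"
    using assms(1,2,5) by (auto simp: prime_dvd_prod_iff incongruent_def)
  ultimately show ?thesis using assms(1) by (simp add: prime_dvd_mult_iff)
qed

lemma card_poly_sums_le: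
  assumes "prime q" "r < q" "triangular_mod q (Suc r) P"
  shows "card {x \<in> tuples r (residues q). \<forall>j\<in>{1..r}. [poly_sums r P x j = b j] (mod int q)} \<le> r ^ r"
    (is "card ?S \<le> _")
proof (cases "?S = {}")
  case True
  thus ?thesis by (simp only: card.empty zero_le)
next
  case False
  then obtain y where y: "y \<in> ?S" by blast
  have "?S \<subseteq> {x \<in> tuples r (residues q). \<forall>j\<in>{1..r}. [power_sums r x j = power_sums r y j] (mod int q)}" (is "_ \<subseteq> ?T")
  proof
    fix x assume x: "x \<in> ?S"
    define L where "L p = (\<Sum>i<r. poly p (x i)) - (\<Sum>i<r. poly p (y i))" for p
    have L: "L (smult a p - smult b p') = a * L p - b * L p'" "L 0 = 0" for a b p p'
      by (simp_all add: L_def sum_distrib_left sum_subtractf algebra_simps)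
    have L_P: "int q dvd L (P l)" if "l < Suc r" for l
    proof (cases "l = 0")
      case True
      have "degree (P 0) \<le> 0" using assms(3) by (auto simp: triangular_mod_def)
      then obtain c where "P 0 = [:c:]" by (auto elim: degree_eq_zeroE)
      thus ?thesis by (simp add: True L_def)
    next
      case False
      hence "l \<in> {1..r}" using that by simp
      hence "[poly_sums r P x l = b l] (mod int q)" "[poly_sums r P y l = b l] (mod int q)"
        using x y by blast+
      hence "[poly_sums r P x l = poly_sums r P y l] (mod int q)" using cong_sym cong_trans by blast
      thus ?thesis by (simp add: L_def tuple_sum_def cong_iff_dvd_diff)
    qed
    have "[power_sums r x j = power_sums r y j] (mod int q)" if "j \<in> {1..r}" for j
    proof -
      have "\<forall>i\<ge>Suc r. coeff (monom (1 :: int) j) i = 0" using that by simp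
      with L_P have "int q dvd L (monom 1 j)"
        by (rule functional_vanishes_mod_prime[of q _ _ L, OF assms(1,3) L])
      thus ?thesis by (simp add: L_def tuple_sum_def poly_monom cong_iff_dvd_diff)
    qed
    thus "x \<in> ?T" using x by auto
  qed
  hence "card ?S \<le> card ?T" by (intro card_mono finite_subset[OF _ finite_tuples[of "residues q" r]]) auto
  also have "\<dots> \<le> r ^ r" by (rule card_power_sums_le_square[OF assms(1,2)])
  finally show ?thesis .
qed

section \<open>Hensel lifting\<close>

definition nonsingular_mod :: "nat \<Rightarrow> nat \<Rightarrow> nat set \<Rightarrow> (nat \<Rightarrow> int poly) \<Rightarrow> (nat \<Rightarrow> int) \<Rightarrow> bool" where
  "nonsingular_mod q r R \<Phi> \<xi> \<longleftrightarrow> (\<forall>y z. (\<forall>i<r. [y i = \<xi> i] (mod int q)) \<longrightarrow>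
      (\<forall>j\<in>R. int q dvd (\<Sum>i<r. z i * poly (pderiv (\<Phi> j)) (y i))) \<longrightarrow> (\<forall>i<r. int q dvd z i))"

lemma poly_taylor_dvd:
  fixes p :: "int poly"
  shows "h ^ 2 dvd poly p (x + h) - (poly p x + h * poly (pderiv p) x)"
proof (induction p)
  case (pCons a p)
  then obtain c where c: "poly p (x + h) - (poly p x + h * poly (pderiv p) x) = h ^ 2 * c" by (elim dvdE)
  have "poly (pCons a p) (x + h) - (poly (pCons a p) x + h * poly (pderiv (pCons a p)) x)
      = (x + h) * (poly p (x + h) - (poly p x + h * poly (pderiv p) x)) + h ^ 2 * poly (pderiv p) x"
    by (simp add: pderiv_pCons algebra_simps power2_eq_square)
  thus ?case unfolding c by simp
qed simp

lemma poly_shift_mod_prime_power: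
  fixes p :: "int poly" and q :: int
  assumes "a \<ge> 1"
  shows "q ^ Suc a dvd poly p (y + q ^ a * z) - poly p y - q ^ a * (z * poly (pderiv p) y)"
proof -
  have "q ^ Suc a dvd (q ^ a) ^ 2"
    using assms by (simp only: power_mult[symmetric]) (intro le_imp_power_dvd, simp)
  also have "\<dots> dvd (q ^ a * z) ^ 2" by (simp add: power_mult_distrib)
  also have "\<dots> dvd poly p (y + q ^ a * z) - (poly p y + q ^ a * z * poly (pderiv p) y)"
    by (rule poly_taylor_dvd)
  finally show ?thesis by (simp add: algebra_simps)
qed

lemma hensel_step:
  assumes "prime q" "nonsingular_mod q r R \<Phi> \<xi>" "a \<ge> 1"
    and y: "\<And>i. i < r \<Longrightarrow> [y i = \<xi> i] (mod int q)"
    and close: "\<And>i. i < r \<Longrightarrow> int q ^ a dvd x i - y i"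
    and sums: "\<And>j. j \<in> R \<Longrightarrow> int q ^ Suc a dvd poly_sums r \<Phi> x j - poly_sums r \<Phi> y j"
    and "i < r"
  shows "int q ^ Suc a dvd x i - y i"
proof -
  define z where "z i = (x i - y i) div int q ^ a" for i
  have z: "x i = y i + int q ^ a * z i" if "i < r" for i
    using close[OF that] by (simp add: z_def)
  have "int q dvd (\<Sum>i<r. z i * poly (pderiv (\<Phi> j)) (y i))" if j: "j \<in> R" for j
  proof -
    let ?lin = "\<lambda>i. int q ^ a * (z i * poly (pderiv (\<Phi> j)) (y i))"
    have "int q ^ Suc a dvd (\<Sum>i<r. poly (\<Phi> j) (x i) - poly (\<Phi> j) (y i) - ?lin i)"
      using poly_shift_mod_prime_power[OF assms(3)] z by (intro dvd_sum) auto
    also have "\<dots> = (poly_sums r \<Phi> x j - poly_sums r \<Phi> y j) - (\<Sum>i<r. ?lin i)"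
      by (simp add: tuple_sum_def sum_subtractf)
    finally have "int q ^ Suc a dvd (\<Sum>i<r. ?lin i)"
      using dvd_diff[OF sums[OF j]] by fastforce
    hence "int q ^ a * int q dvd int q ^ a * (\<Sum>i<r. z i * poly (pderiv (\<Phi> j)) (y i))"
      by (simp only: power_Suc2 sum_distrib_left)
    thus ?thesis using assms(1) by (simp add: prime_gt_0_nat)
  qed
  hence "int q dvd z i"
    using assms(2,7) y unfolding nonsingular_mod_def by blast
  thus ?thesis using z[OF assms(7)] by (auto simp: dvd_def mult_ac)
qed

lemma hensel_unique:
  assumes "prime q" "nonsingular_mod q r R \<Phi> \<xi>" "k \<ge> 1"
    and x: "\<And>i. i < r \<Longrightarrow> [x i = \<xi> i] (mod int q)" and y: "\<And>i. i < r \<Longrightarrow> [y i = \<xi> i] (mod int q)"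
    and sums: "\<And>j. j \<in> R \<Longrightarrow> [poly_sums r \<Phi> x j = poly_sums r \<Phi> y j] (mod int q ^ k)"
    and "i < r"
  shows "int q ^ k dvd x i - y i"
proof -
  have "\<forall>i<r. int q ^ a dvd x i - y i" if "a \<ge> 1" "a \<le> k" for a
    using that
  proof (induction a rule: nat_induct_at_least)
    case base
    have "[x i = y i] (mod int q)" if "i < r" for i
      by (rule cong_trans[OF x[OF that] cong_sym[OF y[OF that]]])
    thus ?case by (simp add: cong_iff_dvd_diff)
  next
    case (Suc a)
    have "int q ^ Suc a dvd poly_sums r \<Phi> x j - poly_sums r \<Phi> y j" if "j \<in> R" for j
      using sums[OF that] le_imp_power_dvd[OF Suc.prems, of "int q"]
      by (auto simp: cong_iff_dvd_diff intro: dvd_trans)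
    with Suc show ?case using hensel_step[OF assms(1,2) Suc.hyps y] by simp
  qed
  thus ?thesis using assms(3,7) by blast
qed

section \<open>Translated and differenced systems\<close>

abbreviation mixed_sums :: "(nat \<Rightarrow> int poly) \<Rightarrow> nat \<Rightarrow> nat \<Rightarrow> (nat \<Rightarrow> int) \<times> (nat \<Rightarrow> int) \<Rightarrow> nat \<Rightarrow> int" where
  "mixed_sums \<Psi> r u \<equiv> joint_sum (poly_sums r \<Psi>) (power_sums u)"

definition graded_system :: "nat \<Rightarrow> nat \<Rightarrow> (nat \<Rightarrow> int poly) \<Rightarrow> bool" where
  "graded_system k d \<Psi> \<longleftrightarrow> (\<forall>j\<in>{1..k}. degree (\<Psi> j) \<le> j - d)"

lemma graded_systemD: "graded_system k d \<Psi> \<Longrightarrow> j \<in> {1..k} \<Longrightarrow> degree (\<Psi> j) \<le> j - d"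
  by (simp add: graded_system_def)

definition translate :: "int \<Rightarrow> (nat \<Rightarrow> int poly) \<Rightarrow> nat \<Rightarrow> int poly" where
  "translate c \<Psi> j = (\<Sum>l=1..j. smult (of_nat (j choose l) * (- c) ^ (j - l)) (\<Psi> l))"

lemma poly_translate: "poly (translate c \<Psi> j) x = (\<Sum>l=1..j. of_nat (j choose l) * (- c) ^ (j - l) * poly (\<Psi> l) x)"
  by (simp add: translate_def poly_sum)

lemma graded_system_translate:
  assumes "graded_system k d \<Psi>"
  shows "graded_system k d (translate c \<Psi>)"
  unfolding graded_system_def translate_def
proof (intro ballI degree_sum_le)
  fix j l assume "j \<in> {1..k}" "l \<in> {1..j}"
  hence "degree (\<Psi> l) \<le> l - d" "l - d \<le> j - d" using assms by (auto simp: graded_system_def)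
  thus "degree (smult (of_nat (j choose l) * (- c) ^ (j - l)) (\<Psi> l)) \<le> j - d"
    by (meson degree_smult_le order.trans)
qed simp

lemma coeff_translate_top:
  assumes "graded_system k d \<Psi>" "j \<in> {1..k}" "d < j"
  shows "coeff (translate c \<Psi> j) (j - d) = coeff (\<Psi> j) (j - d)"
proof -
  have "coeff (translate c \<Psi> j) (j - d)
      = (\<Sum>l\<in>{1..j}. of_nat (j choose l) * (- c) ^ (j - l) * coeff (\<Psi> l) (j - d))"
    by (simp add: translate_def coeff_sum)
  also have "\<dots> = (\<Sum>l\<in>{j}. of_nat (j choose l) * (- c) ^ (j - l) * coeff (\<Psi> l) (j - d))"
  proof (rule sum.mono_neutral_right)
    have "coeff (\<Psi> l) (j - d) = 0" if l: "l \<in> {1..j} - {j}" for l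
    proof (rule coeff_eq_0)
      have "degree (\<Psi> l) \<le> l - d" using assms l by (auto simp: graded_system_def)
      also have "l - d < j - d" using l assms by auto
      finally show "degree (\<Psi> l) < j - d" .
    qed
    thus "\<forall>l\<in>{1..j} - {j}. of_nat (j choose l) * (- c) ^ (j - l) * coeff (\<Psi> l) (j - d) = 0" by simp
  qed (use assms in auto)
  finally show ?thesis by simp
qed

lemma sum_binomial_diff_power:
  fixes c z :: int
  shows "(\<Sum>l=1..j. of_nat (j choose l) * (- c) ^ (j - l) * z ^ l) = (z - c) ^ j - (- c) ^ j"
proof -
  have "(z + (- c)) ^ j = (\<Sum>l\<le>j. of_nat (j choose l) * z ^ l * (- c) ^ (j - l))" by (rule binomial_ring)
  also have "\<dots> = (- c) ^ j + (\<Sum>l=1..j. of_nat (j choose l) * z ^ l * (- c) ^ (j - l))"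
    by (subst atMost_atLeast0, subst sum.atLeast_Suc_atMost) auto
  finally show ?thesis by (simp add: mult_ac)
qed

lemma binomial_transform_mixed_sums:
  "(\<Sum>l=1..j. of_nat (j choose l) * (- c) ^ (j - l) * mixed_sums \<Psi> r u (x, z) l)
   = poly_sums r (translate c \<Psi>) x j + power_sums u (\<lambda>m. z m - c) j - int u * (- c) ^ j"
proof -
  have "(\<Sum>l=1..j. of_nat (j choose l) * (- c) ^ (j - l) * (\<Sum>i<r. poly (\<Psi> l) (x i)))
      = (\<Sum>i<r. poly (translate c \<Psi> j) (x i))"
    unfolding poly_translate sum_distrib_left by (rule sum.swap)
  moreover have "(\<Sum>l=1..j. of_nat (j choose l) * (- c) ^ (j - l) * (\<Sum>m<u. z m ^ l))
      = (\<Sum>m<u. (z m - c) ^ j - (- c) ^ j)"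
    unfolding sum_distrib_left sum_binomial_diff_power[symmetric] by (rule sum.swap)
  ultimately show ?thesis
    by (simp add: tuple_sum_def distrib_left sum.distrib sum_subtractf)
qed

lemma translate_collision:
  assumes "\<forall>j\<in>{1..k}. mixed_sums \<Psi> r u (x, z) j = mixed_sums \<Psi> r u (y, w) j" "j \<in> {1..k}"
  shows "poly_sums r (translate c \<Psi>) x j + power_sums u (\<lambda>m. z m - c) j
       = poly_sums r (translate c \<Psi>) y j + power_sums u (\<lambda>m. w m - c) j"
proof -
  have "(\<Sum>l=1..j. of_nat (j choose l) * (- c) ^ (j - l) * mixed_sums \<Psi> r u (x, z) l)
      = (\<Sum>l=1..j. of_nat (j choose l) * (- c) ^ (j - l) * mixed_sums \<Psi> r u (y, w) l)"
    using assms by (intro sum.cong refl) auto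
  thus ?thesis unfolding binomial_transform_mixed_sums by simp
qed

definition difference_quotient :: "int \<Rightarrow> int poly \<Rightarrow> int poly" where
  "difference_quotient h p = (\<Sum>i\<le>degree p. smult (coeff p i) (\<Sum>m<i. [:0, 1:] ^ (i - Suc m) * [:h, 1:] ^ m))"

lemma poly_difference_quotient: "poly p (x + h) - poly p x = h * poly (difference_quotient h p) x"
proof -
  have "poly p (x + h) - poly p x = (\<Sum>i\<le>degree p. coeff p i * ((x + h) ^ i - x ^ i))"
    by (simp add: poly_altdef sum_subtractf right_diff_distrib)
  also have "\<dots> = (\<Sum>i\<le>degree p. coeff p i * (h * (\<Sum>m<i. x ^ (i - Suc m) * (x + h) ^ m)))"
    by (simp add: power_diff_sumr2)
  also have "\<dots> = h * poly (difference_quotient h p) x"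
    by (simp add: difference_quotient_def poly_sum sum_distrib_left add.commute mult_ac)
  finally show ?thesis .
qed

lemma degree_lead_coeff_difference_quotient:
  assumes "degree p \<le> n"
  shows "degree (difference_quotient h p) \<le> n - 1"
    and "coeff (difference_quotient h p) (n - 1) = int n * coeff p n"
proof -
  let ?f = "\<lambda>i m. [:0, 1:] ^ (i - Suc m) * [:h, 1:] ^ m" and ?g = "\<lambda>i. \<Sum>m<i. [:0, 1:] ^ (i - Suc m) * [:h, 1:] ^ m"
  have deg_f: "degree (?f i m) = i - 1" if "m < i" for i m
    using that by (subst degree_mult_eq) (auto simp: degree_linear_power)
  have lead_f: "coeff (?f i m) (i - 1) = 1" if "m < i" for i m
  proof -
    have "coeff (?f i m) (i - 1) = lead_coeff (?f i m)" by (simp only: deg_f[OF that])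
    thus ?thesis by (simp add: lead_coeff_mult lead_coeff_power)
  qed
  have deg_g: "degree (?g i) \<le> i - 1" for i
    by (rule degree_sum_le) (auto simp: deg_f)
  show "degree (difference_quotient h p) \<le> n - 1"
    unfolding difference_quotient_def
  proof (rule degree_sum_le)
    fix i assume "i \<in> {..degree p}"
    hence "i - 1 \<le> n - 1" using assms by auto
    thus "degree (smult (coeff p i) (?g i)) \<le> n - 1" using deg_g[of i] by (meson degree_smult_le order.trans)
  qed simp
  have "coeff (difference_quotient h p) (n - 1) = (\<Sum>i\<le>degree p. coeff p i * coeff (?g i) (n - 1))"
    by (simp add: difference_quotient_def coeff_sum)
  also have "\<dots> = (\<Sum>i\<in>{n}. coeff p i * coeff (?g i) (n - 1))"
  proof (rule sum.mono_neutral_cong)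
    show "coeff p i * coeff (?g i) (n - 1) = 0" if "i \<in> {..degree p} - {n}" for i
    proof (cases "i = 0")
      case False
      hence "degree (?g i) < n - 1" using deg_g[of i] that assms by auto
      thus ?thesis by (simp add: coeff_eq_0)
    qed simp
  qed (use assms in \<open>auto simp: coeff_eq_0\<close>)
  also have "\<dots> = int n * coeff p n"
    by (simp add: coeff_sum lead_f[unfolded One_nat_def])
  finally show "coeff (difference_quotient h p) (n - 1) = int n * coeff p n" .
qed

definition differenced_system :: "nat \<Rightarrow> nat \<Rightarrow> int \<Rightarrow> (nat \<Rightarrow> int poly) \<Rightarrow> nat \<Rightarrow> int poly" where
  "differenced_system k q h \<Phi> j = smult (h * int q ^ (k - j)) (difference_quotient (h * int q ^ k) (\<Phi> j))"

definition scaled_difference :: "nat \<Rightarrow> (nat \<Rightarrow> int poly) \<Rightarrow> int \<Rightarrow> int \<Rightarrow> nat \<Rightarrow> int" where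
  "scaled_difference q \<Phi> x y j = (poly (\<Phi> j) x - poly (\<Phi> j) y) div int q ^ j"

lemma poly_differenced_system:
  assumes "q > 0" "j \<le> k"
  shows "poly (differenced_system k q h \<Phi> j) x = scaled_difference q \<Phi> (x + h * int q ^ k) x j"
proof -
  have "int q ^ k = int q ^ j * int q ^ (k - j)" using assms(2) by (simp add: power_add[symmetric])
  hence "poly (\<Phi> j) (x + h * int q ^ k) - poly (\<Phi> j) x = int q ^ j * poly (differenced_system k q h \<Phi> j) x"
    unfolding poly_difference_quotient differenced_system_def by simp
  thus ?thesis using assms(1) by (simp add: scaled_difference_def)
qed

lemma graded_differenced_system:
  assumes "graded_system k d \<Phi>"
  shows "graded_system k (Suc d) (differenced_system k q h \<Phi>)"
  unfolding graded_system_def differenced_system_def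
proof
  fix j assume "j \<in> {1..k}"
  hence "degree (\<Phi> j) \<le> j - d" using assms by (auto simp: graded_system_def)
  from degree_lead_coeff_difference_quotient(1)[OF this]
  show "degree (smult (h * int q ^ (k - j)) (difference_quotient (h * int q ^ k) (\<Phi> j))) \<le> j - Suc d"
    by (intro order.trans[OF degree_smult_le]) simp
qed

lemma coeff_differenced_system_top:
  assumes "graded_system k d \<Phi>" "j \<in> {1..k}"
  shows "coeff (differenced_system k q h \<Phi> j) (j - Suc d)
    = h * int q ^ (k - j) * int (j - d) * coeff (\<Phi> j) (j - d)"
proof -
  have "degree (\<Phi> j) \<le> j - d" using assms by (auto simp: graded_system_def)
  from degree_lead_coeff_difference_quotient(2)[OF this] show ?thesis
    by (simp add: differenced_system_def)
qed

lemma nonsingular_mod_graded: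
  assumes "prime q" "k < q" "r \<le> k" "graded_system k (k - r) \<Phi>"
    and lead: "\<And>j. j \<in> {k - r + 1..k} \<Longrightarrow> \<not> int q dvd coeff (\<Phi> j) (j - (k - r))"
    and "incongruent q r \<xi>"
  shows "nonsingular_mod q r {k - r + 1..k} \<Phi> \<xi>"
  unfolding nonsingular_mod_def
proof (intro allI impI)
  fix y z i
  assume y: "\<forall>i<r. [y i = \<xi> i] (mod int q)"
    and z: "\<forall>j\<in>{k - r + 1..k}. int q dvd (\<Sum>i<r. z i * poly (pderiv (\<Phi> j)) (y i))"
    and i: "i < r"
  let ?P = "\<lambda>l. pderiv (\<Phi> (k - r + Suc l))"
  have triangular: "triangular_mod q r ?P" unfolding triangular_mod_def
  proof (intro allI impI conjI)
    fix l assume l: "l < r"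
    hence j: "k - r + Suc l \<in> {1..k}" "k - r + Suc l \<in> {k - r + 1..k}" using assms(3) by auto
    have "degree (\<Phi> (k - r + Suc l)) \<le> Suc l" using assms(4) j(1) unfolding graded_system_def by fastforce
    thus "degree (?P l) \<le> l" by (simp add: degree_pderiv)
    have "\<not> int q dvd coeff (\<Phi> (k - r + Suc l)) (Suc l)" using lead[OF j(2)] by simp
    moreover have "\<not> int q dvd int (Suc l)" using l assms(2,3) by (auto simp del: of_nat_Suc dest: dvd_imp_le)
    ultimately show "\<not> int q dvd coeff (?P l) l"
      using assms(1) by (simp add: coeff_pderiv prime_dvd_mult_iff del: of_nat_Suc)
  qed
  have distinct: "incongruent q r y" using y by (intro incongruent_cong[OF assms(6)]) auto
  have combination: "int q dvd (\<Sum>i<r. z i * poly (?P l) (y i))" if "l < r" for l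
  proof -
    have "k - r + Suc l \<in> {k - r + 1..k}" using that assms(3) by auto
    thus ?thesis using z by blast
  qed
  show "int q dvd z i"
    by (rule vandermonde_mod_prime[OF assms(1) distinct triangular combination i])
qed

lemma translate_monom: "translate c (monom 1) j = [:- c, 1:] ^ j - [:(- c) ^ j:]"
proof -
  have "poly (translate c (monom 1) j) x = poly ([:- c, 1:] ^ j - [:(- c) ^ j:]) x" for x
    using sum_binomial_diff_power[of j c x] by (simp add: poly_translate poly_monom poly_power)
  thus ?thesis by (simp add: poly_eq_poly_eq_iff[symmetric] ext)
qed

lemma nonsingular_mod_translate_monom:
  assumes "prime q" "r + 1 < q" "incongruent q r \<xi>" "\<And>i. i < r \<Longrightarrow> \<not> int q dvd \<xi> i - c"
  shows "nonsingular_mod q r {2..r + 1} (translate c (monom 1)) \<xi>"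
  unfolding nonsingular_mod_def
proof (intro allI impI)
  fix y z i
  assume y: "\<forall>i<r. [y i = \<xi> i] (mod int q)"
    and z: "\<forall>j\<in>{2..r + 1}. int q dvd (\<Sum>i<r. z i * poly (pderiv (translate c (monom 1) j)) (y i))"
    and i: "i < r"
  let ?P = "\<lambda>l. smult (int (l + 2)) ([:- c, 1:] ^ l)"
  have triangular: "triangular_mod q r ?P" unfolding triangular_mod_def
  proof (intro allI impI conjI)
    fix l assume l: "l < r"
    have "degree ([:- c, 1:] ^ l) = l" by (rule degree_linear_power)
    thus "degree (?P l) \<le> l" using degree_smult_le[of "int (l + 2)" "[:- c, 1:] ^ l"] by simp
    have "coeff ([:- c, 1:] ^ l) l = 1"
      using \<open>degree ([:- c, 1:] ^ l) = l\<close> lead_coeff_power[of "[:- c, 1:]" l] by simp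
    moreover have "\<not> q dvd l + 2" using l assms(2) by (auto dest: dvd_imp_le)
    hence "\<not> int q dvd int (l + 2)" by (simp only: int_dvd_int_iff not_False_eq_True)
    ultimately show "\<not> int q dvd coeff (?P l) l" by (simp del: of_nat_add)
  qed
  have distinct: "incongruent q r y" using y by (intro incongruent_cong[OF assms(3)]) auto
  have combination: "int q dvd (\<Sum>i<r. z i * (y i - c) * poly (?P l) (y i))" if "l < r" for l
  proof -
    have "poly (pderiv (translate c (monom 1) (Suc j))) x = int (Suc j) * (x - c) ^ j" for j x
      unfolding translate_monom pderiv_diff pderiv_power_Suc by (simp add: pderiv_pCons poly_power)
    hence "z i * (y i - c) * poly (?P l) (y i) = z i * poly (pderiv (translate c (monom 1) (Suc (Suc l)))) (y i)" for i
      by (simp add: poly_power)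
    moreover have "Suc (Suc l) \<in> {2..r + 1}" using that by simp
    hence "int q dvd (\<Sum>i<r. z i * poly (pderiv (translate c (monom 1) (Suc (Suc l)))) (y i))" using z by blast
    ultimately show ?thesis by (simp only:)
  qed
  have "int q dvd z i * (y i - c)"
    by (rule vandermonde_mod_prime[where z = "\<lambda>i. z i * (y i - c)", OF assms(1) distinct triangular combination i])
  moreover have "\<not> int q dvd y i - c"
    using y i assms(4)[OF i] by (metis cong_iff_dvd_diff cong_sym cong_trans)
  ultimately show "int q dvd z i" using assms(1) by (simp add: prime_dvd_mult_iff)
qed

section \<open>Passing to residue classes\<close>

definition residue_tuple :: "nat \<Rightarrow> nat \<Rightarrow> (nat \<Rightarrow> int) \<Rightarrow> nat \<Rightarrow> int" where
  "residue_tuple q n x = (\<lambda>i\<in>{..<n}. x i mod int q)"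

definition residue_pair :: "nat \<Rightarrow> nat \<Rightarrow> nat \<Rightarrow> (nat \<Rightarrow> int) \<times> (nat \<Rightarrow> int) \<Rightarrow> (nat \<Rightarrow> int) \<times> (nat \<Rightarrow> int)" where
  "residue_pair q r u = map_prod (residue_tuple q r) (residue_tuple q u)"

lemma residue_tuple_in: "q > 0 \<Longrightarrow> residue_tuple q n x \<in> tuples n (residues q)"
  by (auto simp: residue_tuple_def)

lemma residue_tuple_cong: "i < n \<Longrightarrow> [residue_tuple q n x i = x i] (mod int q)"
  by (simp add: residue_tuple_def cong_def)

lemma residue_tuple_eqD:
  assumes "residue_tuple q n x = \<xi>" "i < n"
  shows "[x i = \<xi> i] (mod int q)"
  unfolding assms(1)[symmetric] by (rule cong_sym[OF residue_tuple_cong[OF assms(2)]])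

lemma incongruent_residue_tuple: "incongruent q n x \<Longrightarrow> incongruent q n (residue_tuple q n x)"
  by (erule incongruent_cong) (rule residue_tuple_cong)

lemma poly_diff_dvd:
  fixes p :: "int poly"
  shows "x - y dvd poly p x - poly p y"
  using poly_difference_quotient[of p y "x - y"] by simp

lemma mixed_sums_residue_pair_cong: "[mixed_sums \<Psi> r u p j = mixed_sums \<Psi> r u (residue_pair q r u p) j] (mod int q)"
proof -
  obtain x z where p: "p = (x, z)" by (metis surj_pair)
  have "[poly (\<Psi> j) (x i) = poly (\<Psi> j) (residue_tuple q r x i)] (mod int q)" if "i < r" for i
    using cong_sym[OF residue_tuple_cong[OF that]] poly_diff_dvd dvd_trans unfolding cong_iff_dvd_diff by blast
  moreover have "[z m ^ j = residue_tuple q u z m ^ j] (mod int q)" if "m < u" for m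
    by (rule cong_pow[OF cong_sym[OF residue_tuple_cong[OF that]]])
  ultimately show ?thesis
    by (auto simp: p residue_pair_def tuple_sum_def intro!: cong_add cong_sum)
qed

lemma int_div_less_iff:
  fixes m n q :: int
  assumes "q > 0"
  shows "m div q < n \<longleftrightarrow> m < n * q"
proof -
  have "m div q < n \<longleftrightarrow> \<lfloor>real_of_int m / real_of_int q\<rfloor> < n" by (simp add: floor_divide_of_int_eq)
  also have "\<dots> \<longleftrightarrow> real_of_int m < real_of_int (n * q)"
    using assms by (simp add: floor_less_iff pos_divide_less_eq)
  finally show ?thesis by (simp only: of_int_less_iff)
qed

lemma card_residues_with_remainder_le:
  assumes "q > 0" "j \<le> k"
  shows "card {b \<in> {0..<int q ^ k}. b mod int q ^ j = v} \<le> q ^ (k - j)"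
proof -
  let ?S = "{b \<in> {0..<int q ^ k}. b mod int q ^ j = v}"
  have q_power: "int q ^ k = int q ^ (k - j) * int q ^ j" "int q ^ j > 0"
    using assms by (simp_all add: power_add[symmetric])
  have "card ?S \<le> card {0..<int q ^ (k - j)}"
  proof (rule card_inj_on_le[where f = "\<lambda>b. b div int q ^ j"])
    show "inj_on (\<lambda>b. b div int q ^ j) ?S"
      by (rule inj_onI) (metis (mono_tags, lifting) div_mult_mod_eq mem_Collect_eq)
    show "(\<lambda>b. b div int q ^ j) ` ?S \<subseteq> {0..<int q ^ (k - j)}"
      using q_power by (auto simp: pos_imp_zdiv_nonneg_iff int_div_less_iff)
  qed simp
  also have "\<dots> = q ^ (k - j)" by (simp flip: of_nat_power)
  finally show ?thesis .
qed

lemma sum_diff_eq_choose_two: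
  assumes "r \<le> k"
  shows "(\<Sum>j=k-r+1..k. k - j) = r choose 2"
proof -
  have "(\<Sum>j=k-r+1..k. k - j) = (\<Sum>i<r. i)"
    using assms by (intro sum.reindex_bij_witness[of _ "\<lambda>i. k - i" "\<lambda>j. k - j"]) auto
  also have "\<dots> = r choose 2"
    by (induction r) (simp_all add: numeral_2_eq_2)
  finally show ?thesis .
qed

lemma sum_card_fibres_le:
  assumes "finite S" "finite T"
  shows "(\<Sum>t\<in>T. card {x \<in> S. f x = t}) \<le> card S"
proof -
  have "(\<Sum>t\<in>T. card {x \<in> S. f x = t}) = card (\<Union>t\<in>T. {x \<in> S. f x = t})"
    using assms by (intro card_UN_disjoint[symmetric]) auto
  also have "\<dots> \<le> card S" using assms by (intro card_mono) auto
  finally show ?thesis .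
qed

definition lifted_solutions ::
  "nat \<Rightarrow> nat \<Rightarrow> nat \<Rightarrow> nat \<Rightarrow> (nat \<Rightarrow> int poly) \<Rightarrow> int set \<Rightarrow> int set \<Rightarrow>
     ((nat \<Rightarrow> int \<times> int) \<times> ((nat \<Rightarrow> int) \<times> (nat \<Rightarrow> int))) set" where
  "lifted_solutions k q r u \<Phi> X I = {p \<in> tuples r (congruent_pairs X (int q ^ k)) \<times> (tuples u I \<times> tuples u I).
      \<forall>j\<in>{1..k}. joint_sum (tuple_sum r (\<lambda>(x, y). scaled_difference q \<Phi> x y))
        (\<lambda>(z, w) j. power_sums u z j - power_sums u w j) p j = 0}"

lemma finite_lifted_solutions:
  assumes "finite X" "finite I"
  shows "finite (lifted_solutions k q r u \<Phi> X I)"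
  by (rule finite_subset[of _ "tuples r (congruent_pairs X (int q ^ k)) \<times> (tuples u I \<times> tuples u I)"])
    (use assms finite_congruent_pairs in
      \<open>auto simp: lifted_solutions_def intro!: finite_cartesian_product finite_tuples\<close>)

definition pair_tuples ::
  "nat \<Rightarrow> ((nat \<Rightarrow> 'a) \<times> 'b) \<times> ((nat \<Rightarrow> 'a) \<times> 'b) \<Rightarrow> (nat \<Rightarrow> 'a \<times> 'a) \<times> ('b \<times> 'b)" where
  "pair_tuples r = (\<lambda>((x, z), (y, w)). (\<lambda>i\<in>{..<r}. (x i, y i), (z, w)))"

lemma inj_on_pair_tuples: "inj_on (pair_tuples r) ((tuples r X \<times> B) \<times> (tuples r X \<times> B))"
proof (rule inj_onI)
  fix s t assume mem: "s \<in> (tuples r X \<times> B) \<times> (tuples r X \<times> B)" "t \<in> (tuples r X \<times> B) \<times> (tuples r X \<times> B)"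
    and eq: "pair_tuples r s = pair_tuples r t"
  obtain x z y w x' z' y' w' where st: "s = ((x, z), (y, w))" "t = ((x', z'), (y', w'))"
    by (metis surj_pair)
  have pairs: "(\<lambda>i\<in>{..<r}. (x i, y i)) = (\<lambda>i\<in>{..<r}. (x' i, y' i))" and zw: "z = z'" "w = w'"
    using eq by (simp_all add: st pair_tuples_def)
  have "x i = x' i \<and> y i = y' i" if "i < r" for i
    using fun_cong[OF pairs, of i] that by simp
  hence "x = x'" "y = y'" using mem by (auto simp: st intro!: PiE_ext[of _ "{..<r}" "\<lambda>_. X"])
  thus "s = t" by (simp add: st zw)
qed

lemma sum_scaled_difference:
  assumes "\<And>i. i < r \<Longrightarrow> int q ^ k dvd x i - y i" "j \<le> k"
  shows "int q ^ j * tuple_sum r (\<lambda>(x, y). scaled_difference q \<Phi> x y) (\<lambda>i\<in>{..<r}. (x i, y i)) j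
    = poly_sums r \<Phi> x j - poly_sums r \<Phi> y j"
proof -
  have "int q ^ j * scaled_difference q \<Phi> (x i) (y i) j = poly (\<Phi> j) (x i) - poly (\<Phi> j) (y i)" if "i < r" for i
  proof -
    have "int q ^ j dvd int q ^ k" using assms(2) by (rule le_imp_power_dvd)
    also have "\<dots> dvd x i - y i" by (rule assms(1)[OF that])
    also have "\<dots> dvd poly (\<Phi> j) (x i) - poly (\<Phi> j) (y i)" by (rule poly_diff_dvd)
    finally show ?thesis by (simp add: scaled_difference_def)
  qed
  thus ?thesis by (simp add: tuple_sum_def sum_distrib_left sum_subtractf[symmetric])
qed

lemma pair_tuples_in_lifted_solutions:
  assumes "prime q" "k \<ge> 1" "nonsingular_mod q r R \<Phi> \<xi>"
    and mem: "x \<in> tuples r X" "y \<in> tuples r X" "z \<in> tuples u I" "w \<in> tuples u I"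
    and residues: "residue_tuple q r x = \<xi>" "residue_tuple q r y = \<xi>"
    and sums: "\<And>j. j \<in> R \<Longrightarrow> [poly_sums r \<Phi> x j = poly_sums r \<Phi> y j] (mod int q ^ k)"
    and collision: "\<And>j. j \<in> {1..k} \<Longrightarrow> poly_sums r \<Phi> x j + int q ^ j * power_sums u z j
        = poly_sums r \<Phi> y j + int q ^ j * power_sums u w j"
  shows "pair_tuples r ((x, z), (y, w)) \<in> lifted_solutions k q r u \<Phi> X I"
proof -
  let ?\<delta> = "tuple_sum r (\<lambda>(x, y). scaled_difference q \<Phi> x y) (\<lambda>i\<in>{..<r}. (x i, y i))"
  have close: "int q ^ k dvd x i - y i" if "i < r" for i
    by (rule hensel_unique[OF assms(1,3,2) _ _ sums that])
      (rule residue_tuple_eqD[OF residues(1)] residue_tuple_eqD[OF residues(2)]; assumption)+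
  have "?\<delta> j + (power_sums u z j - power_sums u w j) = 0" if j: "j \<in> {1..k}" for j
  proof -
    have "int q ^ j * ?\<delta> j = poly_sums r \<Phi> x j - poly_sums r \<Phi> y j"
      using close j by (intro sum_scaled_difference) auto
    hence "int q ^ j * (?\<delta> j + (power_sums u z j - power_sums u w j)) = 0"
      using collision[OF j] by (simp add: algebra_simps)
    thus ?thesis using prime_gt_0_nat[OF assms(1)] by simp
  qed
  moreover have "(\<lambda>i\<in>{..<r}. (x i, y i)) \<in> tuples r (congruent_pairs X (int q ^ k))"
    using mem close by (auto simp: congruent_pairs_def PiE_iff)
  ultimately show ?thesis using mem by (simp add: lifted_solutions_def pair_tuples_def)
qed

lemma card_residue_vectors_le:
  assumes "q > 0" "r \<le> k"
    and "\<And>x j. x \<in> A \<Longrightarrow> j \<in> {k - r + 1..k} \<Longrightarrow> f x j mod int q ^ j = v j"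
  shows "card ((\<lambda>x. \<lambda>j\<in>{k - r + 1..k}. f x j mod int q ^ k) ` A) \<le> q ^ (r choose 2)"
proof -
  let ?R = "{k - r + 1..k}" and ?C = "\<lambda>j. {b \<in> {0..<int q ^ k}. b mod int q ^ j = v j}"
  have finC: "finite (?C j)" for j by (rule finite_subset[of _ "{0..<int q ^ k}"]) auto
  have "(\<lambda>x. \<lambda>j\<in>?R. f x j mod int q ^ k) ` A \<subseteq> PiE ?R ?C"
  proof (rule image_subsetI, rule PiE_I)
    fix x j assume x: "x \<in> A" and j: "j \<in> ?R"
    have "int q ^ j dvd int q ^ k" using j by (intro le_imp_power_dvd) auto
    thus "(\<lambda>j\<in>?R. f x j mod int q ^ k) j \<in> ?C j"
      using assms(1) assms(3)[OF x j] j by (simp add: mod_mod_cancel)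
  qed (simp only: restrict_apply if_False)
  hence "card ((\<lambda>x. \<lambda>j\<in>?R. f x j mod int q ^ k) ` A) \<le> card (PiE ?R ?C)"
    by (intro card_mono finite_PiE finC) simp_all
  also have "\<dots> = (\<Prod>j\<in>?R. card (?C j))" by (simp add: card_PiE)
  also have "\<dots> \<le> (\<Prod>j\<in>?R. q ^ (k - j))"
    using assms(1) by (intro prod_mono conjI card_residues_with_remainder_le) auto
  also have "\<dots> = q ^ (r choose 2)"
    unfolding sum_diff_eq_choose_two[OF assms(2), symmetric] by (rule power_sum[symmetric])
  finally show ?thesis .
qed

text \<open>Solutions are sorted by the values \<open>\<Sum>\<^sub>i \<Phi>\<^sub>j(x\<^sub>i)\<close> modulo \<open>q\<^sup>k\<close>. The equation of index \<open>j\<close> fixes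
  such a value modulo \<open>q\<^sup>j\<close>, which leaves \<open>q\<^bsup>k-j\<^esup>\<close> possibilities.\<close>

lemma energy_lifting_le:
  assumes "finite X" "finite I" "prime q" "k \<ge> 1" "r \<le> k"
    and nonsingular: "nonsingular_mod q r {k - r + 1..k} \<Phi> \<xi>"
  shows "energy k (joint_sum (poly_sums r \<Phi>) (\<lambda>z j. int q ^ j * power_sums u z j))
          ({x \<in> tuples r X. residue_tuple q r x = \<xi>} \<times> tuples u I)
      \<le> q ^ (r choose 2) * card {p \<in> lifted_solutions k q r u \<Phi> X I. residue_tuple q r (\<lambda>i. fst (fst p i)) = \<xi>}"
    (is "energy k ?V ?A \<le> _ * card ?L")
proof -
  let ?R = "{k - r + 1..k}"
  let ?class = "\<lambda>p :: (nat \<Rightarrow> int) \<times> (nat \<Rightarrow> int). \<lambda>j\<in>?R. poly_sums r \<Phi> (fst p) j mod int q ^ k"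
  let ?C = "{(p, p') \<in> collisions k ?V ?A. ?class p = ?class p'}"
  have finA: "finite ?A" using finite_tuples[OF assms(1), of r] assms(2) by (intro finite_cartesian_product) auto
  have "energy k ?V ?A \<le> q ^ (r choose 2) * (\<Sum>a\<in>?class ` ?A. energy k ?V {p \<in> ?A. ?class p = a})"
  proof (rule energy_le_fibres[OF finA])
    fix p assume "p \<in> ?A"
    have "poly_sums r \<Phi> (fst p') j mod int q ^ j = poly_sums r \<Phi> (fst p) j mod int q ^ j"
      if "p' \<in> {p' \<in> ?A. \<forall>j\<in>{1..k}. ?V p' j = ?V p j}" "j \<in> ?R" for p' j
    proof -
      have "?V p' j mod int q ^ j = ?V p j mod int q ^ j" using that by auto
      thus ?thesis by (simp add: joint_sum_def case_prod_unfold)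
    qed
    thus "card (?class ` {p' \<in> ?A. \<forall>j\<in>{1..k}. ?V p' j = ?V p j}) \<le> q ^ (r choose 2)"
      using prime_gt_0_nat[OF assms(3)] by (intro card_residue_vectors_le[OF _ assms(5)])
  qed
  also have "(\<Sum>a\<in>?class ` ?A. energy k ?V {p \<in> ?A. ?class p = a}) = card ?C"
    by (rule sum_energy_fibres[OF finA])
  also have "\<dots> \<le> card ?L"
  proof (rule card_inj_on_le[where f = "pair_tuples r"])
    show "inj_on (pair_tuples r) ?C"
      by (rule inj_on_subset[OF inj_on_pair_tuples[of r X "tuples u I"]]) (auto simp: collisions_def)
    show "pair_tuples r ` ?C \<subseteq> ?L"
    proof (rule image_subsetI)
      fix s assume s: "s \<in> ?C"
      obtain x z y w where st: "s = ((x, z), (y, w))" by (metis surj_pair)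
      have same_class: "?class (x, z) = ?class (y, w)" using s by (simp only: st mem_Collect_eq case_prod_conv)
      have "[poly_sums r \<Phi> x j = poly_sums r \<Phi> y j] (mod int q ^ k)" if "j \<in> ?R" for j
        using fun_cong[OF same_class, of j] that by (simp add: cong_def)
      hence "pair_tuples r s \<in> lifted_solutions k q r u \<Phi> X I"
        unfolding st using s
        by (intro pair_tuples_in_lifted_solutions[OF assms(3,4) nonsingular]) (auto simp: st collisions_def)
      moreover have "residue_tuple q r (\<lambda>i. fst (fst (pair_tuples r s) i)) = residue_tuple q r x"
        by (auto simp: residue_tuple_def st pair_tuples_def)
      ultimately show "pair_tuples r s \<in> ?L" using s by (auto simp: st collisions_def)
    qed
    show "finite ?L" using finite_lifted_solutions[OF assms(1,2)] by simp
  qed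
  finally show ?thesis by simp
qed

lemma energy_rescale_le:
  assumes "finite S" "q > 0"
  shows "energy k (mixed_sums \<Psi> r u) (S \<times> tuples u {z \<in> {a<..b}. z mod int q = c})
      \<le> energy k (joint_sum (poly_sums r (translate c \<Psi>)) (\<lambda>z j. int q ^ j * power_sums u z j))
          (S \<times> tuples u {(a - c) div int q<..(b - c) div int q})"
    (is "energy k _ (S \<times> tuples u ?Z) \<le> energy k _ (S \<times> tuples u ?I)")
proof (rule energy_le_inj)
  let ?scale = "\<lambda>z. \<lambda>m\<in>{..<u}. (z m - c) div int q"
  let ?f = "map_prod id ?scale :: (nat \<Rightarrow> int) \<times> (nat \<Rightarrow> int) \<Rightarrow> _"
  have unscale: "z m - c = int q * ?scale z m" if "z \<in> tuples u ?Z" "m < u" for z m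
  proof -
    have "z m mod int q = c" using that by (auto simp: PiE_iff)
    hence "int q dvd z m - c" by (metis dvd_minus_mod)
    thus ?thesis using that by simp
  qed
  have "inj_on ?scale (tuples u ?Z)"
  proof (intro inj_onI)
    fix z w assume zw: "z \<in> tuples u ?Z" "w \<in> tuples u ?Z" "?scale z = ?scale w"
    have "z m = w m" if "m < u" for m
      using unscale[OF zw(1) that] unscale[OF zw(2) that] unfolding zw(3) by linarith
    thus "z = w" by (intro PiE_ext[OF zw(1,2)]) simp
  qed
  thus "inj_on ?f (S \<times> tuples u ?Z)" by (intro map_prod_inj_on) auto
  have "?scale z m \<in> ?I" if z: "z \<in> tuples u ?Z" "m < u" for z m
  proof -
    have "a - c < ?scale z m * int q" "\<not> b - c < ?scale z m * int q"
      using unscale[OF z] PiE_mem[OF z(1), of m] z(2) by (auto simp: mult.commute)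
    hence "(a - c) div int q < ?scale z m" "\<not> (b - c) div int q < ?scale z m"
      using assms(2) by (simp_all only: int_div_less_iff of_nat_0_less_iff not_False_eq_True)
    thus ?thesis by simp
  qed
  thus "?f ` (S \<times> tuples u ?Z) \<subseteq> S \<times> tuples u ?I" by (auto simp: PiE_iff)
  fix p p' assume p: "p \<in> S \<times> tuples u ?Z" "p' \<in> S \<times> tuples u ?Z"
    and eq: "\<forall>j\<in>{1..k}. mixed_sums \<Psi> r u p j = mixed_sums \<Psi> r u p' j"
  obtain x z y w where st: "p = (x, z)" "p' = (y, w)" by (metis surj_pair)
  have "power_sums u (\<lambda>m. z m - c) j = int q ^ j * power_sums u (?scale z) j" if "z \<in> tuples u ?Z" for z j
    using unscale[OF that] by (simp add: tuple_sum_def sum_distrib_left power_mult_distrib[symmetric])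
  thus "\<forall>j\<in>{1..k}. joint_sum (poly_sums r (translate c \<Psi>)) (\<lambda>z j. int q ^ j * power_sums u z j) (?f p) j
      = joint_sum (poly_sums r (translate c \<Psi>)) (\<lambda>z j. int q ^ j * power_sums u z j) (?f p') j"
    using translate_collision[OF eq[unfolded st], of _ c] p by (auto simp: st)
qed (use assms(1) in auto)

definition admissible_residues ::
  "nat \<Rightarrow> nat \<Rightarrow> nat \<Rightarrow> (nat \<Rightarrow> int poly) \<Rightarrow> nat \<Rightarrow> nat \<Rightarrow> ((nat \<Rightarrow> int) \<times> (nat \<Rightarrow> int)) set \<Rightarrow> bool" where
  "admissible_residues k r u \<Psi> q D \<Gamma> \<longleftrightarrow>
     \<Gamma> \<subseteq> tuples r (residues q) \<times> tuples u (residues q) \<and>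
     (\<forall>\<gamma>\<in>\<Gamma>. card {\<gamma>' \<in> \<Gamma>. \<forall>j\<in>{1..k}. [mixed_sums \<Psi> r u \<gamma>' j = mixed_sums \<Psi> r u \<gamma> j] (mod int q)} \<le> D) \<and>
     (\<forall>\<xi> \<eta>. (\<xi>, \<eta>) \<in> \<Gamma> \<longrightarrow> (\<forall>m<u. nonsingular_mod q r {k - r + 1..k} (translate (\<eta> m) \<Psi>) \<xi>))"

lemma energy_le_residue_classes:
  assumes "finite A" "admissible_residues k r u \<Psi> q D \<Gamma>" "residue_pair q r u ` A \<subseteq> \<Gamma>"
  shows "energy k (mixed_sums \<Psi> r u) A
    \<le> D * (\<Sum>\<gamma>\<in>residue_pair q r u ` A. energy k (mixed_sums \<Psi> r u) {p \<in> A. residue_pair q r u p = \<gamma>})"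
proof (rule energy_le_fibres[OF assms(1)])
  fix p assume p: "p \<in> A"
  let ?V = "mixed_sums \<Psi> r u" and ?g = "residue_pair q r u"
  let ?T = "{\<gamma>' \<in> \<Gamma>. \<forall>j\<in>{1..k}. [?V \<gamma>' j = ?V (?g p) j] (mod int q)}"
  have "finite \<Gamma>"
    using assms(2) finite_subset[of \<Gamma> "tuples r (residues q) \<times> tuples u (residues q)"]
    by (auto simp: admissible_residues_def)
  moreover have "?g p' \<in> ?T" if "p' \<in> A" "\<forall>j\<in>{1..k}. ?V p' j = ?V p j" for p'
  proof -
    have "[?V (?g p') j = ?V (?g p) j] (mod int q)" if "j \<in> {1..k}" for j
    proof -
      have "[?V (?g p') j = ?V p' j] (mod int q)" by (rule cong_sym[OF mixed_sums_residue_pair_cong])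
      also have "?V p' j = ?V p j" using \<open>\<forall>j\<in>{1..k}. ?V p' j = ?V p j\<close> that by blast
      also have "[?V p j = ?V (?g p) j] (mod int q)" by (rule mixed_sums_residue_pair_cong)
      finally show ?thesis .
    qed
    thus ?thesis using assms(3) that(1) by blast
  qed
  ultimately have "card (?g ` {p' \<in> A. \<forall>j\<in>{1..k}. ?V p' j = ?V p j}) \<le> card ?T"
    by (intro card_mono) auto
  also have "\<dots> \<le> D" using assms(2,3) p by (auto simp: admissible_residues_def)
  finally show "card (?g ` {p' \<in> A. \<forall>j\<in>{1..k}. ?V p' j = ?V p j}) \<le> D" .
qed

lemma energy_residue_class_le:
  assumes "finite X" "prime q" "k \<ge> 1" "r \<le> k" "u > 0" "admissible_residues k r u \<Psi> q D \<Gamma>"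
    and "A \<subseteq> tuples r X \<times> tuples u {a<..b}" "(\<xi>, \<eta>) \<in> \<Gamma>"
  shows "energy k (mixed_sums \<Psi> r u) {p \<in> A. residue_pair q r u p = (\<xi>, \<eta>)}
    \<le> (\<Sum>m<u. q ^ (r choose 2) * card {p \<in> lifted_solutions k q r u (translate (\<eta> m) \<Psi>) X
          {(a - \<eta> m) div int q<..(b - \<eta> m) div int q}. residue_tuple q r (\<lambda>i. fst (fst p i)) = \<xi>})"
    (is "_ \<le> (\<Sum>m<u. _ * card (?L m))")
proof -
  let ?V = "mixed_sums \<Psi> r u"
  let ?X = "{x \<in> tuples r X. residue_tuple q r x = \<xi>}" and ?Z = "\<lambda>c. {z \<in> {a<..b}. z mod int q = c}"
  have q: "q > 0" using assms(2) by (rule prime_gt_0_nat)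
  have finX: "finite ?X" using finite_tuples[OF assms(1)] by simp
  have finZ: "finite (?Z c)" for c by (rule finite_subset[of _ "{a<..b}"]) auto
  have "{p \<in> A. residue_pair q r u p = (\<xi>, \<eta>)} \<subseteq> ?X \<times> PiE {..<u} (\<lambda>m. ?Z (\<eta> m))"
    using assms(7) by (auto simp: residue_pair_def residue_tuple_def PiE_iff)
  hence "energy k ?V {p \<in> A. residue_pair q r u p = (\<xi>, \<eta>)} \<le> energy k ?V (?X \<times> PiE {..<u} (\<lambda>m. ?Z (\<eta> m)))"
    by (intro energy_mono finite_cartesian_product finite_PiE finX finZ) simp_all
  also have "\<dots> \<le> (\<Sum>m<u. energy k ?V (?X \<times> tuples u (?Z (\<eta> m))))"
    by (rule energy_Holder[OF finX finZ assms(5)])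
  also have "\<dots> \<le> (\<Sum>m<u. q ^ (r choose 2) * card (?L m))"
  proof (rule sum_mono)
    fix m assume "m \<in> {..<u}"
    hence "nonsingular_mod q r {k - r + 1..k} (translate (\<eta> m) \<Psi>) \<xi>"
      using assms(6,8) by (simp add: admissible_residues_def)
    thus "energy k ?V (?X \<times> tuples u (?Z (\<eta> m))) \<le> q ^ (r choose 2) * card (?L m)"
      using assms(1-4) by (intro order.trans[OF energy_rescale_le[OF finX q] energy_lifting_le]) auto
  qed
  finally show ?thesis .
qed

lemma energy_le_lifted_solutions:
  assumes "finite X" "prime q" "k \<ge> 1" "r \<le> k" "u > 0" "admissible_residues k r u \<Psi> q D \<Gamma>"
    and A: "A \<subseteq> tuples r X \<times> tuples u {a<..b}" "residue_pair q r u ` A \<subseteq> \<Gamma>"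
    and lifted: "\<And>c. card (lifted_solutions k q r u (translate c \<Psi>) X {(a - c) div int q<..(b - c) div int q}) \<le> t"
  shows "energy k (mixed_sums \<Psi> r u) A \<le> D * (q ^ u * (u * (q ^ (r choose 2) * t)))"
proof -
  let ?V = "mixed_sums \<Psi> r u" and ?g = "residue_pair q r u"
  let ?X = "tuples r (residues q)" and ?Z = "tuples u (residues q)"
  let ?L = "\<lambda>c. lifted_solutions k q r u (translate c \<Psi>) X {(a - c) div int q<..(b - c) div int q}"
  define N where "N \<xi> c = card {p \<in> ?L c. residue_tuple q r (\<lambda>i. fst (fst p i)) = \<xi>}" for \<xi> c
  have fin: "finite ?X" "finite ?Z" by auto
  have finA: "finite A"
    by (rule finite_subset[OF A(1)]) (use assms(1) in auto)
  have classes: "?g ` A \<subseteq> ?X \<times> ?Z"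
    using A(2) assms(6) unfolding admissible_residues_def by blast
  have "(\<Sum>\<gamma>\<in>?g ` A. energy k ?V {p \<in> A. ?g p = \<gamma>}) \<le> (\<Sum>\<gamma>\<in>?g ` A. \<Sum>m<u. q ^ (r choose 2) * N (fst \<gamma>) (snd \<gamma> m))"
  proof (rule sum_mono)
    fix \<gamma> assume "\<gamma> \<in> ?g ` A"
    hence "(fst \<gamma>, snd \<gamma>) \<in> \<Gamma>" using A(2) by auto
    from energy_residue_class_le[OF assms(1-6) A(1) this]
    show "energy k ?V {p \<in> A. ?g p = \<gamma>} \<le> (\<Sum>m<u. q ^ (r choose 2) * N (fst \<gamma>) (snd \<gamma> m))"
      by (simp add: N_def)
  qed
  also have "\<dots> \<le> (\<Sum>\<gamma>\<in>?X \<times> ?Z. \<Sum>m<u. q ^ (r choose 2) * N (fst \<gamma>) (snd \<gamma> m))"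
    using classes fin by (intro sum_mono2) auto
  also have "\<dots> = (\<Sum>\<eta>\<in>?Z. \<Sum>m<u. q ^ (r choose 2) * (\<Sum>\<xi>\<in>?X. N \<xi> (\<eta> m)))"
    by (simp only: sum.cartesian_product' fst_conv snd_conv)
      (subst sum.swap, intro sum.cong refl, subst sum.swap, simp add: sum_distrib_left)
  also have "\<dots> \<le> (\<Sum>\<eta>\<in>?Z. \<Sum>m<u. q ^ (r choose 2) * t)"
  proof (intro sum_mono mult_left_mono)
    fix \<eta> m
    have "(\<Sum>\<xi>\<in>?X. N \<xi> (\<eta> m)) \<le> card (?L (\<eta> m))"
      unfolding N_def using assms(1) fin by (intro sum_card_fibres_le finite_lifted_solutions) auto
    thus "(\<Sum>\<xi>\<in>?X. N \<xi> (\<eta> m)) \<le> t" using lifted[of "\<eta> m"] by linarith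
  qed simp
  also have "\<dots> = q ^ u * (u * (q ^ (r choose 2) * t))" by (simp add: card_PiE)
  finally have "D * (\<Sum>\<gamma>\<in>?g ` A. energy k ?V {p \<in> A. ?g p = \<gamma>}) \<le> D * (q ^ u * (u * (q ^ (r choose 2) * t)))"
    by (rule mult_le_mono2)
  thus ?thesis using energy_le_residue_classes[OF finA assms(6) A(2)] by linarith
qed

lemma scaled_difference_commute:
  assumes "int q ^ j dvd x - y"
  shows "scaled_difference q \<Phi> y x j = - scaled_difference q \<Phi> x y j"
proof -
  note assms
  also have "x - y dvd poly (\<Phi> j) x - poly (\<Phi> j) y" by (rule poly_diff_dvd)
  finally have "(- (poly (\<Phi> j) x - poly (\<Phi> j) y)) div int q ^ j = - ((poly (\<Phi> j) x - poly (\<Phi> j) y) div int q ^ j)"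
    by (rule dvd_neg_div)
  thus ?thesis by (simp add: scaled_difference_def)
qed

lemma card_lifted_solutions_le:
  fixes N W :: real
  assumes "finite I" "of_int n \<le> N" "N > 0" "q > 0" "r' > 0" "r \<le> 2 * r'"
    and W: "\<And>h. h \<in> {1..n div int q ^ k} \<Longrightarrow>
      real (energy k (mixed_sums (differenced_system k q h \<Phi>) r' u) (tuples r' {1..n} \<times> tuples u I)) \<le> W"
  shows "real (card (lifted_solutions k q r u \<Phi> {1..n} I))
    \<le> 3 ^ r * (N ^ r * real (energy k (power_sums u) (tuples u I))
        + N ^ r / N ^ (2 * r') * (real (nat (n div int q ^ k)) ^ (2 * r') * W))"
proof -
  let ?Q = "int q ^ k" and ?\<delta> = "scaled_difference q \<Phi>" and ?B = "tuples u I"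
  let ?H = "n div ?Q" and ?X = "\<lambda>h. {x \<in> {1..n}. x + h * ?Q \<in> {1..n}}"
  let ?E = "\<lambda>h. energy k (joint_sum (tuple_sum r' (\<lambda>x. ?\<delta> (x + h * ?Q) x)) (power_sums u)) (tuples r' (?X h) \<times> ?B)"
  have fin: "finite {1..n}" "finite ?B" using assms(1) by auto
  have Q: "?Q > 0" using assms(4) by simp
  have card_N: "real (card {1..n}) \<le> N" using assms(2,3) by simp
  have bound_H: "(x - y) div ?Q \<le> ?H" if "x \<in> {1..n}" "y \<in> {1..n}" for x y
    using that Q by (intro zdiv_mono1) auto
  have antisym: "?\<delta> y x j = - ?\<delta> x y j" if "?Q dvd x - y" "j \<in> {1..k}" for x y j
  proof (rule scaled_difference_commute)
    have "int q ^ j dvd ?Q" using that(2) by (intro le_imp_power_dvd) auto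
    thus "int q ^ j dvd x - y" using that(1) by (rule dvd_trans)
  qed
  have differenced: "real (?E h) \<le> W" if h: "h \<in> {1..?H}" for h
  proof -
    let ?\<Psi> = "differenced_system k q h \<Phi>"
    have "\<forall>j\<in>{1..k}. joint_sum (tuple_sum r' (\<lambda>x. ?\<delta> (x + h * ?Q) x)) (power_sums u) p j = mixed_sums ?\<Psi> r' u p j" for p
      using assms(4) by (auto simp: joint_sum_def tuple_sum_def poly_differenced_system case_prod_unfold)
    hence "?E h \<le> energy k (mixed_sums ?\<Psi> r' u) (tuples r' {1..n} \<times> ?B)"
      using fin by (intro energy_le_inj[where f = "\<lambda>p. p"]) (auto simp: PiE_iff)
    thus ?thesis using W[OF h] by linarith
  qed
  have "real (card (lifted_solutions k q r u \<Phi> {1..n} I))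
     \<le> 3 ^ r * (N ^ r * real (energy k (power_sums u) ?B)
        + N ^ r / N ^ (2 * r') * (real (nat ?H) ^ (2 * r' - 1) * (\<Sum>h\<in>{1..?H}. real (?E h))))"
    unfolding lifted_solutions_def
    by (rule card_congruent_solutions_le[OF fin Q card_N assms(3,5,6) bound_H _ antisym])
      (simp_all add: scaled_difference_def)
  also have "\<dots> \<le> 3 ^ r * (N ^ r * real (energy k (power_sums u) ?B)
        + N ^ r / N ^ (2 * r') * (real (nat ?H) ^ (2 * r' - 1) * (real (nat ?H) * W)))"
  proof (intro mult_left_mono add_left_mono)
    show "(\<Sum>h\<in>{1..?H}. real (?E h)) \<le> real (nat ?H) * W"
      using sum_bounded_above[of "{1..?H}" _ W, OF differenced] by simp
  qed (use assms(3) in auto)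
  also have "real (nat ?H) ^ (2 * r' - 1) * (real (nat ?H) * W) = real (nat ?H) ^ (2 * r') * W"
    using assms(5) by (cases r') auto
  finally show ?thesis .
qed

section \<open>Counting residues\<close>

lemma poly_sums_constant:
  assumes "graded_system k d \<Psi>" "d \<le> k" "j \<in> {1..d}"
  shows "poly_sums r \<Psi> x j = poly_sums r \<Psi> y j"
proof -
  have "degree (\<Psi> j) \<le> j - d" using assms by (intro graded_systemD[of k]) auto
  hence "degree (\<Psi> j) = 0" using assms(3) by simp
  then obtain a where "\<Psi> j = [:a:]" by (rule degree_eq_zeroE)
  thus ?thesis by (simp add: tuple_sum_def)
qed

lemma triangular_mod_graded:
  assumes "prime q" "r \<le> k" "graded_system k (k - r) \<Psi>"
    and lead: "\<And>j. j \<in> {k - r + 1..k} \<Longrightarrow> \<not> int q dvd coeff (\<Psi> j) (j - (k - r))"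
  shows "triangular_mod q (Suc r) (\<lambda>l. if l = 0 then 1 else \<Psi> (k - r + l))" (is "triangular_mod _ _ ?P")
  unfolding triangular_mod_def
proof (intro allI impI)
  fix l assume l: "l < Suc r"
  show "degree (?P l) \<le> l \<and> \<not> int q dvd coeff (?P l) l"
  proof (cases "l = 0")
    case True
    thus ?thesis using prime_gt_1_nat[OF assms(1)] by simp
  next
    case False
    hence j: "k - r + l \<in> {1..k}" "k - r + l \<in> {k - r + 1..k}" using l assms(2) by auto
    have "degree (\<Psi> (k - r + l)) \<le> k - r + l - (k - r)"
      by (rule graded_systemD[OF assms(3) j(1)])
    thus ?thesis using lead[OF j(2)] False by simp
  qed
qed

lemma card_graded_poly_sums_le:
  assumes "prime q" "r < q" "r \<le> k" "graded_system k (k - r) \<Psi>"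
    and lead: "\<And>j. j \<in> {k - r + 1..k} \<Longrightarrow> \<not> int q dvd coeff (\<Psi> j) (j - (k - r))"
  shows "card {\<xi> \<in> tuples r (residues q). \<forall>j\<in>{k - r + 1..k}. [poly_sums r \<Psi> \<xi> j = b j] (mod int q)} \<le> r ^ r"
    (is "card ?S \<le> _")
proof -
  let ?P = "\<lambda>l. if l = 0 then 1 else \<Psi> (k - r + l)"
  let ?F = "{\<xi> \<in> tuples r (residues q). \<forall>l\<in>{1..r}. [poly_sums r ?P \<xi> l = b (k - r + l)] (mod int q)}"
  have "[poly_sums r ?P \<xi> l = b (k - r + l)] (mod int q)" if "\<xi> \<in> ?S" "l \<in> {1..r}" for \<xi> l
  proof -
    have "k - r + l \<in> {k - r + 1..k}" using that(2) assms(3) by auto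
    hence "[poly_sums r \<Psi> \<xi> (k - r + l) = b (k - r + l)] (mod int q)" using that(1) by blast
    thus ?thesis using that(2) by (simp add: tuple_sum_def)
  qed
  hence "?S \<subseteq> ?F" by auto
  hence "card ?S \<le> card ?F" by (rule card_mono[rotated]) (simp add: finite_tuples)
  also have "\<dots> \<le> r ^ r"
    by (rule card_poly_sums_le[OF assms(1,2) triangular_mod_graded[OF assms(1,3,4) lead]])
  finally show ?thesis .
qed

lemma card_graded_residues_le:
  fixes \<gamma> :: "(nat \<Rightarrow> int) \<times> (nat \<Rightarrow> int)"
  assumes "prime q" "k < q" "r \<le> k" "k \<le> u" "graded_system k (k - r) \<Psi>"
    and "\<And>j. j \<in> {k - r + 1..k} \<Longrightarrow> \<not> int q dvd coeff (\<Psi> j) (j - (k - r))"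
  shows "card {\<gamma>' \<in> tuples r (residues q) \<times> tuples u (residues q).
      \<forall>j\<in>{1..k}. [mixed_sums \<Psi> r u \<gamma>' j = mixed_sums \<Psi> r u \<gamma> j] (mod int q)}
    \<le> (q ^ (u + r - k) * (k - r) ^ (k - r)) * r ^ r"
    (is "card ?S \<le> _")
proof -
  let ?T = "{\<eta> \<in> tuples u (residues q). \<forall>j\<in>{1..k - r}. [power_sums u \<eta> j = power_sums u (snd \<gamma>) j] (mod int q)}"
  have finT: "finite ?T" by (simp add: finite_tuples)
  have collision: "[poly_sums r \<Psi> (fst \<gamma>') j + power_sums u (snd \<gamma>') j = mixed_sums \<Psi> r u \<gamma> j] (mod int q)"
    if "\<gamma>' \<in> ?S" "j \<in> {1..k}" for \<gamma>' j
    using that by (cases \<gamma>') auto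
  have "card ?S \<le> card ?T * r ^ r"
  proof (rule card_le_card_mult_fibres[where f = snd, OF finT])
    show "snd ` ?S \<subseteq> ?T"
    proof (rule image_subsetI)
      fix \<gamma>' assume \<gamma>': "\<gamma>' \<in> ?S"
      have "[power_sums u (snd \<gamma>') j = power_sums u (snd \<gamma>) j] (mod int q)" if "j \<in> {1..k - r}" for j
        using collision[OF \<gamma>', of j] poly_sums_constant[OF assms(5) _ that, of r "fst \<gamma>'" "fst \<gamma>"] that
        by (auto simp: joint_sum_def case_prod_unfold cong_add_lcancel)
      thus "snd \<gamma>' \<in> ?T" using \<gamma>' by auto
    qed
  next
    fix \<eta> assume "\<eta> \<in> ?T"
    let ?b = "\<lambda>j. mixed_sums \<Psi> r u \<gamma> j - power_sums u \<eta> j"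
    let ?F = "{\<xi> \<in> tuples r (residues q). \<forall>j\<in>{k - r + 1..k}. [poly_sums r \<Psi> \<xi> j = ?b j] (mod int q)}"
    have "[poly_sums r \<Psi> (fst p) j = ?b j] (mod int q)" if "p \<in> {p \<in> ?S. snd p = \<eta>}" "j \<in> {k - r + 1..k}" for p j
      using collision[of p j] that by (simp add: cong_iff_dvd_diff algebra_simps)
    hence "fst ` {p \<in> ?S. snd p = \<eta>} \<subseteq> ?F" by (intro image_subsetI) auto
    hence "card {p \<in> ?S. snd p = \<eta>} \<le> card ?F"
      by (intro card_inj_on_le[where f = fst]) (auto simp: inj_on_def finite_tuples)
    also have "\<dots> \<le> r ^ r" using assms by (intro card_graded_poly_sums_le) auto
    finally show "card {p \<in> ?S. snd p = \<eta>} \<le> r ^ r" .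
  qed
  also have "card ?T \<le> q ^ (u - (k - r)) * (k - r) ^ (k - r)"
    using assms(2-4) by (intro card_power_sums_le[OF assms(1)]) auto
  also have "u - (k - r) = u + r - k" using assms(3,4) by simp
  finally show ?thesis by simp
qed

lemma admissible_residues_graded:
  assumes "prime q" "k < q" "r \<le> k" "k \<le> u" "graded_system k (k - r) \<Psi>"
    and lead: "\<And>j. j \<in> {k - r + 1..k} \<Longrightarrow> \<not> int q dvd coeff (\<Psi> j) (j - (k - r))"
  shows "admissible_residues k r u \<Psi> q ((k - r) ^ (k - r) * r ^ r * q ^ (u + r - k))
    {(\<xi>, \<eta>) \<in> tuples r (residues q) \<times> tuples u (residues q). incongruent q r \<xi>}"
    (is "admissible_residues _ _ _ _ _ _ ?\<Gamma>")
  unfolding admissible_residues_def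
proof (intro conjI ballI allI impI)
  fix \<gamma> :: "(nat \<Rightarrow> int) \<times> (nat \<Rightarrow> int)"
  let ?S = "\<lambda>A. {\<gamma>' \<in> A. \<forall>j\<in>{1..k}. [mixed_sums \<Psi> r u \<gamma>' j = mixed_sums \<Psi> r u \<gamma> j] (mod int q)}"
  have "card (?S ?\<Gamma>) \<le> card (?S (tuples r (residues q) \<times> tuples u (residues q)))"
    by (intro card_mono finite_subset[of "?S _" "tuples r (residues q) \<times> tuples u (residues q)"]) auto
  also have "\<dots> \<le> (k - r) ^ (k - r) * r ^ r * q ^ (u + r - k)"
    using card_graded_residues_le[OF assms, of \<gamma>] by (simp add: mult_ac)
  finally show "card (?S ?\<Gamma>) \<le> \<dots>" .
next
  fix \<xi> \<eta> m assume "(\<xi>, \<eta>) \<in> ?\<Gamma>"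
  moreover have "coeff (translate (\<eta> m) \<Psi> j) (j - (k - r)) = coeff (\<Psi> j) (j - (k - r))" if "j \<in> {k - r + 1..k}" for j
    using that by (intro coeff_translate_top[OF assms(5)]) auto
  ultimately show "nonsingular_mod q r {k - r + 1..k} (translate (\<eta> m) \<Psi>) \<xi>"
    using lead by (intro nonsingular_mod_graded[OF assms(1-3) graded_system_translate[OF assms(5)]]) auto
qed auto

definition append_tuple :: "nat \<Rightarrow> nat \<Rightarrow> (nat \<Rightarrow> 'a) \<times> (nat \<Rightarrow> 'a) \<Rightarrow> nat \<Rightarrow> 'a" where
  "append_tuple r u = (\<lambda>(x, z). \<lambda>i\<in>{..<r + u}. if i < r then x i else z (i - r))"

definition split_tuple :: "nat \<Rightarrow> nat \<Rightarrow> (nat \<Rightarrow> 'a) \<Rightarrow> (nat \<Rightarrow> 'a) \<times> (nat \<Rightarrow> 'a)" where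
  "split_tuple r u x = (\<lambda>i\<in>{..<r}. x i, \<lambda>m\<in>{..<u}. x (r + m))"

lemma split_append_tuple:
  assumes "p \<in> extensional {..<r} \<times> extensional {..<u}"
  shows "split_tuple r u (append_tuple r u p) = p"
  using assms by (auto simp: split_tuple_def append_tuple_def fun_eq_iff extensional_def)

lemma append_split_tuple:
  assumes "x \<in> extensional {..<r + u}"
  shows "append_tuple r u (split_tuple r u x) = x"
  using assms by (auto simp: split_tuple_def append_tuple_def fun_eq_iff extensional_def)

lemma append_tuple_in: "x \<in> tuples r X \<Longrightarrow> z \<in> tuples u X \<Longrightarrow> append_tuple r u (x, z) \<in> tuples (r + u) X"
  by (auto simp: append_tuple_def PiE_iff)

lemma split_tuple_in: "x \<in> tuples (r + u) X \<Longrightarrow> split_tuple r u x \<in> tuples r X \<times> tuples u X"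
  by (auto simp: split_tuple_def PiE_iff)

lemma power_sums_append_tuple: "power_sums (r + u) (append_tuple r u (x, z)) j = power_sums r x j + power_sums u z j"
proof -
  have "power_sums (r + u) (append_tuple r u (x, z)) j
      = (\<Sum>i<r. append_tuple r u (x, z) i ^ j) + (\<Sum>i\<in>{r..<r + u}. append_tuple r u (x, z) i ^ j)"
    by (simp add: tuple_sum_def lessThan_atLeast0 sum.atLeastLessThan_concat)
  moreover have "(\<Sum>i\<in>{r..<r + u}. append_tuple r u (x, z) i ^ j) = power_sums u z j"
    unfolding tuple_sum_def
    by (rule sum.reindex_bij_witness[of _ "\<lambda>m. r + m" "\<lambda>i. i - r"]) (auto simp: append_tuple_def)
  ultimately show ?thesis by (simp add: tuple_sum_def append_tuple_def)
qed

lemma incongruent_append_tupleD: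
  assumes "incongruent q (r + u) (append_tuple r u (x, z))"
  shows "incongruent q r x" "i < r \<Longrightarrow> m < u \<Longrightarrow> \<not> int q dvd x i - z m"
proof -
  have distinct: "\<not> int q dvd append_tuple r u (x, z) i - append_tuple r u (x, z) l"
    if "i < r + u" "l < r + u" "i \<noteq> l" for i l
    using assms that by (simp add: incongruent_def)
  show "incongruent q r x" unfolding incongruent_def
  proof (intro allI impI)
    fix i l assume "i < r" "l < r" "i \<noteq> l"
    thus "\<not> int q dvd x i - x l" using distinct[of i l] by (simp add: append_tuple_def)
  qed
  show "\<not> int q dvd x i - z m" if "i < r" "m < u"
    using distinct[of i "r + m"] that by (simp add: append_tuple_def)
qed

lemma inj_on_append_tuple: "inj_on (append_tuple r u) (tuples r X \<times> tuples u Y)"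
  by (rule inj_on_inverseI[where g = "split_tuple r u"], rule split_append_tuple) (auto simp: PiE_def)

lemma mixed_sums_monom: "mixed_sums (monom 1) r u p j = power_sums (r + u) (append_tuple r u p) j"
  by (cases p) (simp add: power_sums_append_tuple poly_monom)

lemma admissible_residues_monom:
  assumes "prime q" "k < q" "1 \<le> k" "k \<le> u"
  shows "admissible_residues k (k - 1) u (monom 1) q (k ^ k * q ^ (u + (k - 1) - k))
    {\<gamma> \<in> tuples (k - 1) (residues q) \<times> tuples u (residues q). incongruent q (k - 1 + u) (append_tuple (k - 1) u \<gamma>)}"
    (is "admissible_residues _ ?r _ _ _ _ ?\<Gamma>")
  unfolding admissible_residues_def
proof (intro conjI ballI allI impI)
  fix \<gamma> :: "(nat \<Rightarrow> int) \<times> (nat \<Rightarrow> int)"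
  let ?V = "mixed_sums (monom 1) ?r u"
  let ?S = "{\<gamma>' \<in> ?\<Gamma>. \<forall>j\<in>{1..k}. [?V \<gamma>' j = ?V \<gamma> j] (mod int q)}"
  let ?T = "{x \<in> tuples (?r + u) (residues q). \<forall>j\<in>{1..k}. [power_sums (?r + u) x j = ?V \<gamma> j] (mod int q)}"
  have "card ?S \<le> card ?T"
  proof (rule card_inj_on_le[where f = "append_tuple ?r u"])
    show "inj_on (append_tuple ?r u) ?S"
      by (rule inj_on_subset[OF inj_on_append_tuple[of ?r u "residues q" "residues q"]]) auto
    show "append_tuple ?r u ` ?S \<subseteq> ?T"
    proof (rule image_subsetI)
      fix p assume p: "p \<in> ?S"
      hence "append_tuple ?r u p \<in> tuples (?r + u) (residues q)" by (cases p) (simp add: append_tuple_in)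
      thus "append_tuple ?r u p \<in> ?T" using p by (simp add: mixed_sums_monom)
    qed
    show "finite ?T" by (rule finite_subset[of _ "tuples (?r + u) (residues q)"]) auto
  qed
  also have "\<dots> \<le> q ^ (?r + u - k) * k ^ k"
    using assms by (intro card_power_sums_le) auto
  finally show "card ?S \<le> k ^ k * q ^ (u + ?r - k)" by (simp add: add.commute mult.commute)
next
  fix \<xi> \<eta> m assume "(\<xi>, \<eta>) \<in> ?\<Gamma>" "m < u"
  hence "incongruent q ?r \<xi>" "\<And>i. i < ?r \<Longrightarrow> \<not> int q dvd \<xi> i - \<eta> m"
    using incongruent_append_tupleD[of q ?r u \<xi> \<eta>] by auto
  from nonsingular_mod_translate_monom[OF assms(1) _ this]
  show "nonsingular_mod q ?r {k - ?r + 1..k} (translate (\<eta> m) (monom 1)) \<xi>"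
    using assms(2,3) by (simp add: numeral_2_eq_2)
qed auto

lemma incongruent_append_residue_pair:
  assumes "incongruent q (r + u) (append_tuple r u p)"
  shows "incongruent q (r + u) (append_tuple r u (residue_pair q r u p))"
  by (rule incongruent_cong[OF assms])
    (auto simp: append_tuple_def residue_pair_def residue_tuple_cong case_prod_unfold)

definition pair_differences :: "nat \<Rightarrow> (nat \<Rightarrow> int) \<Rightarrow> int" where
  "pair_differences n x = (\<Prod>(i, l)\<in>{(i, l) \<in> {..<n} \<times> {..<n}. i \<noteq> l}. x i - x l)"

lemma finite_index_pairs: "finite {(i, l) \<in> {..<n} \<times> {..<n}. i \<noteq> (l::nat)}"
  by (rule finite_subset[of _ "{..<n} \<times> {..<n}"]) auto

lemma pair_differences_nonzero: "inj_on x {..<n} \<Longrightarrow> pair_differences n x \<noteq> 0"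
  unfolding pair_differences_def using finite_index_pairs by (auto simp: inj_on_def)

lemma incongruent_if_not_dvd_pair_differences:
  assumes "\<not> int q dvd pair_differences n x"
  shows "incongruent q n x"
  unfolding incongruent_def
proof (intro allI impI notI)
  fix i l assume il: "i < n" "l < n" "i \<noteq> l" "int q dvd x i - x l"
  have "x i - x l dvd pair_differences n x"
    unfolding pair_differences_def
    using dvd_prodI[OF finite_index_pairs, of "(i, l)" n "\<lambda>(i, l). x i - x l"] il by simp
  thus False using il assms dvd_trans by blast
qed

lemma pair_differences_le:
  fixes P :: real
  assumes "\<And>i. i < n \<Longrightarrow> x i \<in> {1..\<lfloor>P\<rfloor>}" "P \<ge> 1"
  shows "of_int \<bar>pair_differences n x\<bar> \<le> P ^ (n ^ 2)"
proof -
  let ?I = "{(i, l) \<in> {..<n} \<times> {..<n}. i \<noteq> l}"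
  have "of_int \<bar>pair_differences n x\<bar> = (\<Prod>p\<in>?I. of_int \<bar>x (fst p) - x (snd p)\<bar> :: real)"
    by (simp add: pair_differences_def abs_prod case_prod_unfold)
  also have "\<dots> \<le> (\<Prod>p\<in>?I. P)"
  proof (rule prod_mono, clarify, goal_cases)
    case (1 i l)
    hence "x i \<in> {1..\<lfloor>P\<rfloor>}" "x l \<in> {1..\<lfloor>P\<rfloor>}" using assms(1) by auto
    hence "\<bar>x i - x l\<bar> \<le> \<lfloor>P\<rfloor>" by auto
    thus ?case by (simp add: le_floor_iff)
  qed
  also have "\<dots> = P ^ card ?I" by simp
  also have "\<dots> \<le> P ^ (n ^ 2)"
  proof (rule power_increasing)
    have "card ?I \<le> card ({..<n} \<times> {..<n})" by (intro card_mono) auto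
    thus "card ?I \<le> n ^ 2" by (simp add: power2_eq_square)
  qed (use assms in auto)
  finally show ?thesis .
qed

definition bounded_graded_system :: "nat \<Rightarrow> nat \<Rightarrow> real \<Rightarrow> (nat \<Rightarrow> int poly) \<Rightarrow> bool" where
  "bounded_graded_system k d H \<Psi> \<longleftrightarrow> graded_system k d \<Psi> \<and>
     (\<forall>j\<in>{d + 1..k}. coeff (\<Psi> j) (j - d) \<noteq> 0 \<and> of_int \<bar>coeff (\<Psi> j) (j - d)\<bar> \<le> H)"

lemma bounded_graded_system_mono: "bounded_graded_system k d H \<Psi> \<Longrightarrow> H \<le> H' \<Longrightarrow> bounded_graded_system k d H' \<Psi>"
  by (force simp: bounded_graded_system_def)

lemma bounded_graded_system_translate:
  assumes "bounded_graded_system k d H \<Psi>"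
  shows "bounded_graded_system k d H (translate c \<Psi>)"
  using assms graded_system_translate[of k d \<Psi> c] coeff_translate_top[of k d \<Psi> _ c]
  by (simp add: bounded_graded_system_def)

lemma bounded_graded_system_monom: "bounded_graded_system k 0 1 (monom 1)"
  by (auto simp: bounded_graded_system_def graded_system_def degree_monom_le)

lemma bounded_graded_system_differenced:
  assumes "bounded_graded_system k d H \<Psi>" "1 \<le> h" "of_int h \<le> P" "0 < q" "0 \<le> H"
  shows "bounded_graded_system k (Suc d) (P * real q ^ k * real k * H) (differenced_system k q h \<Psi>)"
proof -
  have graded: "graded_system k d \<Psi>" using assms(1) by (simp add: bounded_graded_system_def)
  have "coeff (differenced_system k q h \<Psi> j) (j - Suc d) \<noteq> 0 \<and>
      of_int \<bar>coeff (differenced_system k q h \<Psi> j) (j - Suc d)\<bar> \<le> P * real q ^ k * real k * H"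
    if j: "j \<in> {Suc d + 1..k}" for j
  proof
    have lead: "coeff (\<Psi> j) (j - d) \<noteq> 0" "of_int \<bar>coeff (\<Psi> j) (j - d)\<bar> \<le> H"
      using assms(1) j by (auto simp: bounded_graded_system_def)
    have coeff: "coeff (differenced_system k q h \<Psi> j) (j - Suc d)
        = h * int q ^ (k - j) * int (j - d) * coeff (\<Psi> j) (j - d)"
      using j by (intro coeff_differenced_system_top[OF graded]) auto
    show "coeff (differenced_system k q h \<Psi> j) (j - Suc d) \<noteq> 0"
      unfolding coeff using assms(2,4) j lead(1) by auto
    have "of_int \<bar>coeff (differenced_system k q h \<Psi> j) (j - Suc d)\<bar>
        = of_int h * real q ^ (k - j) * real (j - d) * of_int \<bar>coeff (\<Psi> j) (j - d)\<bar>"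
      unfolding coeff using assms(2) by (simp add: abs_mult)
    also have "\<dots> \<le> P * real q ^ k * real k * H"
      using assms(2-5) j lead(2) by (intro mult_mono power_increasing) auto
    finally show "of_int \<bar>coeff (differenced_system k q h \<Psi> j) (j - Suc d)\<bar> \<le> P * real q ^ k * real k * H" .
  qed
  thus ?thesis using graded_differenced_system[OF graded] by (simp add: bounded_graded_system_def)
qed

section \<open>One stage of differencing\<close>

lemma powr_le_max_mult_powr:
  fixes x y c p :: real
  assumes "0 < y" "y \<le> x" "x \<le> c * y"
  shows "x powr p \<le> max 1 (c powr p) * y powr p"
proof (cases "p \<ge> 0")
  case True
  have c: "c > 0" using assms by (metis dual_order.strict_trans1 zero_less_mult_pos2)
  have "x powr p \<le> (c * y) powr p" using assms True by (intro powr_mono2) auto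
  also have "\<dots> = c powr p * y powr p" using c assms by (simp add: powr_mult)
  also have "\<dots> \<le> max 1 (c powr p) * y powr p" by (intro mult_right_mono) auto
  finally show ?thesis .
next
  case False
  have "x powr p \<le> 1 * y powr p" using assms False by (simp add: powr_mono2')
  also have "\<dots> \<le> max 1 (c powr p) * y powr p" by (intro mult_right_mono) auto
  finally show ?thesis .
qed

lemma prime_power_mult_powr_le:
  fixes P Q c C \<phi> \<Lambda> :: real
  assumes "P \<ge> 1" "Q > 0" "P powr \<phi> \<le> real q" "real q \<le> C * P powr \<phi>" "1 \<le> c * (Q / real q)"
  shows "real q ^ n * (Q / real q + 1) powr \<Lambda>
    \<le> max 1 ((1 + c) powr \<Lambda>) * max 1 (C powr (real n - \<Lambda>)) * (P powr (\<phi> * (real n - \<Lambda>)) * Q powr \<Lambda>)"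
proof -
  have y: "P powr \<phi> > 0" using assms(1) by simp
  hence q: "real q > 0" using assms(3) by linarith
  have "Q / real q + 1 \<le> (1 + c) * (Q / real q)"
    using assms(5) by (simp only: distrib_right mult_1 add_left_mono)
  hence "(Q / real q + 1) powr \<Lambda> \<le> max 1 ((1 + c) powr \<Lambda>) * (Q / real q) powr \<Lambda>"
    using assms(2) q by (intro powr_le_max_mult_powr) auto
  hence "real q ^ n * (Q / real q + 1) powr \<Lambda> \<le> real q ^ n * (max 1 ((1 + c) powr \<Lambda>) * (Q / real q) powr \<Lambda>)"
    by (intro mult_left_mono) auto
  also have "\<dots> = max 1 ((1 + c) powr \<Lambda>) * real q powr (real n - \<Lambda>) * Q powr \<Lambda>"
    using q assms(2) by (simp add: powr_diff powr_divide powr_realpow)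
  also have "\<dots> \<le> max 1 ((1 + c) powr \<Lambda>) * (max 1 (C powr (real n - \<Lambda>)) * (P powr \<phi>) powr (real n - \<Lambda>)) * Q powr \<Lambda>"
    using assms y by (intro mult_right_mono mult_left_mono powr_le_max_mult_powr) auto
  finally show ?thesis by (simp add: powr_powr mult_ac)
qed

lemma scaled_length_ge:
  fixes c C P Q \<phi> :: real
  assumes "0 < c" "1 \<le> C" "1 \<le> P" "0 < q" "d < k" "\<phi> \<le> 1 / real k"
    and "c * P powr (real (k - d) / real k) \<le> Q" "real q \<le> C * P powr \<phi>"
  shows "c / C * P powr (real (k - Suc d) / real k) \<le> Q / real q"
proof -
  let ?y = "P powr (real (k - Suc d) / real k)"
  have "real (k - d) / real k = real (k - Suc d) / real k + 1 / real k"
    using assms(5) by (simp add: add_divide_distrib[symmetric] of_nat_diff)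
  hence split: "P powr (real (k - d) / real k) = ?y * P powr (1 / real k)"
    by (simp only: powr_add)
  have "real q \<le> C * P powr (1 / real k)"
    using assms by (intro order.trans[OF assms(8)] mult_left_mono powr_mono) auto
  hence "c / C * ?y * real q \<le> c / C * ?y * (C * P powr (1 / real k))"
    using assms(1,2) by (intro mult_left_mono) auto
  also have "\<dots> = c * P powr (real (k - d) / real k)" using assms(2) by (simp add: split)
  also have "\<dots> \<le> Q" by (rule assms(7))
  finally show ?thesis using assms(4) by (simp add: pos_le_divide_eq)
qed

lemma nat_floor_div_power_le:
  assumes "1 \<le> P" "P powr \<phi> < real q"
  shows "real (nat (\<lfloor>P\<rfloor> div int q ^ k)) \<le> P powr (1 - real k * \<phi>)"
proof -
  have y: "P powr (real k * \<phi>) > 0" using assms(1) by simp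
  have "P powr (real k * \<phi>) = (P powr \<phi>) ^ k"
    using assms(1) by (simp add: powr_realpow[symmetric] powr_powr mult.commute)
  also have "\<dots> \<le> real q ^ k" using assms by (intro power_mono) auto
  finally have denominator: "P powr (real k * \<phi>) \<le> real q ^ k" .
  have "nat (\<lfloor>P\<rfloor> div int q ^ k) = nat \<lfloor>P\<rfloor> div q ^ k"
    using assms(1) by (simp add: nat_div_distrib nat_power_eq)
  also have "real \<dots> \<le> real (nat \<lfloor>P\<rfloor>) / real (q ^ k)" by (rule of_nat_div_le_of_nat)
  also have "\<dots> \<le> P / P powr (real k * \<phi>)"
    using assms(1) y denominator by (intro frac_le) auto
  also have "\<dots> = P powr (1 - real k * \<phi>)" using assms(1) by (simp add: powr_diff)
  finally show ?thesis .
qed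

lemma nat_floor_div_power_mult_powr_le:
  assumes "1 \<le> P" "P powr \<phi> < real q" "E \<le> 2 * real k * real r * \<phi>"
  shows "real (nat (\<lfloor>P\<rfloor> div int q ^ k)) ^ (2 * r) * P powr E \<le> P ^ (2 * r)"
proof -
  have "real (nat (\<lfloor>P\<rfloor> div int q ^ k)) ^ (2 * r) \<le> (P powr (1 - real k * \<phi>)) ^ (2 * r)"
    using nat_floor_div_power_le[OF assms(1,2)] by (intro power_mono) auto
  also have "\<dots> = P powr (2 * real r * (1 - real k * \<phi>))"
    using assms(1) by (simp add: powr_realpow[symmetric] powr_powr mult_ac)
  finally have "real (nat (\<lfloor>P\<rfloor> div int q ^ k)) ^ (2 * r) * P powr E \<le> P powr (2 * real r * (1 - real k * \<phi>)) * P powr E"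
    by (intro mult_right_mono) auto
  also have "\<dots> = P powr (2 * real r * (1 - real k * \<phi>) + E)" by (rule powr_add[symmetric])
  also have "\<dots> \<le> P powr (2 * real r)"
    using assms(1,3) by (intro powr_mono) (auto simp: algebra_simps)
  also have "\<dots> = P ^ (2 * r)" using assms(1) powr_realpow[of P "2 * r"] by simp
  finally show ?thesis .
qed

lemma bounded_graded_system_differenced_powr:
  assumes \<Psi>: "bounded_graded_system k d (B * P powr A) \<Psi>" and "0 \<le> B" "1 \<le> C" "1 \<le> P" "1 \<le> k" "\<phi> \<le> 1 / real k"
    and q: "0 < q" "real q \<le> C * P powr \<phi>" and h: "h \<in> {1..\<lfloor>P\<rfloor> div int q ^ k}"
  shows "bounded_graded_system k (Suc d) (C ^ k * real k * B * P powr (A + 2)) (differenced_system k q h (translate c \<Psi>))"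
proof -
  have "\<lfloor>P\<rfloor> div int q ^ k \<le> \<lfloor>P\<rfloor>" using assms(4) q(1) zdiv_mono2[of "\<lfloor>P\<rfloor>" 1 "int q ^ k"] by simp
  hence "of_int h \<le> P" using h by (simp add: le_floor_iff[symmetric])
  hence differenced: "bounded_graded_system k (Suc d) (P * real q ^ k * real k * (B * P powr A))
      (differenced_system k q h (translate c \<Psi>))"
    using h q(1) assms(2) by (intro bounded_graded_system_differenced bounded_graded_system_translate \<Psi>) auto
  have "real q ^ k \<le> (C * P powr (1 / real k)) ^ k"
    using assms(3-6) by (intro power_mono order.trans[OF q(2)] mult_left_mono powr_mono) auto
  also have "\<dots> = C ^ k * P"
    using assms(4,5) by (simp add: power_mult_distrib powr_realpow[symmetric] powr_powr)
  finally have "P * real q ^ k * real k * (B * P powr A) \<le> P * (C ^ k * P) * real k * (B * P powr A)"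
    using assms(2,4) by (intro mult_left_mono mult_right_mono) auto
  also have "\<dots> = C ^ k * real k * B * P powr (A + 2)"
    using assms(4) by (simp add: powr_add power2_eq_square)
  finally show ?thesis by (rule bounded_graded_system_mono[OF differenced])
qed

lemma scaled_interval_length_le:
  assumes "q > 0"
  shows "real_of_int ((b - c) div int q - (a - c) div int q) \<le> of_int (b - a) / real q + 1"
proof -
  have "real_of_int ((b - c) div int q) \<le> of_int (b - c) / real q"
    using real_of_int_div4[of "b - c" "int q"] by simp
  moreover have "of_int (a - c) / real q \<le> real_of_int ((a - c) div int q) + 1"
    using real_of_int_div3[of "a - c" "int q"] by simp
  moreover have "of_int (b - c) / real q - of_int (a - c) / real q = of_int (b - a) / real q"
    by (simp add: diff_divide_distrib)
  ultimately show ?thesis by simp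
qed

locale mean_value_bound =
  fixes k u :: nat and \<Lambda> CJ :: real
  assumes k_ge_2: "2 \<le> k" and k_le_u: "k \<le> u" and CJ_pos: "0 < CJ"
    and mean_value: "\<And>a b L. 1 \<le> L \<Longrightarrow> of_int (b - a) \<le> L \<Longrightarrow>
      real (energy k (power_sums u) (tuples u {a<..b})) \<le> CJ * L powr \<Lambda>"
begin

lemma u_pos: "0 < u"
  using k_ge_2 k_le_u by simp

definition prime_cost :: "nat \<Rightarrow> real" where
  "prime_cost r = real (2 * u - k + (Suc r choose 2)) - \<Lambda>"

text \<open>The bound that one stage of the differencing process is expected to yield when its prime is
  of size \<open>P\<^sup>\<phi>\<close>. At stage \<open>d\<close> the polynomial of index \<open>j\<close> has degree \<open>j - d\<close>, and for \<open>j \<le> d\<close> it is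
  constant and drops out of the equations.\<close>

definition stage_bound :: "nat \<Rightarrow> real \<Rightarrow> bool" where
  "stage_bound d \<phi> \<longleftrightarrow> (\<forall>A\<ge>0. \<forall>B\<ge>1. \<forall>c>0. \<exists>C>0. \<forall>P\<ge>1. \<forall>Q a b \<Psi>.
     c * P powr (real (k - d) / real k) \<le> Q \<longrightarrow> of_int (b - a) \<le> Q \<longrightarrow>
     bounded_graded_system k d (B * P powr A) \<Psi> \<longrightarrow>
     real (energy k (mixed_sums \<Psi> (k - d) u) (tuples (k - d) {1..\<lfloor>P\<rfloor>} \<times> tuples u {a<..b}))
       \<le> C * (P powr (real (k - d) + \<phi> * prime_cost (k - d)) * Q powr \<Lambda>))"

text \<open>A prime of size \<open>P\<^sup>\<phi>\<close> makes the terms with \<open>h \<noteq> 0\<close> negligible at stage \<open>d\<close>.\<close>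

definition stage_ready :: "nat \<Rightarrow> real \<Rightarrow> bool" where
  "stage_ready d \<phi> \<longleftrightarrow> \<phi> = 1 / real k \<or> (\<exists>\<phi>'. Suc d < k \<and> stage_bound (Suc d) \<phi>' \<and>
     real (k - Suc d) + \<phi>' * prime_cost (k - Suc d) \<le> 2 * real k * real (k - Suc d) * \<phi>)"

definition off_diagonal_le :: "nat \<Rightarrow> nat \<Rightarrow> real \<Rightarrow> real \<Rightarrow> (nat \<Rightarrow> int poly) \<Rightarrow> real \<Rightarrow> bool" where
  "off_diagonal_le r q P L \<Phi> V \<longleftrightarrow> (\<exists>r'>0. \<exists>W. r \<le> 2 * r' \<and>
     real (nat (\<lfloor>P\<rfloor> div int q ^ k)) ^ (2 * r') * W \<le> P ^ (2 * r') * V \<and>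
     (\<forall>h c a b. h \<in> {1..\<lfloor>P\<rfloor> div int q ^ k} \<longrightarrow> of_int (b - a) \<le> L \<longrightarrow>
        real (energy k (mixed_sums (differenced_system k q h (translate c \<Phi>)) r' u)
          (tuples r' {1..\<lfloor>P\<rfloor>} \<times> tuples u {a<..b})) \<le> W))"

lemma off_diagonal_le_large_prime:
  assumes "1 \<le> P" "P < real q ^ k" "0 \<le> V"
  shows "off_diagonal_le r q P L \<Phi> V"
proof -
  have "\<lfloor>P\<rfloor> < int q ^ k" using assms(2) by (simp add: floor_less_iff)
  hence "\<lfloor>P\<rfloor> div int q ^ k = 0" using assms(1) by (intro div_pos_pos_trivial) auto
  thus ?thesis unfolding off_diagonal_le_def
    using assms by (intro exI[of _ "Suc r"] exI[of _ "0::real"]) auto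
qed

lemma off_diagonal_le_next_stage:
  assumes "Suc d < k" "r \<le> k - d" "\<phi> \<le> 1 / real k" "stage_bound (Suc d) \<phi>'"
    and dominated: "real (k - Suc d) + \<phi>' * prime_cost (k - Suc d) \<le> 2 * real k * real (k - Suc d) * \<phi>"
    and "0 \<le> A" "1 \<le> B" "0 < c" "1 \<le> C"
  obtains V where "0 \<le> V" "\<And>P L q \<Psi>. 1 \<le> P \<Longrightarrow> c * P powr (real (k - Suc d) / real k) \<le> L \<Longrightarrow>
    P powr \<phi> < real q \<Longrightarrow> real q \<le> C * P powr \<phi> \<Longrightarrow> bounded_graded_system k d (B * P powr A) \<Psi> \<Longrightarrow>
    off_diagonal_le r q P L \<Psi> (V * L powr \<Lambda>)"
proof -
  let ?r = "k - Suc d" and ?B = "C ^ k * real k * B"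
  let ?E = "real ?r + \<phi>' * prime_cost ?r"
  have "1 * 1 * 1 \<le> ?B" using k_ge_2 assms(7,9) by (intro mult_mono one_le_power) auto
  hence "1 \<le> ?B" "0 \<le> A + 2" using assms(6) by simp_all
  then obtain V where V: "V > 0" and bound: "\<And>P Q a b \<Psi>. 1 \<le> P \<Longrightarrow> c * P powr (real ?r / real k) \<le> Q \<Longrightarrow>
      of_int (b - a) \<le> Q \<Longrightarrow> bounded_graded_system k (Suc d) (?B * P powr (A + 2)) \<Psi> \<Longrightarrow>
      real (energy k (mixed_sums \<Psi> ?r u) (tuples ?r {1..\<lfloor>P\<rfloor>} \<times> tuples u {a<..b})) \<le> V * (P powr ?E * Q powr \<Lambda>)"
    using assms(4)[unfolded stage_bound_def, rule_format, of "A + 2" ?B c] assms(8) by blast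
  have "off_diagonal_le r q P L \<Psi> (V * L powr \<Lambda>)"
    if P: "1 \<le> P" and L: "c * P powr (real ?r / real k) \<le> L"
      and q: "P powr \<phi> < real q" "real q \<le> C * P powr \<phi>"
      and \<Psi>: "bounded_graded_system k d (B * P powr A) \<Psi>" for P L q \<Psi>
  proof -
    let ?H = "\<lfloor>P\<rfloor> div int q ^ k"
    let ?W = "V * (P powr ?E * L powr \<Lambda>)"
    have q_pos: "0 < q" using q(1) P by (metis of_nat_0_less_iff order.strict_trans1 powr_ge_zero)
    have "(real (nat ?H) ^ (2 * ?r) * P powr ?E) * (V * L powr \<Lambda>) \<le> P ^ (2 * ?r) * (V * L powr \<Lambda>)"
      using V by (intro mult_right_mono nat_floor_div_power_mult_powr_le[OF P q(1) dominated]) auto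
    hence total: "real (nat ?H) ^ (2 * ?r) * ?W \<le> P ^ (2 * ?r) * (V * L powr \<Lambda>)" by (simp only: mult_ac)
    have "real (energy k (mixed_sums (differenced_system k q h (translate c' \<Psi>)) ?r u)
        (tuples ?r {1..\<lfloor>P\<rfloor>} \<times> tuples u {a<..b})) \<le> ?W"
      if "h \<in> {1..?H}" "of_int (b - a) \<le> L" for h c' a b
      using that P assms(3,7,9) k_ge_2 q_pos q(2)
      by (intro bound L bounded_graded_system_differenced_powr[OF \<Psi>]) auto
    thus ?thesis unfolding off_diagonal_le_def
      using total assms(1,2) by (intro exI[of _ ?r] exI[of _ ?W]) auto
  qed
  thus ?thesis using V by (intro that[of V]) auto
qed

lemma off_diagonal_le_stage_ready:
  assumes "r \<le> k - d" "\<phi> \<le> 1 / real k" "stage_ready d \<phi>" "0 \<le> A" "1 \<le> B" "0 < c" "1 \<le> C"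
  obtains V where "0 \<le> V" "\<And>P L q \<Psi>. 1 \<le> P \<Longrightarrow> c * P powr (real (k - Suc d) / real k) \<le> L \<Longrightarrow>
    P powr \<phi> < real q \<Longrightarrow> real q \<le> C * P powr \<phi> \<Longrightarrow> bounded_graded_system k d (B * P powr A) \<Psi> \<Longrightarrow>
    off_diagonal_le r q P L \<Psi> (V * L powr \<Lambda>)"
proof (cases "\<phi> = 1 / real k")
  case True
  have "off_diagonal_le r q P L \<Psi> (0 * L powr \<Lambda>)" if P: "1 \<le> P" and q: "P powr \<phi> < real q" for P L q \<Psi>
  proof (rule off_diagonal_le_large_prime[OF P])
    have "P = (P powr \<phi>) ^ k" using P k_ge_2 True by (simp add: powr_realpow[symmetric] powr_powr)
    also have "\<dots> < real q ^ k" using q k_ge_2 by (intro power_strict_mono) auto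
    finally show "P < real q ^ k" .
  qed simp
  thus ?thesis using that[of 0] by simp
next
  case False
  then obtain \<phi>' where "Suc d < k" "stage_bound (Suc d) \<phi>'"
    "real (k - Suc d) + \<phi>' * prime_cost (k - Suc d) \<le> 2 * real k * real (k - Suc d) * \<phi>"
    using assms(3) unfolding stage_ready_def by blast
  from off_diagonal_le_next_stage[OF this(1) assms(1,2) this(2,3) assms(4-7)] that show ?thesis by metis
qed

lemma energy_at_prime:
  assumes "prime q" "r \<le> k" "1 \<le> P" "1 \<le> L" "of_int (b - a) / real q + 1 \<le> L"
    and "admissible_residues k r u \<Psi> q D \<Gamma>" "off_diagonal_le r q P L \<Psi> V"
    and S: "S \<subseteq> tuples r {1..\<lfloor>P\<rfloor>} \<times> tuples u {a<..b}" "residue_pair q r u ` S \<subseteq> \<Gamma>"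
  shows "real (energy k (mixed_sums \<Psi> r u) S)
    \<le> real D * (real q ^ u * (real u * (real q ^ (r choose 2) * (3 ^ r * (P ^ r * (CJ * L powr \<Lambda> + V))))))"
proof -
  let ?b = "3 ^ r * (P ^ r * (CJ * L powr \<Lambda> + V))" and ?I = "\<lambda>c. {(a - c) div int q<..(b - c) div int q}"
  have q: "q > 0" using assms(1) by (rule prime_gt_0_nat)
  obtain r' W where r': "r' > 0" "r \<le> 2 * r'"
    and W: "real (nat (\<lfloor>P\<rfloor> div int q ^ k)) ^ (2 * r') * W \<le> P ^ (2 * r') * V"
    and differenced: "\<And>h c a b. h \<in> {1..\<lfloor>P\<rfloor> div int q ^ k} \<Longrightarrow> of_int (b - a) \<le> L \<Longrightarrow>
      real (energy k (mixed_sums (differenced_system k q h (translate c \<Psi>)) r' u)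
        (tuples r' {1..\<lfloor>P\<rfloor>} \<times> tuples u {a<..b})) \<le> W"
    using assms(7) unfolding off_diagonal_le_def by blast
  have lifted: "real (card (lifted_solutions k q r u (translate c \<Psi>) {1..\<lfloor>P\<rfloor>} (?I c))) \<le> ?b" for c
  proof -
    have length: "of_int ((b - c) div int q - (a - c) div int q) \<le> L"
      using scaled_interval_length_le[OF q, of b c a] assms(5) by linarith
    have "real (card (lifted_solutions k q r u (translate c \<Psi>) {1..\<lfloor>P\<rfloor>} (?I c)))
      \<le> 3 ^ r * (P ^ r * real (energy k (power_sums u) (tuples u (?I c)))
        + P ^ r / P ^ (2 * r') * (real (nat (\<lfloor>P\<rfloor> div int q ^ k)) ^ (2 * r') * W))"
      using assms(3) q r' differenced[OF _ length] by (intro card_lifted_solutions_le) auto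
    also have "\<dots> \<le> 3 ^ r * (P ^ r * (CJ * L powr \<Lambda>) + P ^ r / P ^ (2 * r') * (P ^ (2 * r') * V))"
      using assms(3) W mean_value[OF assms(4) length] by (intro mult_left_mono add_mono) auto
    also have "\<dots> = ?b" using assms(3) by (simp add: distrib_left)
    finally show ?thesis .
  qed
  define t where "t = nat \<lfloor>?b\<rfloor>"
  have t: "real t \<le> ?b" using lifted[of 0] by (simp add: t_def)
  have "energy k (mixed_sums \<Psi> r u) S \<le> D * (q ^ u * (u * (q ^ (r choose 2) * t)))"
    using k_ge_2 lifted u_pos
    by (intro energy_le_lifted_solutions[OF _ assms(1) _ assms(2) _ assms(6) S]) (auto simp: t_def le_nat_floor)
  hence "real (energy k (mixed_sums \<Psi> r u) S) \<le> real (D * (q ^ u * (u * (q ^ (r choose 2) * t))))"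
    by (simp only: of_nat_le_iff)
  also have "\<dots> = real D * (real q ^ u * (real u * (real q ^ (r choose 2) * real t)))" by simp
  also have "\<dots> \<le> real D * (real q ^ u * (real u * (real q ^ (r choose 2) * ?b)))"
    by (intro mult_left_mono t) auto
  finally show ?thesis .
qed

lemma power_sums_energy_le_at_prime:
  assumes "prime q" "k < q" "1 \<le> L" "of_int (b - a) / real q + 1 \<le> L"
  shows "real (energy k (power_sums u) (tuples u {a<..b})) \<le> real (k ^ k * u) * CJ * (real q ^ (2 * u - k) * L powr \<Lambda>)"
proof -
  let ?S = "tuples 0 {1..\<lfloor>1::real\<rfloor>} \<times> tuples u {a<..b}" and ?\<Psi> = "\<lambda>_. 0 :: int poly"
  let ?\<Gamma> = "{(\<xi>, \<eta>) \<in> tuples 0 (residues q) \<times> tuples u (residues q). incongruent q 0 \<xi>}"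
  have "1 ^ k < real q ^ k" using assms(2) k_ge_2 by (intro power_strict_mono) auto
  hence off_diagonal: "off_diagonal_le 0 q 1 L ?\<Psi> 0" by (intro off_diagonal_le_large_prime) auto
  have admissible: "admissible_residues k 0 u ?\<Psi> q ((k - 0) ^ (k - 0) * 0 ^ 0 * q ^ (u + 0 - k)) ?\<Gamma>"
    using k_le_u by (intro admissible_residues_graded[OF assms(1,2)]) (auto simp: graded_system_def)
  have residues: "residue_pair q 0 u ` ?S \<subseteq> ?\<Gamma>"
    using residue_tuple_in[OF prime_gt_0_nat[OF assms(1)], of 0]
      residue_tuple_in[OF prime_gt_0_nat[OF assms(1)], of u]
    by (auto simp: residue_pair_def incongruent_def)
  have "energy k (power_sums u) (tuples u {a<..b}) \<le> energy k (mixed_sums ?\<Psi> 0 u) ?S"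
  proof (rule energy_le_inj[where f = "\<lambda>z. (\<lambda>_. undefined, z)"])
    show "finite ?S" by (intro finite_cartesian_product finite_tuples) simp_all
    show "\<forall>j\<in>{1..k}. mixed_sums ?\<Psi> 0 u (\<lambda>_. undefined, z) j = mixed_sums ?\<Psi> 0 u (\<lambda>_. undefined, w) j"
      if "\<forall>j\<in>{1..k}. power_sums u z j = power_sums u w j" for z w
      unfolding joint_sum_Pair add_left_cancel by (rule that)
    show "inj_on (\<lambda>z. (\<lambda>_. undefined, z)) (tuples u {a<..b})" by (simp add: inj_on_def)
    show "(\<lambda>z. (\<lambda>_. undefined, z)) ` tuples u {a<..b} \<subseteq> ?S" by (intro image_subsetI SigmaI, rule PiE_I, simp_all)
  qed
  hence "real (energy k (power_sums u) (tuples u {a<..b})) \<le> real (energy k (mixed_sums ?\<Psi> 0 u) ?S)" by simp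
  also have "\<dots> \<le> real ((k - 0) ^ (k - 0) * 0 ^ 0 * q ^ (u + 0 - k))
      * (real q ^ u * (real u * (real q ^ (0 choose 2) * (3 ^ 0 * (1 ^ 0 * (CJ * L powr \<Lambda> + 0))))))"
    by (rule energy_at_prime[OF assms(1) _ _ assms(3,4) admissible off_diagonal subset_refl residues]) auto
  also have "\<dots> = real (k ^ k * u) * CJ * ((real q ^ (u - k) * real q ^ u) * L powr \<Lambda>)"
    by (simp add: binomial_eq_0)
  also have "real q ^ (u - k) * real q ^ u = real q ^ (2 * u - k)"
    using k_le_u by (simp add: power_add[symmetric] mult_2)
  finally show ?thesis .
qed

end

lemma abs_prod_leading_coeffs_le:
  assumes "bounded_graded_system k d H \<Psi>"
  shows "(\<Prod>j\<in>{d + 1..k}. coeff (\<Psi> j) (j - d)) \<noteq> 0"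
    and "of_int \<bar>\<Prod>j\<in>{d + 1..k}. coeff (\<Psi> j) (j - d)\<bar> \<le> H ^ (k - d)"
proof -
  show "(\<Prod>j\<in>{d + 1..k}. coeff (\<Psi> j) (j - d)) \<noteq> 0"
    using assms by (auto simp: bounded_graded_system_def)
  have "of_int \<bar>\<Prod>j\<in>{d + 1..k}. coeff (\<Psi> j) (j - d)\<bar> = (\<Prod>j\<in>{d + 1..k}. real_of_int \<bar>coeff (\<Psi> j) (j - d)\<bar>)"
    by (simp add: abs_prod)
  also have "\<dots> \<le> (\<Prod>j\<in>{d + 1..k}. H)"
    using assms by (intro prod_mono) (auto simp: bounded_graded_system_def)
  finally show "of_int \<bar>\<Prod>j\<in>{d + 1..k}. coeff (\<Psi> j) (j - d)\<bar> \<le> H ^ (k - d)" by simp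
qed

locale differencing_stage = mean_value_bound +
  fixes d r :: nat and \<phi> A B c :: real
  assumes d_less_k: "d < k" and r_le: "r \<le> k - d"
    and \<phi>_pos: "0 < \<phi>" and \<phi>_le: "\<phi> \<le> 1 / real k" and ready: "stage_ready d \<phi>"
    and A_nonneg: "0 \<le> A" and B_ge_1: "1 \<le> B" and c_pos: "0 < c"
begin

definition stage_data :: "real \<Rightarrow> real \<Rightarrow> int \<Rightarrow> int \<Rightarrow> (nat \<Rightarrow> int poly) \<Rightarrow> bool" where
  "stage_data P Q a b \<Psi> \<longleftrightarrow> 1 \<le> P \<and> c * P powr (real (k - d) / real k) \<le> Q \<and> of_int (b - a) \<le> Q \<and>
     bounded_graded_system k d (B * P powr A) \<Psi>"

definition stage_prime :: "real \<Rightarrow> real \<Rightarrow> (nat \<Rightarrow> int poly) \<Rightarrow> nat \<Rightarrow> bool" where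
  "stage_prime C P \<Psi> q \<longleftrightarrow> prime q \<and> k < q \<and> P powr \<phi> < real q \<and> real q \<le> C * P powr \<phi> \<and>
     (\<forall>j\<in>{d + 1..k}. \<not> int q dvd coeff (\<Psi> j) (j - d))"

definition separating_primes :: "real \<Rightarrow> real \<Rightarrow> (nat \<Rightarrow> int poly) \<Rightarrow> nat \<Rightarrow> nat set \<Rightarrow> bool" where
  "separating_primes C P \<Psi> M T \<longleftrightarrow> finite T \<and> (\<forall>q\<in>T. stage_prime C P \<Psi> q) \<and>
     (\<forall>D. D \<noteq> 0 \<and> of_int \<bar>D\<bar> \<le> P ^ M \<longrightarrow> (\<exists>q\<in>T. \<not> int q dvd D))"

definition main_term :: "real \<Rightarrow> real \<Rightarrow> real" where
  "main_term P Q = P ^ r * (P powr (\<phi> * prime_cost r) * Q powr \<Lambda>)"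

lemma main_term_nonneg: "1 \<le> P \<Longrightarrow> 0 \<le> main_term P Q"
  by (simp add: main_term_def)

lemma main_term_eq_powr: "1 \<le> P \<Longrightarrow> main_term P Q = P powr (real r + \<phi> * prime_cost r) * Q powr \<Lambda>"
  unfolding main_term_def by (simp add: powr_add powr_realpow)

lemma separating_primes_not_dvd_leading_coeffs:
  defines "lead \<equiv> \<lambda>\<Psi>. \<Prod>j\<in>{d + 1..k}. coeff (\<Psi> j) (j - d)"
  assumes data: "stage_data P Q a b \<Psi>" and "finite T"
    and primes: "\<forall>q\<in>T. prime q \<and> k < q \<and> P powr \<phi> < real q \<and> real q \<le> C * P powr \<phi>"
    and avoid: "\<forall>D. D \<noteq> 0 \<and> of_int \<bar>D\<bar> \<le> B ^ (k - d) * P powr (A * real (k - d) + real M) \<longrightarrow> (\<exists>q\<in>T. \<not> int q dvd D)"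
  shows "separating_primes C P \<Psi> M {q \<in> T. \<not> int q dvd lead \<Psi>}" (is "separating_primes _ _ _ _ ?T")
proof -
  have P: "1 \<le> P" and \<Psi>: "bounded_graded_system k d (B * P powr A) \<Psi>"
    using data by (simp_all add: stage_data_def)
  have "\<exists>q\<in>?T. \<not> int q dvd D" if D: "D \<noteq> 0" "of_int \<bar>D\<bar> \<le> P ^ M" for D
  proof -
    have "of_int \<bar>lead \<Psi> * D\<bar> \<le> (B * P powr A) ^ (k - d) * P ^ M"
      using abs_prod_leading_coeffs_le(2)[OF \<Psi>] D B_ge_1 P
      unfolding abs_mult of_int_mult lead_def by (intro mult_mono) auto
    also have "\<dots> = B ^ (k - d) * P powr (A * real (k - d) + real M)"
      using P by (simp add: power_mult_distrib powr_add powr_realpow[symmetric] powr_powr)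
    finally obtain q where "q \<in> T" "\<not> int q dvd lead \<Psi> * D"
      using avoid[rule_format, of "lead \<Psi> * D"] abs_prod_leading_coeffs_le(1)[OF \<Psi>] D by (auto simp: lead_def)
    thus ?thesis by auto
  qed
  moreover have "stage_prime C P \<Psi> q" if q: "q \<in> ?T" for q
  proof -
    have "coeff (\<Psi> j) (j - d) dvd lead \<Psi>" if "j \<in> {d + 1..k}" for j
      unfolding lead_def by (rule dvd_prodI[OF finite_atLeastAtMost that])
    hence "\<not> int q dvd coeff (\<Psi> j) (j - d)" if "j \<in> {d + 1..k}" for j
      using q that dvd_trans[of "int q" "coeff (\<Psi> j) (j - d)" "lead \<Psi>"] by auto
    thus ?thesis using primes q by (simp add: stage_prime_def)
  qed
  ultimately show ?thesis using assms(3) by (auto simp: separating_primes_def)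
qed

lemma separating_primes_exist:
  fixes M :: nat
  obtains C N where "1 \<le> C" "\<And>P Q a b \<Psi>. stage_data P Q a b \<Psi> \<Longrightarrow> \<exists>T. card T \<le> N \<and> separating_primes C P \<Psi> M T"
proof -
  let ?E = "A * real (k - d) + real M"
  have lead_bound: "1 \<le> B ^ (k - d)" using B_ge_1 by simp
  obtain C N where C: "1 \<le> C" and primes: "\<And>P. 1 \<le> P \<Longrightarrow> \<exists>T. finite T \<and> card T = N \<and>
      (\<forall>q\<in>T. prime q \<and> k < q \<and> P powr \<phi> < real q \<and> real q \<le> C * P powr \<phi>) \<and>
      (\<forall>D. D \<noteq> 0 \<and> of_int \<bar>D\<bar> \<le> B ^ (k - d) * P powr ?E \<longrightarrow> (\<exists>q\<in>T. \<not> int q dvd D))"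
    by (rule primes_avoiding_small_integers[OF \<phi>_pos lead_bound, where E = ?E and k = k], rule that)
  have "\<exists>T. card T \<le> N \<and> separating_primes C P \<Psi> M T" if data: "stage_data P Q a b \<Psi>" for P Q a b \<Psi>
  proof -
    have P: "1 \<le> P" using data by (simp add: stage_data_def)
    obtain T where T: "finite T" "card T = N"
      "\<forall>q\<in>T. prime q \<and> k < q \<and> P powr \<phi> < real q \<and> real q \<le> C * P powr \<phi>"
      "\<forall>D. D \<noteq> 0 \<and> of_int \<bar>D\<bar> \<le> B ^ (k - d) * P powr ?E \<longrightarrow> (\<exists>q\<in>T. \<not> int q dvd D)"
      using primes[OF P] by (elim exE conjE)
    let ?T = "{q \<in> T. \<not> int q dvd (\<Prod>j\<in>{d + 1..k}. coeff (\<Psi> j) (j - d))}"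
    have "card ?T \<le> N" unfolding T(2)[symmetric] using T(1) by (intro card_mono) auto
    moreover have "separating_primes C P \<Psi> M ?T"
      by (rule separating_primes_not_dvd_leading_coeffs[OF data T(1,3,4)])
    ultimately show ?thesis by (intro exI[of _ ?T] conjI)
  qed
  thus ?thesis by (rule that[OF C])
qed

lemma stage_prime_length:
  assumes "1 \<le> C" "stage_data P Q a b \<Psi>" "stage_prime C P \<Psi> q"
  shows "c / C * P powr (real (k - Suc d) / real k) \<le> Q / real q" "c / C \<le> Q / real q"
proof -
  have P: "1 \<le> P" and Q: "c * P powr (real (k - d) / real k) \<le> Q"
    using assms(2) by (simp_all add: stage_data_def)
  have q: "0 < q" "real q \<le> C * P powr \<phi>" using assms(3) by (auto simp: stage_prime_def prime_gt_0_nat)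
  show length: "c / C * P powr (real (k - Suc d) / real k) \<le> Q / real q"
    by (rule scaled_length_ge[OF c_pos assms(1) P q(1) d_less_k \<phi>_le Q q(2)])
  have "c / C * 1 \<le> c / C * P powr (real (k - Suc d) / real k)"
    using c_pos assms(1) P by (intro mult_left_mono) (auto simp: ge_one_powr_ge_zero)
  thus "c / C \<le> Q / real q" using length by linarith
qed

lemma stage_prime_cost_le:
  assumes "1 \<le> C"
  obtains G where "0 \<le> G" "\<And>P Q a b \<Psi> q. stage_data P Q a b \<Psi> \<Longrightarrow> stage_prime C P \<Psi> q \<Longrightarrow>
    P ^ r * (real q ^ (2 * u - k + (Suc r choose 2)) * (Q / real q + 1) powr \<Lambda>) \<le> G * main_term P Q"
proof
  let ?G = "max 1 ((1 + C / c) powr \<Lambda>) * max 1 (C powr prime_cost r)"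
  show "0 \<le> ?G" by simp
  fix P Q a b \<Psi> q assume data: "stage_data P Q a b \<Psi>" and prime: "stage_prime C P \<Psi> q"
  have P: "1 \<le> P" using data by (simp add: stage_data_def)
  have q: "P powr \<phi> \<le> real q" "real q \<le> C * P powr \<phi>" using prime by (auto simp: stage_prime_def)
  have "c / C \<le> Q / real q" by (rule stage_prime_length(2)[OF assms data prime])
  moreover from this have "0 < Q / real q" using c_pos assms by (smt (verit) divide_pos_pos)
  ultimately have ratio: "1 \<le> C / c * (Q / real q)" and Q: "0 < Q"
    using c_pos assms by (auto simp: field_simps zero_less_divide_iff)
  have "P ^ r * (real q ^ (2 * u - k + (Suc r choose 2)) * (Q / real q + 1) powr \<Lambda>)
      \<le> P ^ r * (?G * (P powr (\<phi> * prime_cost r) * Q powr \<Lambda>))"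
    unfolding prime_cost_def using P by (intro mult_left_mono prime_power_mult_powr_le P Q q ratio) auto
  thus "P ^ r * (real q ^ (2 * u - k + (Suc r choose 2)) * (Q / real q + 1) powr \<Lambda>) \<le> ?G * main_term P Q"
    by (simp add: main_term_def mult_ac)
qed

lemma energy_le_at_stage_prime:
  fixes n :: nat
  assumes "1 \<le> C"
  obtains K where "0 \<le> K" "\<And>P Q a b \<Psi> q \<Gamma> S. stage_data P Q a b \<Psi> \<Longrightarrow> stage_prime C P \<Psi> q \<Longrightarrow>
    admissible_residues k r u \<Psi> q (n * q ^ (u + r - k)) \<Gamma> \<Longrightarrow>
    S \<subseteq> tuples r {1..\<lfloor>P\<rfloor>} \<times> tuples u {a<..b} \<Longrightarrow> residue_pair q r u ` S \<subseteq> \<Gamma> \<Longrightarrow>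
    real (energy k (mixed_sums \<Psi> r u) S) \<le> K * main_term P Q"
proof -
  obtain G where G: "0 \<le> G" and cost: "\<And>P Q a b \<Psi> q. stage_data P Q a b \<Psi> \<Longrightarrow> stage_prime C P \<Psi> q \<Longrightarrow>
      P ^ r * (real q ^ (2 * u - k + (Suc r choose 2)) * (Q / real q + 1) powr \<Lambda>) \<le> G * main_term P Q"
    by (rule stage_prime_cost_le[OF assms], rule that)
  have "0 < c / C" using c_pos assms by simp
  then obtain V where V: "0 \<le> V" and off_diagonal: "\<And>P L q \<Psi>. 1 \<le> P \<Longrightarrow>
      c / C * P powr (real (k - Suc d) / real k) \<le> L \<Longrightarrow> P powr \<phi> < real q \<Longrightarrow> real q \<le> C * P powr \<phi> \<Longrightarrow>
      bounded_graded_system k d (B * P powr A) \<Psi> \<Longrightarrow> off_diagonal_le r q P L \<Psi> (V * L powr \<Lambda>)"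
    using off_diagonal_le_stage_ready[OF r_le \<phi>_le ready A_nonneg B_ge_1 _ assms, of "c / C"] by blast
  define K where "K = real n * real u * 3 ^ r * (CJ + V)"
  have K: "0 \<le> K" using CJ_pos V by (simp add: K_def)
  have exponent: "u + r - k + u + (r choose 2) = 2 * u - k + (Suc r choose 2)"
    using k_le_u by (simp add: numeral_2_eq_2)
  have "real (energy k (mixed_sums \<Psi> r u) S) \<le> K * G * main_term P Q"
    if data: "stage_data P Q a b \<Psi>" and prime: "stage_prime C P \<Psi> q"
      and \<Gamma>: "admissible_residues k r u \<Psi> q (n * q ^ (u + r - k)) \<Gamma>"
      and S: "S \<subseteq> tuples r {1..\<lfloor>P\<rfloor>} \<times> tuples u {a<..b}" "residue_pair q r u ` S \<subseteq> \<Gamma>"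
    for P Q a b \<Psi> q \<Gamma> S
  proof -
    let ?L = "Q / real q + 1"
    have P: "1 \<le> P" and "of_int (b - a) \<le> Q" and \<Psi>: "bounded_graded_system k d (B * P powr A) \<Psi>"
      using data by (simp_all add: stage_data_def)
    hence length: "of_int (b - a) / real q + 1 \<le> ?L" by (simp add: divide_right_mono)
    have q: "prime q" "P powr \<phi> < real q" "real q \<le> C * P powr \<phi>" using prime by (simp_all add: stage_prime_def)
    have L: "1 \<le> ?L" "c / C * P powr (real (k - Suc d) / real k) \<le> ?L" and "r \<le> k"
      using stage_prime_length[OF assms data prime] \<open>0 < c / C\<close> r_le by auto
    have "real (energy k (mixed_sums \<Psi> r u) S) \<le> real (n * q ^ (u + r - k))
        * (real q ^ u * (real u * (real q ^ (r choose 2) * (3 ^ r * (P ^ r * (CJ * ?L powr \<Lambda> + V * ?L powr \<Lambda>))))))"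
      by (rule energy_at_prime[OF q(1) \<open>r \<le> k\<close> P L(1) length \<Gamma> off_diagonal[OF P L(2) q(2,3) \<Psi>] S])
    also have "\<dots> = K * (P ^ r * (real q ^ (u + r - k + u + (r choose 2)) * ?L powr \<Lambda>))"
      by (simp add: K_def power_add algebra_simps)
    also have "\<dots> \<le> K * (G * main_term P Q)"
      unfolding exponent using K cost[OF data prime] by (intro mult_left_mono) auto
    finally show ?thesis by (simp add: mult.assoc)
  qed
  moreover have "0 \<le> K * G" using K G by simp
  ultimately show ?thesis using that by metis
qed

lemma energy_le_if_admissible:
  fixes n M :: nat
  obtains K where "0 \<le> K" "\<And>P Q a b \<Psi> \<Gamma> S \<delta>. stage_data P Q a b \<Psi> \<Longrightarrow>
    S \<subseteq> tuples r {1..\<lfloor>P\<rfloor>} \<times> tuples u {a<..b} \<Longrightarrow>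
    (\<forall>C q. stage_prime C P \<Psi> q \<longrightarrow> admissible_residues k r u \<Psi> q (n * q ^ (u + r - k)) (\<Gamma> q)) \<Longrightarrow>
    (\<forall>p\<in>S. \<delta> p \<noteq> 0 \<and> of_int \<bar>\<delta> p\<bar> \<le> P ^ M) \<Longrightarrow>
    (\<forall>q. \<forall>p\<in>S. prime q \<longrightarrow> \<not> int q dvd \<delta> p \<longrightarrow> residue_pair q r u p \<in> \<Gamma> q) \<Longrightarrow>
    real (energy k (mixed_sums \<Psi> r u) S) \<le> K * main_term P Q"
proof -
  obtain C N where C: "1 \<le> C" and primes: "\<And>P Q a b \<Psi>. stage_data P Q a b \<Psi> \<Longrightarrow> 
      \<exists>T. card T \<le> N \<and> separating_primes C P \<Psi> M T"
    by (rule separating_primes_exist[where M = M], rule that)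
  obtain K where K: "0 \<le> K" and at_prime: "\<And>P Q a b \<Psi> q \<Gamma> S. stage_data P Q a b \<Psi> \<Longrightarrow> stage_prime C P \<Psi> q \<Longrightarrow>
      admissible_residues k r u \<Psi> q (n * q ^ (u + r - k)) \<Gamma> \<Longrightarrow>
      S \<subseteq> tuples r {1..\<lfloor>P\<rfloor>} \<times> tuples u {a<..b} \<Longrightarrow> residue_pair q r u ` S \<subseteq> \<Gamma> \<Longrightarrow>
      real (energy k (mixed_sums \<Psi> r u) S) \<le> K * main_term P Q"
    by (rule energy_le_at_stage_prime[OF C, where n = n], rule that)
  have "real (energy k (mixed_sums \<Psi> r u) S) \<le> real N ^ 2 * K * main_term P Q"
    if data: "stage_data P Q a b \<Psi>" and S: "S \<subseteq> tuples r {1..\<lfloor>P\<rfloor>} \<times> tuples u {a<..b}"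
      and admissible: "\<forall>C q. stage_prime C P \<Psi> q \<longrightarrow> admissible_residues k r u \<Psi> q (n * q ^ (u + r - k)) (\<Gamma> q)"
      and \<delta>: "\<forall>p\<in>S. \<delta> p \<noteq> 0 \<and> of_int \<bar>\<delta> p\<bar> \<le> P ^ M"
      and residues: "\<forall>q. \<forall>p\<in>S. prime q \<longrightarrow> \<not> int q dvd \<delta> p \<longrightarrow> residue_pair q r u p \<in> \<Gamma> q"
    for P Q a b \<Psi> \<Gamma> S \<delta>
  proof -
    let ?E = "energy k (mixed_sums \<Psi> r u)" and ?S = "\<lambda>q. {p \<in> S. \<not> int q dvd \<delta> p}"
    have P: "1 \<le> P" using data by (simp add: stage_data_def)
    obtain T where "card T \<le> N" and T: "finite T" "\<And>q. q \<in> T \<Longrightarrow> stage_prime C P \<Psi> q"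
      "\<And>D. D \<noteq> 0 \<Longrightarrow> of_int \<bar>D\<bar> \<le> P ^ M \<Longrightarrow> \<exists>q\<in>T. \<not> int q dvd D"
      using primes[OF data] by (auto simp: separating_primes_def)
    have finS: "finite S" by (rule finite_subset[OF S]) auto
    have "real (?E S) \<le> real (card T) ^ 2 * (K * main_term P Q)"
    proof (rule energy_le_cover[OF T(1)])
      show "S \<subseteq> (\<Union>q\<in>T. ?S q)" using T(3) \<delta> by blast
      fix q assume q: "q \<in> T"
      hence "prime q" using T(2) by (auto simp: stage_prime_def)
      thus "real (?E (?S q)) \<le> K * main_term P Q"
        using S residues by (intro at_prime[OF data T(2)[OF q] admissible[rule_format, OF T(2)[OF q]]]) auto
    qed (use finS in simp)
    also have "\<dots> \<le> real N ^ 2 * (K * main_term P Q)"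
      using \<open>card T \<le> N\<close> K main_term_nonneg[OF P] by (intro mult_right_mono power_mono) auto
    finally show ?thesis by (simp add: mult.assoc)
  qed
  moreover have "0 \<le> real N ^ 2 * K" using K by simp
  ultimately show ?thesis using that by metis
qed

lemma interval_energy_le:
  obtains K where "0 \<le> K" "\<And>P Q a b \<Psi>. stage_data P Q a b \<Psi> \<Longrightarrow>
    P ^ r * real (energy k (power_sums u) (tuples u {a<..b})) \<le> K * main_term P Q"
proof -
  obtain C N where C: "1 \<le> C" and primes: "\<And>P Q a b \<Psi>. stage_data P Q a b \<Psi> \<Longrightarrow> 
      \<exists>T. card T \<le> N \<and> separating_primes C P \<Psi> 0 T"
    by (rule separating_primes_exist[where M = 0], rule that)
  obtain G where G: "0 \<le> G" and cost: "\<And>P Q a b \<Psi> q. stage_data P Q a b \<Psi> \<Longrightarrow> stage_prime C P \<Psi> q \<Longrightarrow>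
      P ^ r * (real q ^ (2 * u - k + (Suc r choose 2)) * (Q / real q + 1) powr \<Lambda>) \<le> G * main_term P Q"
    by (rule stage_prime_cost_le[OF C], rule that)
  define K where "K = real (k ^ k * u) * CJ"
  have K: "0 \<le> K" using CJ_pos by (simp add: K_def)
  have "P ^ r * real (energy k (power_sums u) (tuples u {a<..b})) \<le> K * G * main_term P Q"
    if data: "stage_data P Q a b \<Psi>" for P Q a b \<Psi>
  proof -
    have P: "1 \<le> P" and ab: "of_int (b - a) \<le> Q" using data by (simp_all add: stage_data_def)
    obtain q where prime: "stage_prime C P \<Psi> q" 
      using primes[OF data] by (fastforce simp: separating_primes_def dest: spec[of _ 1])
    let ?L = "Q / real q + 1"
    have q: "prime q" "k < q" using prime by (simp_all add: stage_prime_def)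
    have "real (energy k (power_sums u) (tuples u {a<..b})) \<le> K * (real q ^ (2 * u - k) * ?L powr \<Lambda>)"
      unfolding K_def using stage_prime_length(2)[OF C data prime] c_pos C ab
      by (intro power_sums_energy_le_at_prime[OF q]) (auto simp: divide_right_mono intro: order.trans[of 0 "c / C"])
    also have "\<dots> \<le> K * (real q ^ (2 * u - k + (Suc r choose 2)) * ?L powr \<Lambda>)"
      using K q(2) by (intro mult_left_mono mult_right_mono power_increasing) auto
    finally have "P ^ r * real (energy k (power_sums u) (tuples u {a<..b}))
        \<le> P ^ r * (K * (real q ^ (2 * u - k + (Suc r choose 2)) * ?L powr \<Lambda>))"
      using P by (intro mult_left_mono) auto
    also have "\<dots> = K * (P ^ r * (real q ^ (2 * u - k + (Suc r choose 2)) * ?L powr \<Lambda>))" by (simp only: mult_ac)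
    also have "\<dots> \<le> K * (G * main_term P Q)" using K cost[OF data prime] by (intro mult_left_mono) auto
    finally show ?thesis by (simp add: mult.assoc)
  qed
  moreover have "0 \<le> K * G" using K G by simp
  ultimately show ?thesis using that by metis
qed

end

context differencing_stage
begin

lemma distinct_entries_energy_le:
  assumes "r = k - d"
  obtains K where "0 \<le> K" "\<And>P Q a b \<Psi>. stage_data P Q a b \<Psi> \<Longrightarrow>
    real (energy k (mixed_sums \<Psi> r u) ({x \<in> tuples r {1..\<lfloor>P\<rfloor>}. inj_on x {..<r}} \<times> tuples u {a<..b}))
      \<le> K * main_term P Q"
proof -
  have d: "k - r = d" "r \<le> k" using assms d_less_k by simp_all
  let ?\<Gamma> = "\<lambda>q. {(\<xi>, \<eta>) \<in> tuples r (residues q) \<times> tuples u (residues q). incongruent q r \<xi>}"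
  let ?n = "(k - r) ^ (k - r) * r ^ r"
  obtain K where K: "0 \<le> K" and bound: "\<And>P Q a b \<Psi> \<Gamma> S \<delta>. stage_data P Q a b \<Psi> \<Longrightarrow>
      S \<subseteq> tuples r {1..\<lfloor>P\<rfloor>} \<times> tuples u {a<..b} \<Longrightarrow>
      (\<forall>C q. stage_prime C P \<Psi> q \<longrightarrow> admissible_residues k r u \<Psi> q (?n * q ^ (u + r - k)) (\<Gamma> q)) \<Longrightarrow>
      (\<forall>p\<in>S. \<delta> p \<noteq> 0 \<and> of_int \<bar>\<delta> p\<bar> \<le> P ^ (r ^ 2)) \<Longrightarrow>
      (\<forall>q. \<forall>p\<in>S. prime q \<longrightarrow> \<not> int q dvd \<delta> p \<longrightarrow> residue_pair q r u p \<in> \<Gamma> q) \<Longrightarrow>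
      real (energy k (mixed_sums \<Psi> r u) S) \<le> K * main_term P Q"
    by (rule energy_le_if_admissible[where n = ?n and M = "r ^ 2"], rule that)
  have "real (energy k (mixed_sums \<Psi> r u) ({x \<in> tuples r {1..\<lfloor>P\<rfloor>}. inj_on x {..<r}} \<times> tuples u {a<..b}))
      \<le> K * main_term P Q"
    if data: "stage_data P Q a b \<Psi>" for P Q a b \<Psi>
  proof (rule bound[OF data, where \<delta> = "\<lambda>p. pair_differences r (fst p)" and \<Gamma> = ?\<Gamma>])
    let ?D = "{x \<in> tuples r {1..\<lfloor>P\<rfloor>}. inj_on x {..<r}} \<times> tuples u {a<..b}"
    have P: "1 \<le> P" and \<Psi>: "graded_system k d \<Psi>"
      using data by (simp_all add: stage_data_def bounded_graded_system_def)
    show "?D \<subseteq> tuples r {1..\<lfloor>P\<rfloor>} \<times> tuples u {a<..b}" by auto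
    show "\<forall>C q. stage_prime C P \<Psi> q \<longrightarrow> admissible_residues k r u \<Psi> q (?n * q ^ (u + r - k)) (?\<Gamma> q)"
      using \<Psi> d k_le_u by (intro allI impI admissible_residues_graded) (auto simp: stage_prime_def)
    show "\<forall>p\<in>?D. pair_differences r (fst p) \<noteq> 0 \<and>
        of_int \<bar>pair_differences r (fst p)\<bar> \<le> P ^ (r ^ 2)"
    proof (rule ballI, clarsimp simp: pair_differences_nonzero)
      fix x assume "x \<in> tuples r {1..\<lfloor>P\<rfloor>}"
      hence "of_int \<bar>pair_differences r x\<bar> \<le> P ^ (r ^ 2)" using P by (intro pair_differences_le) (auto simp: PiE_iff)
      thus "\<bar>real_of_int (pair_differences r x)\<bar> \<le> P ^ (r ^ 2)" by simp
    qed
    show "\<forall>q. \<forall>p\<in>?D. prime q \<longrightarrow> \<not> int q dvd pair_differences r (fst p) \<longrightarrow> residue_pair q r u p \<in> ?\<Gamma> q"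
    proof (intro allI ballI impI)
      fix q and p :: "(nat \<Rightarrow> int) \<times> (nat \<Rightarrow> int)" assume q: "prime q" "\<not> int q dvd pair_differences r (fst p)"
      show "residue_pair q r u p \<in> ?\<Gamma> q"
        using residue_tuple_in[OF prime_gt_0_nat[OF q(1)]]
          incongruent_residue_tuple[OF incongruent_if_not_dvd_pair_differences[OF q(2)]]
        by (simp add: residue_pair_def map_prod_def case_prod_unfold)
    qed
  qed
  thus ?thesis by (rule that[OF K])
qed

lemma mixed_sums_energy_le:
  assumes "r = k - d"
  obtains K where "0 < K" "\<And>P Q a b \<Psi>. stage_data P Q a b \<Psi> \<Longrightarrow>
    real (energy k (mixed_sums \<Psi> r u) (tuples r {1..\<lfloor>P\<rfloor>} \<times> tuples u {a<..b})) \<le> K * main_term P Q"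
proof -
  obtain K where K: "0 \<le> K" and interval: "\<And>P Q a b \<Psi>. stage_data P Q a b \<Psi> \<Longrightarrow>
      P ^ r * real (energy k (power_sums u) (tuples u {a<..b})) \<le> K * main_term P Q"
    by (rule interval_energy_le, rule that)
  obtain K' where K': "0 \<le> K'" and distinct: "\<And>P Q a b \<Psi>. stage_data P Q a b \<Psi> \<Longrightarrow>
      real (energy k (mixed_sums \<Psi> r u) ({x \<in> tuples r {1..\<lfloor>P\<rfloor>}. inj_on x {..<r}} \<times> tuples u {a<..b}))
        \<le> K' * main_term P Q"
    by (rule distinct_entries_energy_le[OF assms], rule that)
  define N where "N = 4 * K' + (2 * real r ^ 2) ^ (r + 2) * K"
  have "real (energy k (mixed_sums \<Psi> r u) (tuples r {1..\<lfloor>P\<rfloor>} \<times> tuples u {a<..b})) \<le> (1 + N) * main_term P Q"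
    if data: "stage_data P Q a b \<Psi>" for P Q a b \<Psi>
  proof -
    let ?E = "energy k (mixed_sums \<Psi> r u)" and ?J = "real (energy k (power_sums u) (tuples u {a<..b}))"
    have P: "1 \<le> P" using data by (simp add: stage_data_def)
    have "real (card {1..\<lfloor>P\<rfloor>}) ^ r * ?J \<le> P ^ r * ?J"
      using P by (intro mult_right_mono power_mono) auto
    also note interval[OF data]
    finally have diagonal: "real (card {1..\<lfloor>P\<rfloor>}) ^ r * ?J \<le> K * main_term P Q" .
    have "real (?E (tuples r {1..\<lfloor>P\<rfloor>} \<times> tuples u {a<..b}))
        \<le> 4 * real (?E ({x \<in> tuples r {1..\<lfloor>P\<rfloor>}. inj_on x {..<r}} \<times> tuples u {a<..b}))
          + (2 * real r ^ 2) ^ (r + 2) * (real (card {1..\<lfloor>P\<rfloor>}) ^ r * ?J)"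
      unfolding mult.assoc[symmetric]
      using assms d_less_k by (intro energy_joint_sum_le_distinct finite_tuples) auto
    also have "\<dots> \<le> 4 * (K' * main_term P Q) + (2 * real r ^ 2) ^ (r + 2) * (K * main_term P Q)"
      using diagonal distinct[OF data] by (intro add_mono mult_left_mono) auto
    also have "\<dots> \<le> (1 + N) * main_term P Q"
      using main_term_nonneg[OF P] by (simp add: N_def algebra_simps)
    finally show ?thesis .
  qed
  moreover have "0 < 1 + N" using K K' by (simp add: N_def add_pos_nonneg)
  ultimately show ?thesis by (intro that[of "1 + N"])
qed

end

lemma (in mean_value_bound) stage_bound_if_ready:
  assumes "d < k" "0 < \<phi>" "\<phi> \<le> 1 / real k" "stage_ready d \<phi>"
  shows "stage_bound d \<phi>"
  unfolding stage_bound_def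
proof (intro allI impI)
  fix A B c :: real assume "0 \<le> A" "1 \<le> B" "0 < c"
  then interpret differencing_stage k u \<Lambda> CJ d "k - d" \<phi> A B c
    using assms by unfold_locales auto
  obtain K where K: "0 < K" and bound: "\<And>P Q a b \<Psi>. stage_data P Q a b \<Psi> \<Longrightarrow>
      real (energy k (mixed_sums \<Psi> (k - d) u) (tuples (k - d) {1..\<lfloor>P\<rfloor>} \<times> tuples u {a<..b})) \<le> K * main_term P Q"
    by (rule mixed_sums_energy_le[OF refl], rule that)
  show "\<exists>C>0. \<forall>P\<ge>1. \<forall>Q a b \<Psi>. c * P powr (real (k - d) / real k) \<le> Q \<longrightarrow> of_int (b - a) \<le> Q \<longrightarrow>
     bounded_graded_system k d (B * P powr A) \<Psi> \<longrightarrow>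
     real (energy k (mixed_sums \<Psi> (k - d) u) (tuples (k - d) {1..\<lfloor>P\<rfloor>} \<times> tuples u {a<..b}))
       \<le> C * (P powr (real (k - d) + \<phi> * prime_cost (k - d)) * Q powr \<Lambda>)"
    using K bound by (intro exI[of _ K]) (simp add: stage_data_def main_term_eq_powr)
qed

lemma energy_distinct_le_mixed_sums:
  assumes "finite X"
  shows "energy k (power_sums (r + u)) {x \<in> tuples (r + u) X. inj_on x {..<r + u}}
    \<le> energy k (mixed_sums (monom 1) r u) {p \<in> tuples r X \<times> tuples u X. inj_on (append_tuple r u p) {..<r + u}}"
    (is "energy _ _ ?D \<le> energy _ _ ?S")
proof (rule energy_le_inj[where f = "split_tuple r u"])
  have recover: "append_tuple r u (split_tuple r u x) = x" if "x \<in> ?D" for x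
    using that by (intro append_split_tuple) (auto simp: PiE_def)
  show "finite ?S" using assms by (simp add: finite_tuples)
  show "inj_on (split_tuple r u) ?D" by (metis (no_types, lifting) inj_onI recover)
  show "split_tuple r u ` ?D \<subseteq> ?S"
  proof (rule image_subsetI)
    fix x assume x: "x \<in> ?D"
    hence "split_tuple r u x \<in> tuples r X \<times> tuples u X" by (intro split_tuple_in) simp
    thus "split_tuple r u x \<in> ?S" using x by (simp add: recover[OF x])
  qed
  show "\<forall>j\<in>{1..k}. mixed_sums (monom 1) r u (split_tuple r u x) j = mixed_sums (monom 1) r u (split_tuple r u y) j"
    if "x \<in> ?D" "y \<in> ?D" "\<forall>j\<in>{1..k}. power_sums (r + u) x j = power_sums (r + u) y j" for x y
    using that by (simp add: mixed_sums_monom recover)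
qed

lemma (in differencing_stage) distinct_power_sums_energy_le:
  assumes "r = k - 1"
  obtains K where "0 \<le> K" "\<And>P Q. stage_data P Q 0 \<lfloor>P\<rfloor> (monom 1) \<Longrightarrow>
    real (energy k (power_sums (r + u)) {x \<in> tuples (r + u) {1..\<lfloor>P\<rfloor>}. inj_on x {..<r + u}}) \<le> K * main_term P Q"
proof -
  let ?\<delta> = "\<lambda>p. pair_differences (r + u) (append_tuple r u p)"
  let ?\<Gamma> = "\<lambda>q. {\<gamma> \<in> tuples r (residues q) \<times> tuples u (residues q). incongruent q (r + u) (append_tuple r u \<gamma>)}"
  obtain K where K: "0 \<le> K" and bound: "\<And>P Q a b \<Psi> \<Gamma> S \<delta>. stage_data P Q a b \<Psi> \<Longrightarrow>
      S \<subseteq> tuples r {1..\<lfloor>P\<rfloor>} \<times> tuples u {a<..b} \<Longrightarrow>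
      (\<forall>C q. stage_prime C P \<Psi> q \<longrightarrow> admissible_residues k r u \<Psi> q (k ^ k * q ^ (u + r - k)) (\<Gamma> q)) \<Longrightarrow>
      (\<forall>p\<in>S. \<delta> p \<noteq> 0 \<and> of_int \<bar>\<delta> p\<bar> \<le> P ^ ((r + u) ^ 2)) \<Longrightarrow>
      (\<forall>q. \<forall>p\<in>S. prime q \<longrightarrow> \<not> int q dvd \<delta> p \<longrightarrow> residue_pair q r u p \<in> \<Gamma> q) \<Longrightarrow>
      real (energy k (mixed_sums \<Psi> r u) S) \<le> K * main_term P Q"
    by (rule energy_le_if_admissible[where n = "k ^ k" and M = "(r + u) ^ 2"], rule that)
  have "real (energy k (power_sums (r + u)) {x \<in> tuples (r + u) {1..\<lfloor>P\<rfloor>}. inj_on x {..<r + u}}) \<le> K * main_term P Q"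
    if data: "stage_data P Q 0 \<lfloor>P\<rfloor> (monom 1)" for P Q
  proof -
    let ?S = "{p \<in> tuples r {1..\<lfloor>P\<rfloor>} \<times> tuples u {1..\<lfloor>P\<rfloor>}. inj_on (append_tuple r u p) {..<r + u}}"
    have P: "1 \<le> P" using data by (simp add: stage_data_def)
    have "real (energy k (mixed_sums (monom 1) r u) ?S) \<le> K * main_term P Q"
    proof (rule bound[OF data, where \<delta> = ?\<delta> and \<Gamma> = ?\<Gamma>])
      have "{0<..\<lfloor>P\<rfloor>} = {1..\<lfloor>P\<rfloor>}" by auto
      thus "?S \<subseteq> tuples r {1..\<lfloor>P\<rfloor>} \<times> tuples u {0<..\<lfloor>P\<rfloor>}" by auto
      show "\<forall>C q. stage_prime C P (monom 1) q \<longrightarrow> admissible_residues k r u (monom 1) q (k ^ k * q ^ (u + r - k)) (?\<Gamma> q)"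
        unfolding assms using k_ge_2 k_le_u by (intro allI impI admissible_residues_monom) (auto simp: stage_prime_def)
      show "\<forall>p\<in>?S. ?\<delta> p \<noteq> 0 \<and> of_int \<bar>?\<delta> p\<bar> \<le> P ^ ((r + u) ^ 2)"
      proof
        fix p assume p: "p \<in> ?S"
        hence "append_tuple r u p \<in> tuples (r + u) {1..\<lfloor>P\<rfloor>}" by (cases p) (simp add: append_tuple_in)
        hence "of_int \<bar>?\<delta> p\<bar> \<le> P ^ ((r + u) ^ 2)" using P by (intro pair_differences_le) (auto simp: PiE_iff)
        thus "?\<delta> p \<noteq> 0 \<and> of_int \<bar>?\<delta> p\<bar> \<le> P ^ ((r + u) ^ 2)" using p by (simp add: pair_differences_nonzero)
      qed
      show "\<forall>q. \<forall>p\<in>?S. prime q \<longrightarrow> \<not> int q dvd ?\<delta> p \<longrightarrow> residue_pair q r u p \<in> ?\<Gamma> q"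
      proof (intro allI ballI impI)
        fix q and p :: "(nat \<Rightarrow> int) \<times> (nat \<Rightarrow> int)" assume q: "prime q" "\<not> int q dvd ?\<delta> p"
        show "residue_pair q r u p \<in> ?\<Gamma> q"
          using incongruent_append_residue_pair[OF incongruent_if_not_dvd_pair_differences[OF q(2)]]
            residue_tuple_in[OF prime_gt_0_nat[OF q(1)]]
          by (simp add: residue_pair_def map_prod_def case_prod_unfold)
      qed
    qed
    thus ?thesis using energy_distinct_le_mixed_sums[of "{1..\<lfloor>P\<rfloor>}" k r u] by simp
  qed
  thus ?thesis by (rule that[OF K])
qed

lemma (in differencing_stage) power_sums_energy_le:
  assumes "r = k - 1"
  obtains K where "0 < K" "\<And>P Q. stage_data P Q 0 \<lfloor>P\<rfloor> (monom 1) \<Longrightarrow>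
    real (energy k (power_sums (r + u)) (tuples (r + u) {1..\<lfloor>P\<rfloor>})) \<le> K * main_term P Q"
proof -
  let ?n = "r + u"
  obtain K where K: "0 \<le> K" and interval: "\<And>P Q a b \<Psi>. stage_data P Q a b \<Psi> \<Longrightarrow>
      P ^ r * real (energy k (power_sums u) (tuples u {a<..b})) \<le> K * main_term P Q"
    by (rule interval_energy_le, rule that)
  obtain K' where K': "0 \<le> K'" and distinct: "\<And>P Q. stage_data P Q 0 \<lfloor>P\<rfloor> (monom 1) \<Longrightarrow>
      real (energy k (power_sums ?n) {x \<in> tuples ?n {1..\<lfloor>P\<rfloor>}. inj_on x {..<?n}}) \<le> K' * main_term P Q"
    by (rule distinct_power_sums_energy_le[OF assms], rule that)
  define N where "N = 4 * K' + (2 * real ?n ^ 2) ^ (?n + 2) * K"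
  have "real (energy k (power_sums ?n) (tuples ?n {1..\<lfloor>P\<rfloor>})) \<le> (1 + N) * main_term P Q"
    if data: "stage_data P Q 0 \<lfloor>P\<rfloor> (monom 1)" for P Q
  proof -
    let ?E = "energy k (power_sums ?n)" and ?J = "real (energy k (power_sums u) (tuples u {0<..\<lfloor>P\<rfloor>}))"
    have P: "1 \<le> P" using data by (simp add: stage_data_def)
    have "{0<..\<lfloor>P\<rfloor>} = {1..\<lfloor>P\<rfloor>}" by auto
    hence "real (card {1..\<lfloor>P\<rfloor>}) ^ u \<le> ?J"
      using card_le_energy[OF finite_tuples, of "{1..\<lfloor>P\<rfloor>}" u k "power_sums u"] by (simp add: card_PiE)
    hence "real (card {1..\<lfloor>P\<rfloor>}) ^ ?n \<le> P ^ r * ?J"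
      using P unfolding power_add by (intro mult_mono power_mono) auto
    also note interval[OF data]
    finally have diagonal: "real (card {1..\<lfloor>P\<rfloor>}) ^ ?n \<le> K * main_term P Q" .
    have "real (?E (tuples ?n {1..\<lfloor>P\<rfloor>})) \<le> 4 * real (?E {x \<in> tuples ?n {1..\<lfloor>P\<rfloor>}. inj_on x {..<?n}})
        + (2 * real ?n ^ 2) ^ (?n + 2) * real (card {1..\<lfloor>P\<rfloor>}) ^ ?n"
      using u_pos by (intro energy_tuple_sum_le_distinct) auto
    also have "\<dots> \<le> 4 * (K' * main_term P Q) + (2 * real ?n ^ 2) ^ (?n + 2) * (K * main_term P Q)"
      using diagonal distinct[OF data] by (intro add_mono mult_left_mono) auto
    also have "\<dots> \<le> (1 + N) * main_term P Q"
      using main_term_nonneg[OF P] by (simp add: N_def algebra_simps)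
    finally show ?thesis .
  qed
  moreover have "0 < 1 + N" using K K' by (simp add: N_def add_pos_nonneg)
  ultimately show ?thesis by (intro that[of "1 + N"])
qed

lemma (in mean_value_bound) extended_mean_value:
  assumes "0 < \<phi>" "\<phi> \<le> 1 / real k" "stage_ready 0 \<phi>"
  shows "\<exists>C>0. \<forall>P\<ge>1. real (energy k (power_sums (k - 1 + u)) (tuples (k - 1 + u) {1..\<lfloor>P\<rfloor>}))
    \<le> C * P powr (real (k - 1) + \<phi> * prime_cost (k - 1) + \<Lambda>)"
proof -
  interpret differencing_stage k u \<Lambda> CJ 0 "k - 1" \<phi> 0 1 1
    using assms k_ge_2 by unfold_locales auto
  obtain K where K: "0 < K" and bound: "\<And>P Q. stage_data P Q 0 \<lfloor>P\<rfloor> (monom 1) \<Longrightarrow>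
      real (energy k (power_sums (k - 1 + u)) (tuples (k - 1 + u) {1..\<lfloor>P\<rfloor>})) \<le> K * main_term P Q"
    by (rule power_sums_energy_le[OF refl], rule that)
  have "real (energy k (power_sums (k - 1 + u)) (tuples (k - 1 + u) {1..\<lfloor>P\<rfloor>}))
      \<le> K * P powr (real (k - 1) + \<phi> * prime_cost (k - 1) + \<Lambda>)" if P: "1 \<le> P" for P
  proof -
    have "stage_data P P 0 \<lfloor>P\<rfloor> (monom 1)"
      using P k_ge_2 bounded_graded_system_monom by (simp add: stage_data_def)
    from bound[OF this] show ?thesis by (simp only: main_term_eq_powr[OF P] powr_add)
  qed
  thus ?thesis using K by blast
qed

section \<open>The mean value as a solution count\<close>

lemma e_eq_cis: "e z = cis (2 * pi * z)"
  by (simp add: e_def cis_conv_exp mult_ac)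

lemma e_add: "e (a + b) = e a * e b"
  by (simp add: e_eq_cis cis_mult distrib_left)

lemma e_sum: "e (\<Sum>i\<in>I. f i) = (\<Prod>i\<in>I. e (f i))"
  by (induction I rule: infinite_finite_induct) (simp_all add: e_add, simp_all add: e_eq_cis)

lemma cnj_e: "cnj (e a) = e (- a)"
  by (simp add: e_eq_cis cis_cnj)

lemma set_integrable_e:
  fixes c :: real
  shows "set_integrable lborel {0..<1} (\<lambda>a. e (a * c))"
proof -
  have "continuous_on {0..1} (\<lambda>a. e (a * c))"
    unfolding e_eq_cis cis_conv_exp by (intro continuous_intros)
  hence "set_integrable lborel {0..1} (\<lambda>a. e (a * c))" by (rule borel_integrable_atLeastAtMost')
  thus ?thesis by (rule set_integrable_subset) auto
qed

lemma LINT_e: "(LINT a:{0..<1}|lborel. e (a * of_int n)) = (if n = 0 then 1 else 0)"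
proof (cases "n = 0")
  case True
  thus ?thesis by (simp add: e_eq_cis set_lebesgue_integral_def)
next
  case False
  define c where "c = 2 * complex_of_real pi * \<i> * of_int n"
  have c: "c \<noteq> 0" using False by (simp add: c_def)
  have e: "e (a * of_int n) = exp (c * of_real a)" for a
    by (simp add: e_def c_def mult_ac)
  have continuous: "continuous_on {0..1} (\<lambda>a. e (a * of_int n))"
    unfolding e by (intro continuous_intros)
  have measurable: "set_borel_measurable lborel A (\<lambda>a. e (a * of_int n))" if "A \<in> sets borel" for A
    unfolding set_borel_measurable_def e using that
    by (intro borel_measurable_scaleR borel_measurable_indicator borel_measurable_continuous_onI continuous_intros) auto
  have "(LINT a:{0..<1}|lborel. e (a * of_int n)) = (LINT a:{0..1}|lborel. e (a * of_int n))"
  proof (rule set_integral_cong_set)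
    show "AE a in lborel. (a \<in> {0..1::real}) = (a \<in> {0..<1})"
      using AE_lborel_singleton[of 1] by eventually_elim auto
  qed (auto intro: measurable)
  also have "\<dots> = exp (c * of_real 1) / c - exp (c * of_real 0) / c"
    unfolding set_lebesgue_integral_def
  proof (rule integral_FTC_Icc)
    show "((\<lambda>a. exp (c * of_real a) / c) has_vector_derivative e (x * of_int n)) (at x within {0..1})" for x
      unfolding e using c
      by (auto intro!: derivative_eq_intros has_vector_derivative_real_field simp: field_simps)
  qed (auto intro: continuous)
  also have "exp (c * of_real 1) = 1"
    using e[of 1] cis_multiple_2pi[of "of_int n"] by (simp add: e_eq_cis)
  finally show ?thesis using False by simp
qed

abbreviation lborel_prod :: "nat \<Rightarrow> (nat \<Rightarrow> real) measure" where
  "lborel_prod k \<equiv> \<Pi>\<^sub>M i\<in>{1..k}. lborel"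

abbreviation unit_cube :: "nat \<Rightarrow> (nat \<Rightarrow> real) set" where
  "unit_cube k \<equiv> \<Pi>\<^sub>E i\<in>{1..k}. {0..<1}"

lemma indicator_unit_cube_scaleR_e:
  assumes "\<alpha> \<in> space (lborel_prod k)"
  shows "indicator (unit_cube k) \<alpha> *\<^sub>R e (\<Sum>i=1..k. \<alpha> i * c i)
    = (\<Prod>i\<in>{1..k}. indicator {0..<1::real} (\<alpha> i) *\<^sub>R e (\<alpha> i * c i))"
proof -
  have "\<alpha> \<in> extensional {1..k}" using assms by (simp add: space_PiM PiE_def)
  hence "indicator (unit_cube k) \<alpha> = (\<Prod>i\<in>{1..k}. indicator {0..<1::real} (\<alpha> i) :: real)"
    by (auto simp: indicator_def PiE_iff)
  thus ?thesis by (simp add: e_sum scaleR_conv_of_real prod.distrib)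
qed

lemma integrable_unit_cube_e:
  fixes c :: "nat \<Rightarrow> real"
  shows "set_integrable (lborel_prod k) (unit_cube k) (\<lambda>\<alpha>. e (\<Sum>i=1..k. \<alpha> i * c i))"
proof -
  interpret product_sigma_finite "\<lambda>_::nat. lborel :: real measure" by standard
  have "integrable (lborel_prod k) (\<lambda>\<alpha>. \<Prod>i\<in>{1..k}. indicator {0..<1::real} (\<alpha> i) *\<^sub>R e (\<alpha> i * c i))"
    using set_integrable_e unfolding set_integrable_def by (intro product_integrable_prod) auto
  thus ?thesis
    unfolding set_integrable_def
    by (subst Bochner_Integration.integrable_cong[OF refl indicator_unit_cube_scaleR_e])
qed

lemma integral_unit_cube_e:
  fixes v :: "nat \<Rightarrow> int"
  shows "(LINT \<alpha>:unit_cube k|lborel_prod k. e (\<Sum>i=1..k. \<alpha> i * of_int (v i))) = (if \<forall>i\<in>{1..k}. v i = 0 then 1 else 0)"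
proof -
  interpret product_sigma_finite "\<lambda>_::nat. lborel :: real measure" by standard
  have "(LINT \<alpha>:unit_cube k|lborel_prod k. e (\<Sum>i=1..k. \<alpha> i * of_int (v i)))
      = (LINT \<alpha>|lborel_prod k. (\<Prod>i\<in>{1..k}. indicator {0..<1::real} (\<alpha> i) *\<^sub>R e (\<alpha> i * of_int (v i))))"
    unfolding set_lebesgue_integral_def by (intro Bochner_Integration.integral_cong refl indicator_unit_cube_scaleR_e)
  also have "\<dots> = (\<Prod>i\<in>{1..k}. LINT a:{0..<1}|lborel. e (a * of_int (v i)))"
    unfolding set_lebesgue_integral_def
    using set_integrable_e unfolding set_integrable_def by (intro product_integral_prod) auto
  also have "\<dots> = (if \<forall>i\<in>{1..k}. v i = 0 then 1 else 0)" by (auto simp: LINT_e)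
  finally show ?thesis .
qed

lemma exponential_sum_power_eq:
  assumes "finite X"
  shows "(\<Sum>x\<in>X. e (\<Sum>i=1..k. \<alpha> i * of_int x ^ i)) ^ s = (\<Sum>x\<in>tuples s X. e (\<Sum>i=1..k. \<alpha> i * of_int (power_sums s x i)))"
proof -
  have "(\<Sum>x\<in>X. e (\<Sum>i=1..k. \<alpha> i * of_int x ^ i)) ^ s
      = (\<Sum>x\<in>tuples s X. \<Prod>m<s. e (\<Sum>i=1..k. \<alpha> i * of_int (x m) ^ i))"
    using assms prod_sum_PiE[of "{..<s}" "\<lambda>_. X" "\<lambda>_ x. e (\<Sum>i=1..k. \<alpha> i * of_int x ^ i)"] by simp
  also have "\<dots> = (\<Sum>x\<in>tuples s X. e (\<Sum>i=1..k. \<alpha> i * of_int (power_sums s x i)))"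
    unfolding e_sum[symmetric] sum.swap[of _ "{1..k}" "{..<s}"] by (simp add: tuple_sum_def sum_distrib_left)
  finally show ?thesis .
qed

lemma norm_exponential_sum_power_eq:
  assumes "finite X"
  shows "complex_of_real (cmod (\<Sum>x\<in>X. e (\<Sum>i=1..k. \<alpha> i * of_int x ^ i)) ^ (2 * s))
    = (\<Sum>p\<in>tuples s X \<times> tuples s X. e (\<Sum>i=1..k. \<alpha> i * of_int (power_sums s (fst p) i - power_sums s (snd p) i)))"
proof -
  let ?S = "\<Sum>x\<in>X. e (\<Sum>i=1..k. \<alpha> i * of_int x ^ i)" and ?c = "\<lambda>x. \<Sum>i=1..k. \<alpha> i * of_int (power_sums s x i)"
  have "complex_of_real (cmod ?S ^ (2 * s)) = ?S ^ s * cnj (?S ^ s)"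
    by (simp only: complex_norm_square[symmetric] norm_power power_mult[symmetric] mult.commute of_real_power)
  also have "\<dots> = (\<Sum>x\<in>tuples s X. \<Sum>y\<in>tuples s X. e (?c x) * e (- ?c y))"
    unfolding exponential_sum_power_eq[OF assms] cnj_sum cnj_e by (rule sum_product)
  also have "\<dots> = (\<Sum>p\<in>tuples s X \<times> tuples s X. e (?c (fst p) - ?c (snd p)))"
    by (simp add: e_add[symmetric] sum.cartesian_product case_prod_unfold)
  finally show ?thesis by (simp add: sum_subtractf[symmetric] right_diff_distrib)
qed

lemma int_image_positive_nats_le: "int ` {x. 1 \<le> x \<and> real x \<le> P} = {1..\<lfloor>P\<rfloor>}"
proof
  show "{1..\<lfloor>P\<rfloor>} \<subseteq> int ` {x. 1 \<le> x \<and> real x \<le> P}"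
  proof
    fix x assume "x \<in> {1..\<lfloor>P\<rfloor>}"
    hence "x = int (nat x)" "nat x \<in> {x. 1 \<le> x \<and> real x \<le> P}" by (auto simp: le_floor_iff)
    thus "x \<in> int ` {x. 1 \<le> x \<and> real x \<le> P}" by blast
  qed
qed (auto simp: le_floor_iff)

lemma vinogradov_J_eq_energy:
  "vinogradov_J s k P = real (energy k (power_sums s) (tuples s {1..\<lfloor>P\<rfloor>}))"
proof -
  let ?N = "{x::nat. 1 \<le> x \<and> real x \<le> P}" and ?T = "tuples s {1..\<lfloor>P\<rfloor>}"
  let ?S = "\<lambda>\<alpha>. \<Sum>x\<in>{1..\<lfloor>P\<rfloor>}. e (\<Sum>i=1..k. \<alpha> i * of_int x ^ i)"
  let ?v = "\<lambda>p i. power_sums s (fst p) i - power_sums s (snd p) i"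
  have sums: "(\<Sum>x\<in>?N. e (\<Sum>i=1..k. \<alpha> i * real x ^ i)) = ?S \<alpha>" for \<alpha>
    unfolding int_image_positive_nats_le[symmetric] by (simp add: sum.reindex)
  have "complex_of_real (vinogradov_J s k P) = (LINT \<alpha>:unit_cube k|lborel_prod k. complex_of_real (cmod (?S \<alpha>) ^ (2 * s)))"
    unfolding vinogradov_J_def sums by (rule set_integral_complex_of_real[symmetric])
  also have "\<dots> = (LINT \<alpha>:unit_cube k|lborel_prod k. \<Sum>p\<in>?T \<times> ?T. e (\<Sum>i=1..k. \<alpha> i * of_int (?v p i)))"
    by (simp only: norm_exponential_sum_power_eq finite_atLeastAtMost_int)
  also have "\<dots> = (\<Sum>p\<in>?T \<times> ?T. LINT \<alpha>:unit_cube k|lborel_prod k. e (\<Sum>i=1..k. \<alpha> i * of_int (?v p i)))"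
    unfolding set_lebesgue_integral_def scaleR_sum_right
    using integrable_unit_cube_e unfolding set_integrable_def by (intro Bochner_Integration.integral_sum)
  also have "\<dots> = (\<Sum>p\<in>?T \<times> ?T. if p \<in> collisions k (power_sums s) ?T then 1 else 0)"
    unfolding integral_unit_cube_e
    by (intro sum.cong[OF refl] if_cong) (simp_all add: collisions_def case_prod_unfold mem_Times_iff)
  also have "\<dots> = (\<Sum>p\<in>?T \<times> ?T \<inter> collisions k (power_sums s) ?T. 1)"
    by (intro sum.inter_restrict[symmetric] finite_cartesian_product finite_tuples) simp_all
  also have "?T \<times> ?T \<inter> collisions k (power_sums s) ?T = collisions k (power_sums s) ?T"
    by (auto simp: collisions_def)
  finally have "complex_of_real (vinogradov_J s k P) = of_real (real (energy k (power_sums s) ?T))"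
    by (simp add: energy_def)
  thus ?thesis by (simp only: of_real_eq_iff)
qed

section \<open>The recursion for the exponents\<close>

lemma energy_interval_le: "energy k (power_sums u) (tuples u {a<..b}) \<le> energy k (power_sums u) (tuples u {1..b - a})"
proof (rule energy_le_inj[where f = "\<lambda>z. \<lambda>m\<in>{..<u}. z m - a"])
  let ?shift = "\<lambda>z :: nat \<Rightarrow> int. \<lambda>m\<in>{..<u}. z m - a"
  show "inj_on ?shift (tuples u {a<..b})"
  proof (rule inj_onI)
    fix z w assume z: "z \<in> tuples u {a<..b}" and w: "w \<in> tuples u {a<..b}" and eq: "?shift z = ?shift w"
    show "z = w"
    proof (rule PiE_ext[OF z w])
      show "z m = w m" if "m \<in> {..<u}" for m using fun_cong[OF eq, of m] that by simp
    qed
  qed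
  show "?shift ` tuples u {a<..b} \<subseteq> tuples u {1..b - a}" by (force simp: PiE_iff)
  fix z w :: "nat \<Rightarrow> int" assume eq: "\<forall>j\<in>{1..k}. power_sums u z j = power_sums u w j"
  have "power_sums u (\<lambda>m. z m - a) j = power_sums u (\<lambda>m. w m - a) j" if "j \<in> {1..k}" for j
    using translate_collision[where \<Psi> = "\<lambda>_. 0" and r = 0 and u = u and k = k and z = z and w = w] eq that
    by (simp add: tuple_sum_def)
  thus "\<forall>j\<in>{1..k}. power_sums u (?shift z) j = power_sums u (?shift w) j"
    by (simp add: tuple_sum_def)
qed (simp add: finite_tuples)

lemma mean_value_bound_if_vinogradov_J_le:
  assumes "2 \<le> k" "k \<le> u" "0 < C" and bound: "\<forall>P\<ge>1. vinogradov_J u k P \<le> C * P powr \<Lambda>"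
  shows "mean_value_bound k u \<Lambda> C"
proof
  fix a b and L :: real assume L: "1 \<le> L" "of_int (b - a) \<le> L"
  have "energy k (power_sums u) (tuples u {a<..b}) \<le> energy k (power_sums u) (tuples u {1..b - a})"
    by (rule energy_interval_le)
  also have "\<dots> \<le> energy k (power_sums u) (tuples u {1..\<lfloor>L\<rfloor>})"
    using L(2) by (intro energy_mono finite_tuples PiE_mono) (auto simp: le_floor_iff)
  finally have "real (energy k (power_sums u) (tuples u {a<..b})) \<le> vinogradov_J u k L"
    by (simp add: vinogradov_J_eq_energy)
  also have "\<dots> \<le> C * L powr \<Lambda>" using bound L(1) by blast
  finally show "real (energy k (power_sums u) (tuples u {a<..b})) \<le> C * L powr \<Lambda>" .
qed (use assms in auto)

lemma phi_terminal: "j \<le> J \<Longrightarrow> phi k D j J = 1 / real k"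
  by (simp add: phi.simps)

lemma phi_rec: "J < j \<Longrightarrow> phi k D j J = min (1 / real k) (phi_step k D (J + 1) (phi k D j (J + 1)))"
  by (subst phi.simps) simp

lemma phi_step_pos:
  assumes "D \<le> real k * (real k + 1) / 2" "J < k" "0 < x" "x \<le> 1 / real k"
  shows "0 < phi_step k D (J + 1) x"
proof -
  define m where "m = real k - real J"
  define N where "N = real J * (real J - 1) / 2 - D"
  have m: "1 \<le> m" using assms(2) unfolding m_def by linarith
  have k: "0 < real k" using assms(2) by simp
  have "2 * real k * m + (real J * (real J - 1) / 2 - real k * (real k + 1) / 2) = real k * (m - 1) + (m * m + m) / 2"
    by (simp add: m_def field_simps)
  moreover have "0 < real k * (m - 1) + (m * m + m) / 2"
    using m by (intro add_nonneg_pos) (auto intro!: add_pos_pos)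
  ultimately have "- (2 * real k * m) < N" using assms(1) by (simp add: N_def)
  hence "- 1 < N / (2 * real k * m)" using m k by (simp add: field_simps)
  hence "- (1 / 2) * x < (1 / 2 + N / (2 * real k * m)) * x"
    using assms(3) by (intro mult_strict_right_mono) auto
  moreover have "phi_step k D (J + 1) x = 1 / (2 * real k) + (1 / 2 + N / (2 * real k * m)) * x"
    by (simp add: phi_step_def N_def m_def)
  ultimately show ?thesis using assms(4) by simp
qed

lemma phi_bounds:
  assumes "2 \<le> k" "D \<le> real k * (real k + 1) / 2" "j \<le> k"
  shows "0 < phi k D j J" and "phi k D j J \<le> 1 / real k"
proof -
  have "0 < phi k D j J \<and> phi k D j J \<le> 1 / real k"
  proof (induction "j - J" arbitrary: J)
    case 0
    thus ?case using assms(1) by (simp add: phi_terminal)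
  next
    case (Suc n)
    hence "J < j" by simp
    moreover have "0 < phi k D j (J + 1) \<and> phi k D j (J + 1) \<le> 1 / real k"
      using Suc.hyps(1)[of "J + 1"] Suc.hyps(2) by simp
    ultimately show ?case
      using assms by (simp add: phi_rec phi_step_pos[unfolded Suc_eq_plus1[symmetric]])
  qed
  thus "0 < phi k D j J" "phi k D j J \<le> 1 / real k" by blast+
qed

lemma theta_attained:
  assumes "1 \<le> k"
  obtains j where "j \<in> {1..k}" "theta k D = phi k D j 1"
proof -
  have "theta k D \<in> (\<lambda>j. phi k D j 1) ` {1..k}"
    unfolding theta_def using assms by (intro Min_in) auto
  thus ?thesis using that by blast
qed

lemma theta_bounds:
  assumes "2 \<le> k" "D \<le> real k * (real k + 1) / 2"
  shows "0 < theta k D" and "theta k D \<le> 1 / real k"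
proof -
  have "1 \<le> k" using assms(1) by simp
  then obtain j where "j \<in> {1..k}" "theta k D = phi k D j 1" by (rule theta_attained)
  thus "0 < theta k D" "theta k D \<le> 1 / real k" using phi_bounds[OF assms] by auto
qed

lemma real_Suc_choose_two: "real (Suc r choose 2) = real r * (real r + 1) / 2"
  by (induction r) (simp_all add: numeral_2_eq_2 field_simps)

context mean_value_bound
begin

lemma prime_cost_eq:
  assumes "\<Lambda> = 2 * real u - real k * (real k + 1) / 2 + D"
  shows "prime_cost r = real k * (real k - 1) / 2 + real r * (real r + 1) / 2 - D"
proof -
  have "prime_cost r = real (2 * u - k) + real (Suc r choose 2) - \<Lambda>" by (simp add: prime_cost_def)
  also have "real (2 * u - k) = 2 * real u - real k" using k_le_u by (simp add: of_nat_diff)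
  finally have "prime_cost r = real r * (real r + 1) / 2 + (2 * real u - real k - \<Lambda>)"
    by (simp add: real_Suc_choose_two)
  moreover have "2 * real u - real k - \<Lambda> = real k * (real k - 1) / 2 - D" using assms by (simp add: field_simps)
  ultimately show ?thesis by linarith
qed

lemma phi_step_prime_cost_eq:
  assumes "\<Lambda> = 2 * real u - real k * (real k + 1) / 2 + D" "J < k"
  shows "2 * real k * real (k - J) * phi_step k D (J + 1) x = real (k - J) + x * prime_cost (k - J)"
proof -
  define m where "m = real k - real J"
  define N where "N = real J * (real J - 1) / 2 - D"
  have m: "m \<noteq> 0" "real (k - J) = m" and k: "real k \<noteq> 0" using assms(2) by (simp_all add: m_def of_nat_diff)
  have J: "real J = real k - m" by (simp add: m_def)
  have "phi_step k D (J + 1) x = 1 / (2 * real k) + (1 / 2 + N / (2 * real k * m)) * x"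
    by (simp add: phi_step_def N_def m_def)
  hence "2 * real k * m * phi_step k D (J + 1) x = m + x * (real k * m + N)"
    using m k by (simp add: field_simps)
  moreover have "prime_cost (k - J) = real k * m + N"
    unfolding prime_cost_eq[OF assms(1)] m(2) N_def J by (simp add: field_simps)
  ultimately show ?thesis by (simp add: m(2))
qed

lemma stage_ready_phi:
  assumes "\<Lambda> = 2 * real u - real k * (real k + 1) / 2 + D" "J < j" "j \<le> k"
    and next_stage: "J + 1 < j \<Longrightarrow> stage_bound (J + 1) (phi k D j (J + 2))"
  shows "stage_ready J (phi k D j (J + 1))"
proof (cases "phi k D j (J + 1) = 1 / real k")
  case True
  thus ?thesis by (simp add: stage_ready_def)
next
  case False
  hence less: "J + 1 < j" using assms(2) phi_terminal[of j "J + 1"] by (metis Suc_eq_plus1 Suc_lessI order_refl)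
  hence "phi k D j (J + 1) = phi_step k D (J + 1 + 1) (phi k D j (J + 2))"
    using False phi_rec[of "J + 1" j k D] by (auto simp: min_def split: if_splits)
  hence "real (k - (J + 1)) + phi k D j (J + 2) * prime_cost (k - (J + 1))
      = 2 * real k * real (k - (J + 1)) * phi k D j (J + 1)"
    using phi_step_prime_cost_eq[OF assms(1), of "J + 1"] less assms(3) by simp
  thus ?thesis using next_stage[OF less] less assms(3) unfolding stage_ready_def by auto
qed

lemma stage_bound_phi:
  assumes \<Lambda>: "\<Lambda> = 2 * real u - real k * (real k + 1) / 2 + D" and D: "D \<le> real k * (real k + 1) / 2"
    and j: "j \<le> k"
  shows "J < j \<Longrightarrow> stage_bound J (phi k D j (J + 1))"
proof (induction "j - J" arbitrary: J)
  case (Suc n)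
  have "stage_bound (J + 1) (phi k D j (J + 2))" if "J + 1 < j"
    using Suc.hyps(1)[of "J + 1"] Suc.hyps(2) that by simp
  hence "stage_ready J (phi k D j (J + 1))" by (rule stage_ready_phi[OF \<Lambda> Suc.prems j])
  thus ?case using Suc.prems j phi_bounds[OF k_ge_2 D j] by (intro stage_bound_if_ready) auto
qed simp

lemma extended_mean_value_theta:
  assumes \<Lambda>: "\<Lambda> = 2 * real u - real k * (real k + 1) / 2 + D" and D: "D \<le> real k * (real k + 1) / 2"
  shows "\<exists>C>0. \<forall>P\<ge>1. vinogradov_J (u + (k - 1)) k P
    \<le> C * P powr (real (k - 1) + theta k D * prime_cost (k - 1) + \<Lambda>)"
proof -
  have "1 \<le> k" using k_ge_2 by simp
  then obtain j where j: "j \<in> {1..k}" and theta: "theta k D = phi k D j 1" by (rule theta_attained)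
  have "stage_ready 0 (phi k D j (0 + 1))"
    using j by (intro stage_ready_phi[OF \<Lambda>]) (auto intro: stage_bound_phi[OF \<Lambda> D, of _ 1, simplified])
  hence "stage_ready 0 (theta k D)" by (simp add: theta)
  thus ?thesis
    using extended_mean_value[OF theta_bounds[OF k_ge_2 D]] by (simp add: vinogradov_J_eq_energy add.commute)
qed

end

lemma vinogradov_J_step:
  assumes "2 \<le> k" "k \<le> u" "D \<le> real k * (real k + 1) / 2"
    and "\<exists>C>0. \<forall>P\<ge>1. vinogradov_J u k P \<le> C * P powr (2 * real u - real k * (real k + 1) / 2 + D)"
  shows "\<exists>C>0. \<forall>P\<ge>1. vinogradov_J (u + (k - 1)) k P \<le> C * P powr (2 * real (u + (k - 1)) - real k * (real k + 1) / 2
     + (D * (1 - theta k D) + (real k - 1) * (real k * theta k D - 1)))"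
proof -
  let ?\<Lambda> = "2 * real u - real k * (real k + 1) / 2 + D"
  obtain C where "0 < C" "\<forall>P\<ge>1. vinogradov_J u k P \<le> C * P powr ?\<Lambda>" using assms(4) by blast
  then interpret mean_value_bound k u ?\<Lambda> C by (intro mean_value_bound_if_vinogradov_J_le assms)
  have "real (k - 1) + theta k D * prime_cost (k - 1) + ?\<Lambda>
      = 2 * real (u + (k - 1)) - real k * (real k + 1) / 2
        + (D * (1 - theta k D) + (real k - 1) * (real k * theta k D - 1))"
    unfolding prime_cost_eq[OF refl] using assms(1) by (simp add: of_nat_diff field_simps)
  thus ?thesis using extended_mean_value_theta[OF refl assms(3)] by (simp only:)
qed

lemma Delta_le:
  assumes "2 \<le> k" "\<mu> \<le> 2 * real t"
  shows "Delta t k \<mu> l \<le> real k * (real k + 1) / 2"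
proof (induction l)
  case 0
  show ?case using assms(2) by simp
next
  case (Suc l)
  let ?D = "Delta t k \<mu> l" and ?x = "theta k (Delta t k \<mu> l)"
  have x: "0 < ?x" "?x \<le> 1 / real k" using theta_bounds[OF assms(1) Suc] by auto
  have "real k * ?x \<le> 1" using assms(1) x(2) by (simp add: field_simps)
  hence "(real k - 1) * (real k * ?x - 1) \<le> 0" using assms(1) by (intro mult_nonneg_nonpos) auto
  moreover have "1 / real k \<le> 1" using assms(1) by simp
  hence "?D * (1 - ?x) \<le> real k * (real k + 1) / 2 * (1 - ?x)"
    using Suc x(2) by (intro mult_right_mono) auto
  moreover have "real k * (real k + 1) / 2 * (1 - ?x) \<le> real k * (real k + 1) / 2 * 1"
    using x(1) by (intro mult_left_mono) auto
  ultimately show ?case by simp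
qed

theorem theorem3p1:
  fixes t k :: nat and \<mu> :: real
  assumes "2 \<le> k" and "k \<le> t"
    and "2 * real t - real k * (real k + 1) / 2 < \<mu>" and "\<mu> \<le> 2 * real t"
    and "\<exists>C>0. \<forall>P\<ge>1. vinogradov_J t k P \<le> C * P powr \<mu>"
  shows "\<forall>l\<ge>1. \<exists>C>0. \<forall>P\<ge>1. vinogradov_J (t + l * (k - 1)) k P \<le> C * P powr lam t k \<mu> l"
proof -
  have "\<exists>C>0. \<forall>P\<ge>1. vinogradov_J (t + l * (k - 1)) k P \<le> C * P powr lam t k \<mu> l" for l
  proof (induction l)
    case 0
    show ?case using assms(5) by (simp add: lam_def)
  next
    case (Suc l)
    have "k \<le> t + l * (k - 1)" using assms(2) by simp
    from vinogradov_J_step[OF assms(1) this Delta_le[OF assms(1,4)] Suc[unfolded lam_def]]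
    show ?case by (simp add: lam_def add_ac)
  qed
  thus ?thesis by blast
qed

end
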